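(* Let $\mathcal{P}_+$ be a local functional of fermion number $N_F=1$ each of whose monomials consists only of $+$fields, with at least one field. If $Q_-\mathcal{P}_+=0$, then $$\mathcal{P}_+=\mathcal{C}_+ + Q_-\mathcal{Q}_+,$$ where $\mathcal{C}_+$ is a (possibly zero) finite linear combination of $+$type CLR terms with $N_F=1$, and $\mathcal{Q}_+$ is a local functional of fermion number $N_F=2$ each of whose monomials consists only of $+$fields, with at least one field. Similarly, let $\mathcal{P}_-$ be a local functional with $N_F=1$ each of whose monomials consists only of $-$fields, with at least one field. If $Q_+\mathcal{P}_-=0$, then $\mathcal{P}_-=\mathcal{C}_- + Q_+\mathcal{Q}_-$, where $\mathcal{C}_-$ is a (possibly zero) finite linear combination of $-$type CLR terms with $N_F=1$, and $\mathcal{Q}_-$ is a local functional with $N_F=2$ each of whose monomials consists only of $-$fields, with at least one field.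
   Context: Lattice sites are labelled by integers $n$ (lattice spacing $1$). For each site $n$ there are Grassmann-even variables $\phi_{+n},\phi_{-n},F_{+n},F_{-n}$ and Grassmann-odd variables $\chi_{+n},\chi_{-n},\bar\chi_{+n},\bar\chi_{-n}$. Variables with subscript $+$ (resp. $-$) are called $+$fields (resp. $-$fields). The fermion number $N_F$ is additive, with $N_F=0$ for $\phi_\pm,F_\pm$, $N_F=+1$ for $\chi_\pm$, and $N_F=-1$ for $\bar\chi_\pm$. A coefficient $C_{m_0m_1\cdots m_I}\in\mathbb{C}$ is a translationally invariant local coefficient (TILC) if (i) $C_{m_0+1,\dots,m_I+1}=C_{m_0,\dots,m_I}$, so that $C_{m_0\cdots m_I}=C(m_0-m_1,\dots,m_0-m_I)$, and (ii) there exist $L,M>0$ such that $|C(k_1,\dots,k_I)|<L\,e^{-M|k_\ell|}$ for each $\ell$ whenever $|k_\ell|$ is large. A local functional is a finite sum of terms $\sum_{m_0,\dots,m_I}C_{m_0\cdots m_I}X^{(0)}_{m_0}\cdots X^{(I)}_{m_I}$, where $C$ is a TILC and each $X^{(j)}$ is one of the lattice variables above. The difference operator $\nabla$ is a two-index TILC, $\nabla_{mn}=\nabla(m-n)$, with $(\nabla X)_m=\sum_n\nabla_{mn}X_n$, and its generating function $\tilde\nabla(z)=\sum_k\nabla(k)z^k$ satisfies $\tilde\nabla(1)=0$. $Q_+$ and $Q_-$ are Grassmann-odd derivations, obeying $Q(AB)=(QA)B+(-1)^{|A|}A(QB)$ with $|A|$ the Grassmann parity of $A$. On the variables they act as follows.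 - $Q_+$: $\phi_{+n}\mapsto\bar\chi_{+n}$, $\bar\chi_{+n}\mapsto0$, $\chi_{+n}\mapsto F_{+n}$, $F_{+n}\mapsto0$, $\phi_{-n}\mapsto0$, $\bar\chi_{-n}\mapsto0$, $\chi_{-n}\mapsto -i(\nabla\phi_-)_n$, $F_{-n}\mapsto -i(\nabla\bar\chi_-)_n$. - $Q_-$: $\phi_{-n}\mapsto-\bar\chi_{-n}$, $\bar\chi_{-n}\mapsto0$, $\chi_{-n}\mapsto F_{-n}$, $F_{-n}\mapsto0$, $\phi_{+n}\mapsto0$, $\bar\chi_{+n}\mapsto0$, $\chi_{+n}\mapsto i(\nabla\phi_+)_n$, $F_{+n}\mapsto -i(\nabla\bar\chi_+)_n$. A TILC $C_{mn_1\cdots n_k}$ ($k\ge0$), totally symmetric in $n_1,\dots,n_k$, satisfies the cyclic Leibniz rule (CLR) if for all sites $n_0,\dots,n_k$ one has $\sum_{p}\sum_m\nabla_{m n_{p(0)}}C_{m n_{p(1)}\cdots n_{p(k)}}=0$, where $p$ runs over the cyclic permutations of $\{0,1,\dots,k\}$. A $\pm$type CLR term with $N_F=1$ is a functional $\sum_{m,n_1,\dots,n_k}C_{mn_1\cdots n_k}\chi_{\pm m}\phi_{\pm n_1}\cdots\phi_{\pm n_k}$ with such a $C$.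
   Formalization: The difference operator ∇ is additionally assumed not to be identically zero; for ∇ = 0 the claim fails, e.g. the sum over n of F_{+n}χ_{+n} is Q_- closed but is neither a CLR term nor Q_- exact. *)

theory Defs
  imports "HOL-Analysis.Analysis" "HOL-Combinatorics.Permutations"
begin

datatype sgn = Pl | Mi
datatype fld = Phi | Ff | Chi | Chb

fun flip :: "sgn \<Rightarrow> sgn" where
  "flip Pl = Mi" | "flip Mi = Pl"

type_synonym lvar = "fld \<times> sgn \<times> int"

definition is_odd :: "lvar \<Rightarrow> bool" where
  "is_odd x \<longleftrightarrow> fst x = Chi \<or> fst x = Chb"

definition nf_var :: "lvar \<Rightarrow> int" where
  "nf_var x = (if fst x = Chi then 1 else if fst x = Chb then -1 else 0)"

definition nf_mono :: "lvar list \<Rightarrow> int" where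
  "nf_mono xs = sum_list (map nf_var xs)"

text \<open>A (possibly infinite) formal sum  \<Sum>_xs T xs * xs!0 * ... * xs!(n-1)
  is represented by its coefficient function T :: lvar list => complex.
  Two tensors represent the same Grassmann element iff their graded
  symmetrizations agree.\<close>

definition gsym :: "(lvar list \<Rightarrow> complex) \<Rightarrow> lvar list \<Rightarrow> complex" where
  "gsym T xs = (\<Sum>\<sigma>\<in>{\<sigma>. \<sigma> permutes {..<length xs}}.
      (-1) ^ card {(i,j). i < j \<and> j < length xs \<and> \<sigma> j < \<sigma> i
                       \<and> is_odd (xs ! \<sigma> i) \<and> is_odd (xs ! \<sigma> j)}
      * T (map (\<lambda>i. xs ! \<sigma> i) [0..<length xs]))"

definition geq :: "(lvar list \<Rightarrow> complex) \<Rightarrow> (lvar list \<Rightarrow> complex) \<Rightarrow> bool" where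
  "geq T T' \<longleftrightarrow> (\<forall>xs. gsym T xs = gsym T' xs)"

definition tilc :: "(int list \<Rightarrow> complex) \<Rightarrow> nat \<Rightarrow> bool" where
  "tilc C n \<longleftrightarrow>
     (\<forall>ms. length ms = n \<longrightarrow> C (map (\<lambda>m. m + 1) ms) = C ms) \<and>
     (\<exists>L>0. \<exists>M>0. \<exists>K. \<forall>ms. length ms = n \<longrightarrow>
        (\<forall>j\<in>{1..<n}. K \<le> \<bar>ms!0 - ms!j\<bar> \<longrightarrow>
            norm (C ms) < L * exp (- M * real_of_int \<bar>ms!0 - ms!j\<bar>)))"

text \<open>Difference operator: nabla_{mn} = nabla (m - n), a two-index TILC with
  generating function vanishing at z = 1; we also require it to be nonzero.\<close>
definition difference_op :: "(int \<Rightarrow> complex) \<Rightarrow> bool" where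
  "difference_op nabla \<longleftrightarrow>
     (\<exists>L>0. \<exists>M>0. \<exists>K. \<forall>k. K \<le> \<bar>k\<bar> \<longrightarrow> norm (nabla k) < L * exp (- M * real_of_int \<bar>k\<bar>)) \<and>
     (nabla has_sum 0) UNIV \<and> (\<exists>k. nabla k \<noteq> 0)"

text \<open>Local functional: finitely many monomial lengths, and for each sequence of
  field types the coefficient is a TILC (finitely many type sequences occur).\<close>
definition local_functional :: "(lvar list \<Rightarrow> complex) \<Rightarrow> bool" where
  "local_functional T \<longleftrightarrow>
     (\<exists>N. \<forall>xs. N < length xs \<longrightarrow> T xs = 0) \<and>
     (\<forall>ks :: (fld \<times> sgn) list.
        tilc (\<lambda>ms. T (map2 (\<lambda>k m. (fst k, snd k, m)) ks ms)) (length ks))"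

definition fermion_number :: "int \<Rightarrow> (lvar list \<Rightarrow> complex) \<Rightarrow> bool" where
  "fermion_number q T \<longleftrightarrow> (\<forall>xs. T xs \<noteq> 0 \<longrightarrow> nf_mono xs = q)"

definition pure :: "sgn \<Rightarrow> (lvar list \<Rightarrow> complex) \<Rightarrow> bool" where
  "pure s T \<longleftrightarrow> (\<forall>xs. T xs \<noteq> 0 \<longrightarrow> (\<forall>x\<in>set xs. fst (snd x) = s))"

text \<open>qc nabla s x y = coefficient of the variable y in Q_s x.\<close>
definition qc :: "(int \<Rightarrow> complex) \<Rightarrow> sgn \<Rightarrow> lvar \<Rightarrow> lvar \<Rightarrow> complex" where
  "qc nabla s x y =
     (case x of (f, t, n) \<Rightarrow> (case y of (g, u, k) \<Rightarrow>
       if t = s then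
         (if f = Phi \<and> g = Chb \<and> u = s \<and> k = n then (if s = Pl then 1 else -1)
          else if f = Chi \<and> g = Ff \<and> u = s \<and> k = n then 1
          else 0)
       else
         (if f = Chi \<and> g = Phi \<and> u = t then (if s = Pl then - \<i> else \<i>) * nabla (n - k)
          else if f = Ff \<and> g = Chb \<and> u = t then - \<i> * nabla (n - k)
          else 0)))"

text \<open>Action of the odd derivation Q_s on a tensor (term-wise graded Leibniz rule).\<close>
definition qop :: "(int \<Rightarrow> complex) \<Rightarrow> sgn \<Rightarrow> (lvar list \<Rightarrow> complex) \<Rightarrow> lvar list \<Rightarrow> complex" where
  "qop nabla s T xs = (\<Sum>j<length xs.
      (-1) ^ card {i. i < j \<and> is_odd (xs ! i)} *
      infsum (\<lambda>x. qc nabla s x (xs ! j) * T (xs[j := x])) UNIV)"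

definition is_clr :: "(int \<Rightarrow> complex) \<Rightarrow> nat \<Rightarrow> (int list \<Rightarrow> complex) \<Rightarrow> bool" where
  "is_clr nabla k C \<longleftrightarrow> tilc C (Suc k) \<and>
     (\<forall>m ns ns'. length ns = k \<longrightarrow> mset ns' = mset ns \<longrightarrow> C (m # ns') = C (m # ns)) \<and>
     (\<forall>ns. length ns = Suc k \<longrightarrow>
        (\<Sum>r<Suc k. infsum (\<lambda>m. nabla (m - hd (rotate r ns)) * C (m # tl (rotate r ns))) UNIV) = 0)"

definition clr_tensor :: "sgn \<Rightarrow> nat \<Rightarrow> (int list \<Rightarrow> complex) \<Rightarrow> lvar list \<Rightarrow> complex" where
  "clr_tensor s k C xs =
     (if xs \<noteq> [] \<and> fst (hd xs) = Chi \<and> fst (snd (hd xs)) = s \<and> length xs = Suc k \<and>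
         (\<forall>y\<in>set (tl xs). fst y = Phi \<and> fst (snd y) = s)
      then C (map (\<lambda>y. snd (snd y)) xs) else 0)"

end

(* Convolution by nabla is injective on exponentially decaying sequences, with a left inverse:
   for suitable arbitrarily small e its generating function has no zero on the circles
   |z| = exp(+-e), and the Laurent coefficients of its reciprocal on the two circles give two convolution
   inverses, one decaying to the right and one to the left. Using one of them on each side of a
   base point yields an operator D with D nabla = id that preserves exponential decay.

   Q acts slot by slot on coefficient tensors and commutes with graded symmetrization, so P may be
   taken graded symmetric, and then Q P = 0 already as a tensor. Slots come in pairs "upper"
   (chi, F) and "lower" (phi, chibar), Q mapping upper to lower: this is a Koszul complex. Take the
   position of the head slot as base point. If T is closed under the tail slots, then T - Q (D_j T)
   has no upper field in slot j any more, because slot operators anticommute and D_j inverts Q on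
   slot j. Hence a closed tensor whose monomials all have an upper field in the tail is exact.
   Fermion number one together with one auxiliary field (F or chibar) forces two upper fields, so
   this applies to that part of P; the remaining monomials are chi phi ... phi, where closedness
   is the cyclic Leibniz rule. *)

theory Submission
  imports Defs "HOL-Complex_Analysis.Complex_Analysis"
begin

section \<open>Inverting a difference operator\<close>

text \<open>A summable convolution inverse of \<open>nabla\<close> would have a generating function
  whose value at z = 1, times that of \<open>nabla\<close>, is 1; the latter value is 0, so there is
  none. This is why two one-sided inverses have to be combined at a base point, and translation
  invariance forces that point to move along with the fields. The resulting D grows with the
  distance of its input from the base point and decays with that of its output. The decay of the
  tensor has to pay for the growth, so the rate of D must be a small fraction of the rate of the
  tensor. The price of the base point is that an operator acting on the head slot moves it and need
  not anticommute with D. Hence the argument with D covers only the tail slots. The head is treated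
  separately, by sorting monomials according to whether their head is upper: the head term of Q
  leads only from upper to lower heads.\<close>

lemma summable_exp_neg_abs_int:
  fixes M :: real
  assumes "M > 0"
  shows "(\<lambda>k::int. exp (- M * \<bar>real_of_int k\<bar>)) summable_on UNIV"
proof -
  let ?f = "\<lambda>k::int. exp (- M * \<bar>real_of_int k\<bar>)"
  have "summable (\<lambda>n::nat. exp (- M) ^ n)"
    using assms by (intro summable_geometric) auto
  then have nat: "(\<lambda>n::nat. exp (- M * real n)) summable_on UNIV"
    by (intro norm_summable_imp_summable_on) (simp add: exp_of_nat_mult[symmetric] mult_ac)
  have "?f summable_on range int"
    by (subst summable_on_reindex) (use nat in \<open>auto simp: o_def\<close>)
  moreover have "?f summable_on range (\<lambda>n. - int n)"
    by (subst summable_on_reindex) (use nat in \<open>auto simp: o_def inj_on_def\<close>)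
  ultimately have "?f summable_on (range int \<union> range (\<lambda>n. - int n))"
    by (rule summable_on_union)
  moreover have "range int \<union> range (\<lambda>n. - int n) = UNIV"
  proof (rule UNIV_eq_I[symmetric])
    fix k :: int
    have "k = int (nat k) \<or> k = - int (nat (- k))" by linarith
    then show "k \<in> range int \<union> range (\<lambda>n. - int n)" by blast
  qed
  ultimately show ?thesis by simp
qed

text \<open>By the M-test the finite partial sums converge uniformly, so integration passes to the
  limit. This reads off Laurent coefficients of a two-sided series without fixing an order of
  summation.\<close>

lemma has_sum_integral:
  fixes h :: "'a \<Rightarrow> real \<Rightarrow> complex"
  assumes cont: "\<And>l. continuous_on {a..b} (h l)"
    and bound: "\<And>l x. x \<in> {a..b} \<Longrightarrow> norm (h l x) \<le> B l"
    and summable: "B summable_on UNIV"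
  shows "((\<lambda>l. integral {a..b} (h l)) has_sum integral {a..b} (\<lambda>x. \<Sum>\<^sub>\<infinity>l. h l x)) UNIV"
proof -
  have "uniform_limit {a..b} (\<lambda>X x. \<Sum>l\<in>X. h l x) (\<lambda>x. \<Sum>\<^sub>\<infinity>l. h l x) (finite_subsets_at_top UNIV)"
    by (rule Weierstrass_m_test_general) (use assms in auto)
  then obtain I J where I: "\<And>X. ((\<lambda>x. \<Sum>l\<in>X. h l x) has_integral I X) {a..b}"
    and J: "((\<lambda>x. \<Sum>\<^sub>\<infinity>l. h l x) has_integral J) {a..b}"
    and lim: "(I \<longlongrightarrow> J) (finite_subsets_at_top UNIV)"
    by (rule uniform_limit_integral) (auto intro!: continuous_intros cont)
  have h: "(h l has_integral integral {a..b} (h l)) {a..b}" for l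
    using cont by (intro integrable_integral integrable_continuous_real)
  have "I X = (\<Sum>l\<in>X. integral {a..b} (h l))" if "finite X" for X
    using I has_integral_sum[OF that, of h "\<lambda>l. integral {a..b} (h l)" "{a..b}"] h has_integral_unique
    by blast
  then have "\<forall>\<^sub>F X in finite_subsets_at_top UNIV. I X = (\<Sum>l\<in>X. integral {a..b} (h l))"
    by (simp add: eventually_finite_subsets_at_top_weakI)
  then have "((\<lambda>l. integral {a..b} (h l)) has_sum J) UNIV"
    using lim unfolding has_sum_def by (simp add: tendsto_cong)
  then show ?thesis using J by (simp add: integral_unique)
qed

lemma integral_exp_ii_int:
  "integral {0..2*pi} (\<lambda>\<theta>. exp (\<i> * of_int n * of_real \<theta>)) = (if n = 0 then 2 * of_real pi else 0)"
proof (cases "n = 0")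
  case False
  let ?F = "\<lambda>z. exp (\<i> * of_int n * z) / (\<i> * of_int n)"
  have "((\<lambda>\<theta>. exp (\<i> * of_int n * of_real \<theta>)) has_integral
      (?F (of_real (2*pi)) - ?F (of_real 0))) {0..2*pi}"
    by (rule fundamental_theorem_of_calculus)
      (use False in \<open>auto intro!: derivative_eq_intros has_vector_derivative_real_field
         simp: field_simps\<close>)
  moreover have "exp (\<i> * of_int n * of_real (2*pi)) = 1"
    using exp_integer_2pi[of "of_int n"] by (simp add: mult_ac)
  ultimately show ?thesis using False by (simp add: integral_unique)
qed (simp add: scaleR_conv_of_real)

text \<open>Only finitely many \<open>k\<close> escape the assumed bound; their weighted norms are
  added to the constant.\<close>

lemma exp_decay_everywhere:
  fixes f :: "int \<Rightarrow> complex"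
  assumes "M > 0" and "\<And>k. K \<le> \<bar>k\<bar> \<Longrightarrow> norm (f k) < L * exp (- M * real_of_int \<bar>k\<bar>)"
  obtains L' where "L' > 0" "\<And>k. norm (f k) \<le> L' * exp (- M * \<bar>real_of_int k\<bar>)"
proof -
  let ?S = "\<Sum>k\<in>{-K..K}. norm (f k) * exp (M * \<bar>real_of_int k\<bar>)"
  have pos: "0 \<le> ?S" by (intro sum_nonneg) auto
  have "norm (f k) \<le> (\<bar>L\<bar> + ?S + 1) * exp (- M * \<bar>real_of_int k\<bar>)" for k
  proof (cases "K \<le> \<bar>k\<bar>")
    case True
    then have "norm (f k) \<le> L * exp (- M * \<bar>real_of_int k\<bar>)"
      using assms(2) by fastforce
    also have "\<dots> \<le> (\<bar>L\<bar> + ?S + 1) * exp (- M * \<bar>real_of_int k\<bar>)"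
      using pos by (intro mult_right_mono) auto
    finally show ?thesis .
  next
    case False
    have "norm (f k) * exp (M * \<bar>real_of_int k\<bar>) \<le> ?S"
      by (rule member_le_sum[where f = "\<lambda>k. norm (f k) * exp (M * \<bar>real_of_int k\<bar>)"]) (use False in auto)
    then have "norm (f k) * exp (M * \<bar>real_of_int k\<bar>) \<le> \<bar>L\<bar> + ?S + 1" by linarith
    then have "norm (f k) * exp (M * \<bar>real_of_int k\<bar>) * exp (- M * \<bar>real_of_int k\<bar>)
      \<le> (\<bar>L\<bar> + ?S + 1) * exp (- M * \<bar>real_of_int k\<bar>)"
      by (rule mult_right_mono) simp
    moreover have "exp (M * \<bar>real_of_int k\<bar>) * exp (- M * \<bar>real_of_int k\<bar>) = 1"
      by (simp add: exp_add[symmetric])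
    ultimately show ?thesis by (simp only: mult.assoc mult_1_right)
  qed
  then show ?thesis using that[of "\<bar>L\<bar> + ?S + 1"] pos by auto
qed

section \<open>Generating functions and convolution inverses\<close>

context
  fixes f :: "int \<Rightarrow> complex" and L M :: real
  assumes LM: "L > 0" "M > 0"
    and decay: "\<And>k. norm (f k) \<le> L * exp (- M * \<bar>real_of_int k\<bar>)"
begin

text \<open>The generating function of \<open>f\<close> at \<open>exp w\<close>: working on a strip instead of an annulus
  makes the domain convex.\<close>

definition gen_fun :: "complex \<Rightarrow> complex" where
  "gen_fun w = (\<Sum>\<^sub>\<infinity>k. f k * exp (of_int k * w))"

lemma gen_fun_term_bound:
  assumes "\<bar>Re w\<bar> \<le> t"
  shows "norm (f k * exp (of_int k * w)) \<le> L * exp (- (M - t) * \<bar>real_of_int k\<bar>)"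
proof -
  have "real_of_int k * Re w \<le> \<bar>real_of_int k * Re w\<bar>" by simp
  also have "\<dots> \<le> \<bar>real_of_int k\<bar> * t"
    unfolding abs_mult by (rule mult_left_mono) (use assms in auto)
  finally have "exp (real_of_int k * Re w) \<le> exp (t * \<bar>real_of_int k\<bar>)"
    by (simp add: mult.commute)
  then have "norm (f k * exp (of_int k * w)) \<le> L * exp (- M * \<bar>real_of_int k\<bar>) * exp (t * \<bar>real_of_int k\<bar>)"
    unfolding norm_mult using decay LM by (intro mult_mono) auto
  also have "\<dots> = L * exp (- (M - t) * \<bar>real_of_int k\<bar>)"
    by (simp add: mult.assoc exp_add[symmetric] algebra_simps)
  finally show ?thesis .
qed

lemma gen_fun_bound_summable:
  assumes "t < M"
  shows "(\<lambda>k::int. L * exp (- (M - t) * \<bar>real_of_int k\<bar>)) summable_on UNIV"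
  using summable_exp_neg_abs_int[of "M - t"] assms by (intro summable_on_cmult_right) auto

lemma gen_fun_uniform_limit:
  assumes "t < M" "\<And>w. w \<in> Y \<Longrightarrow> \<bar>Re w\<bar> \<le> t"
  shows "uniform_limit Y (\<lambda>X w. \<Sum>k\<in>X. f k * exp (of_int k * w)) gen_fun (finite_subsets_at_top UNIV)"
  unfolding gen_fun_def
  by (rule Weierstrass_m_test_general[OF _ gen_fun_bound_summable[OF assms(1)]])
     (use assms gen_fun_term_bound in auto)

lemma gen_fun_holomorphic: "gen_fun holomorphic_on {w. \<bar>Re w\<bar> < M}"
proof -
  have op: "open {w. \<bar>Re w\<bar> < M}"
    by (intro open_Collect_less continuous_intros)
  have "gen_fun field_differentiable (at z)" if z: "\<bar>Re z\<bar> < M" for z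
  proof -
    \<comment> \<open>Half the distance to the edge of the strip, so that one summable majorant
      serves the whole closed disc.\<close>
    define r where "r = (M - \<bar>Re z\<bar>) / 2"
    have r: "r > 0" using z by (simp add: r_def)
    have sub: "\<bar>Re w\<bar> \<le> (M + \<bar>Re z\<bar>) / 2" if "w \<in> cball z r" for w
    proof -
      have "\<bar>Re w - Re z\<bar> \<le> norm (w - z)"
        by (metis abs_Re_le_cmod minus_complex.sel(1))
      also have "\<dots> \<le> r" using that by (simp add: dist_norm norm_minus_commute)
      finally show ?thesis by (simp add: r_def field_simps abs_if split: if_splits)
    qed
    have "uniform_limit (cball z r) (\<lambda>X w. \<Sum>k\<in>X. f k * exp (of_int k * w)) gen_fun (finite_subsets_at_top UNIV)"
      by (rule gen_fun_uniform_limit[of "(M + \<bar>Re z\<bar>) / 2"]) (use z sub in auto)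
    then have "gen_fun holomorphic_on ball z r"
      by (rule holomorphic_uniform_limit[rotated])
        (auto intro!: always_eventually continuous_intros holomorphic_intros)
    then show ?thesis using r
      by (simp add: holomorphic_on_open field_differentiable_def)
  qed
  then show ?thesis
    using op by (simp add: holomorphic_on_open field_differentiable_def)
qed

text \<open>With z = exp w this integrates over the circle of radius exp \<open>t\<close>. The
  weight \<open>c\<close> stays free for two uses: built from the reciprocal of
  \<open>gen_fun\<close> it gives the convolution inverse, and as a character it isolates one value
  of \<open>f\<close>.\<close>

lemma gen_fun_fourier:
  assumes "\<bar>t\<bar> < M" and "continuous_on {0..2*pi} c"
  shows "((\<lambda>k. f k * integral {0..2*pi} (\<lambda>\<theta>. exp (of_int k * (of_real t + \<i> * of_real \<theta>)) * c \<theta>))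
     has_sum integral {0..2*pi} (\<lambda>\<theta>. gen_fun (of_real t + \<i> * of_real \<theta>) * c \<theta>)) UNIV"
proof -
  have "bounded (c ` {0..2*pi})"
    by (intro compact_imp_bounded compact_continuous_image assms) auto
  then obtain B where B: "B > 0" "\<And>x. x \<in> {0..2*pi} \<Longrightarrow> norm (c x) \<le> B"
    by (auto simp: bounded_pos)
  let ?h = "\<lambda>k \<theta>. f k * exp (of_int k * (of_real t + \<i> * of_real \<theta>)) * c \<theta>"
  have "((\<lambda>k. integral {0..2*pi} (?h k)) has_sum integral {0..2*pi} (\<lambda>\<theta>. \<Sum>\<^sub>\<infinity>k. ?h k \<theta>)) UNIV"
  proof (rule has_sum_integral)
    show "continuous_on {0..2*pi} (?h k)" for k
      by (intro continuous_intros assms)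
    show "norm (?h k x) \<le> L * exp (- (M - \<bar>t\<bar>) * \<bar>real_of_int k\<bar>) * B" if "x \<in> {0..2*pi}" for k x
      unfolding norm_mult[of "f k * _"]
      by (intro mult_mono gen_fun_term_bound B that) (use LM in auto)
    show "(\<lambda>k. L * exp (- (M - \<bar>t\<bar>) * \<bar>real_of_int k\<bar>) * B) summable_on UNIV"
      using gen_fun_bound_summable[of "\<bar>t\<bar>"] assms by (intro summable_on_cmult_left) auto
  qed
  moreover have "(\<Sum>\<^sub>\<infinity>k. ?h k \<theta>) = gen_fun (of_real t + \<i> * of_real \<theta>) * c \<theta>" for \<theta>
    unfolding gen_fun_def by (rule infsum_cmult_left')
  moreover have "integral {0..2*pi} (?h k) =
      f k * integral {0..2*pi} (\<lambda>\<theta>. exp (of_int k * (of_real t + \<i> * of_real \<theta>)) * c \<theta>)" for k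
    by (subst integral_mult_right[symmetric]) (simp add: mult.assoc)
  ultimately show ?thesis by simp
qed

text \<open>\<open>E\<close> consists of the Laurent coefficients of \<open>1 / gen_fun\<close> on
  the circle of radius exp \<open>t\<close>; a bound of this function there gives the bound on
  \<open>E\<close>. The convolution identity is \<open>gen_fun * (1 / gen_fun) = 1\<close> read
  coefficientwise.\<close>

lemma convolution_inverse_on_line:
  assumes t: "\<bar>t\<bar> < M" and nz: "\<And>w. Re w = t \<Longrightarrow> gen_fun w \<noteq> 0"
  obtains A E where "A > 0" "\<And>k. norm (E k) \<le> A * exp (- t * real_of_int k)"
    "\<And>n. ((\<lambda>l. E l * f (n - l)) has_sum (if n = 0 then 1 else 0)) UNIV"
proof -
  define w where "w \<theta> = (of_real t + \<i> * of_real \<theta> :: complex)" for \<theta>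
  define g where "g \<theta> = 1 / gen_fun (w \<theta>)" for \<theta>
  have nz': "gen_fun (w \<theta>) \<noteq> 0" for \<theta>
    by (rule nz) (simp add: w_def)
  have contw: "continuous_on S w" for S
    unfolding w_def by (intro continuous_intros)
  have "continuous_on {0..2*pi} (gen_fun \<circ> w)"
    by (intro continuous_on_compose contw holomorphic_on_imp_continuous_on
        holomorphic_on_subset[OF gen_fun_holomorphic]) (use t in \<open>auto simp: w_def\<close>)
  then have cont: "continuous_on {0..2*pi} g"
    unfolding g_def o_def using nz' by (intro continuous_intros) auto
  have "bounded (g ` {0..2*pi})"
    by (intro compact_imp_bounded compact_continuous_image cont) auto
  then obtain B where B: "B > 0" "\<And>x. x \<in> {0..2*pi} \<Longrightarrow> norm (g x) \<le> B"
    by (auto simp: bounded_pos)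
  define E where "E k = integral {0..2*pi} (\<lambda>\<theta>. exp (- of_int k * w \<theta>) * g \<theta>) / (2 * of_real pi)" for k :: int
  show ?thesis
  proof
    show "B > 0" by (rule B)
    show "norm (E k) \<le> B * exp (- t * real_of_int k)" for k
    proof -
      have "norm (integral {0..2*pi} (\<lambda>\<theta>. exp (- of_int k * w \<theta>) * g \<theta>)) \<le>
          exp (- t * real_of_int k) * B * (2 * pi - 0)"
      proof (rule integral_bound)
        show "continuous_on {0..2 * pi} (\<lambda>\<theta>. exp (- of_int k * w \<theta>) * g \<theta>)"
          by (intro continuous_intros cont contw)
        show "norm (exp (- of_int k * w \<theta>) * g \<theta>) \<le> exp (- t * real_of_int k) * B"
          if "\<theta> \<in> {0..2*pi}" for \<theta>
          unfolding norm_mult by (intro mult_mono B that) (simp_all add: w_def)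
      qed simp
      then show ?thesis
        by (simp add: E_def norm_divide field_simps)
    qed
    show "((\<lambda>l. E l * f (n - l)) has_sum (if n = 0 then 1 else 0)) UNIV" for n
    proof -
      have c: "continuous_on {0..2*pi} (\<lambda>\<theta>. exp (- of_int n * w \<theta>) * g \<theta>)"
        by (intro continuous_intros cont contw)
      have "((\<lambda>k. f k * integral {0..2*pi} (\<lambda>\<theta>. exp (of_int k * w \<theta>) * (exp (- of_int n * w \<theta>) * g \<theta>)))
        has_sum integral {0..2*pi} (\<lambda>\<theta>. gen_fun (w \<theta>) * (exp (- of_int n * w \<theta>) * g \<theta>))) UNIV"
        using gen_fun_fourier[OF t c] by (simp add: w_def)
      moreover have "exp (of_int k * w \<theta>) * (exp (- of_int n * w \<theta>) * g \<theta>) = exp (- of_int (n - k) * w \<theta>) * g \<theta>"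
        for k \<theta>
        unfolding mult.assoc[symmetric] exp_add[symmetric] by (simp add: algebra_simps)
      moreover have "gen_fun (w \<theta>) * (exp (- of_int n * w \<theta>) * g \<theta>) = exp (- of_int n * w \<theta>)" for \<theta>
        using nz' by (simp add: g_def)
      moreover have "integral {0..2*pi} (\<lambda>\<theta>. exp (- of_int k * w \<theta>) * g \<theta>) = E k * (2 * of_real pi)" for k
        by (simp add: E_def)
      ultimately have "((\<lambda>k. f k * (E (n - k) * (2 * of_real pi))) has_sum
          integral {0..2*pi} (\<lambda>\<theta>. exp (- of_int n * w \<theta>))) UNIV"
        by (simp only:)
      moreover have "integral {0..2*pi} (\<lambda>\<theta>. exp (- of_int n * w \<theta>))
          = exp (- of_int n * of_real t) * integral {0..2*pi} (\<lambda>\<theta>. exp (\<i> * of_int (- n) * of_real \<theta>))"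
        by (subst integral_mult_right[symmetric])
          (simp add: exp_add[symmetric] w_def algebra_simps)
      ultimately have "((\<lambda>k. f k * (E (n - k) * (2 * of_real pi))) has_sum
          (if n = 0 then 2 * of_real pi else 0)) UNIV"
        by (simp only: integral_exp_ii_int) (simp split: if_splits)
      then have "((\<lambda>k. f k * (E (n - k) * (2 * of_real pi)) / (2 * of_real pi)) has_sum
          ((if n = 0 then 2 * of_real pi else 0) / (2 * of_real pi))) UNIV"
        by (rule has_sum_divide_const)
      then have "((\<lambda>k. f k * E (n - k)) has_sum (if n = 0 then 1 else 0)) UNIV"
        by (simp split: if_splits)
      then show ?thesis
        by (subst has_sum_reindex_bij_witness[of _ "\<lambda>k. n - k" "\<lambda>k. n - k" _ "\<lambda>k. f k * E (n - k)"])
          auto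
    qed
  qed
qed

text \<open>\<open>gen_fun\<close> is not identically zero, so its zeros in the strip are countable
  and forbid only countably many values of \<epsilon> in an interval. Excluding the absolute values
  of the real parts makes one \<epsilon> good for both circles.\<close>

lemma convolution_inverses:
  assumes sum0: "(f has_sum 0) UNIV" and nonzero: "f k0 \<noteq> 0" and \<delta>: "\<delta> > 0"
  obtains \<epsilon> A Ep Em where "0 < \<epsilon>" "\<epsilon> < \<delta>" "A > 0"
    "\<And>k. norm (Ep k) \<le> A * exp (- \<epsilon> * real_of_int k)"
    "\<And>k. norm (Em k) \<le> A * exp (\<epsilon> * real_of_int k)"
    "\<And>n. ((\<lambda>l. Ep l * f (n - l)) has_sum (if n = 0 then 1 else 0)) UNIV"
    "\<And>n. ((\<lambda>l. Em l * f (n - l)) has_sum (if n = 0 then 1 else 0)) UNIV"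
proof -
  define S where "S = {w. \<bar>Re w\<bar> < M}"
  have op: "open S" unfolding S_def
    by (intro open_Collect_less continuous_intros)
  have "convex S"
  proof -
    have "S = {w. Re w < M} \<inter> {w. Re w > - M}" by (auto simp: S_def)
    then show ?thesis by (simp add: convex_halfspace_Re_lt convex_halfspace_Re_gt convex_Int)
  qed
  then have conn: "connected S" by (rule convex_connected)
  \<comment> \<open>A countable union of closed strips: this verifies the F-sigma condition of the
    theorem that a nonconstant holomorphic function has countably many zeros.\<close>
  have "S = (\<Union>n. {w. \<bar>Re w\<bar> \<le> M - 1 / real (Suc n)})"
  proof (intro equalityI subsetI)
    fix w assume "w \<in> S"
    then obtain n where "1 / real (Suc n) < M - \<bar>Re w\<bar>"
      using nat_approx_posE[of "M - \<bar>Re w\<bar>"] by (auto simp: S_def)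
    then have "\<bar>Re w\<bar> \<le> M - 1 / real (Suc n)" by linarith
    then show "w \<in> (\<Union>n. {w. \<bar>Re w\<bar> \<le> M - 1 / real (Suc n)})" by blast
  next
    fix w assume "w \<in> (\<Union>n. {w. \<bar>Re w\<bar> \<le> M - 1 / real (Suc n)})"
    then obtain n where "\<bar>Re w\<bar> \<le> M - 1 / real (Suc n)" by blast
    moreover have "1 / real (Suc n) > 0" by simp
    ultimately show "w \<in> S" by (simp only: S_def mem_Collect_eq)
  qed
  moreover have "closed {w. \<bar>Re w\<bar> \<le> M - 1 / real (Suc n)}" for n
    by (intro closed_Collect_le continuous_intros)
  ultimately have fsig: "fsigma S"
    using fsigma.intros[of "\<lambda>n. {w. \<bar>Re w\<bar> \<le> M - 1 / real (Suc n)}"] by auto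
  have "\<not> gen_fun constant_on S"
  proof
    assume "gen_fun constant_on S"
    then obtain c where c: "\<And>w. w \<in> S \<Longrightarrow> gen_fun w = c"
      by (auto simp: constant_on_def)
    \<comment> \<open>The value at 0 is the sum of \<open>f\<close>. A constant
      \<open>gen_fun\<close> would thus vanish, and so would its Fourier coefficient
      \<open>f k0\<close>.\<close>
    have "gen_fun 0 = 0"
      unfolding gen_fun_def using sum0 by (simp add: infsumI)
    then have c0: "gen_fun w = 0" if "w \<in> S" for w
      using c[of 0] c[OF that] LM by (simp add: S_def)
    have z: "gen_fun (\<i> * of_real \<theta>) = 0" for \<theta>
      by (rule c0) (use LM in \<open>simp add: S_def\<close>)
    have "((\<lambda>k. f k * integral {0..2*pi} (\<lambda>\<theta>. exp (of_int k * (of_real 0 + \<i> * of_real \<theta>)) *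
         exp (\<i> * of_int (- k0) * of_real \<theta>)))
     has_sum integral {0..2*pi} (\<lambda>\<theta>. gen_fun (of_real 0 + \<i> * of_real \<theta>) * exp (\<i> * of_int (- k0) * of_real \<theta>))) UNIV"
      by (rule gen_fun_fourier) (use LM in \<open>auto intro!: continuous_intros\<close>)
    moreover have "exp (of_int k * (of_real 0 + \<i> * of_real \<theta>)) * exp (\<i> * of_int (- k0) * of_real \<theta>)
        = exp (\<i> * of_int (k - k0) * of_real \<theta>)" for k \<theta>
      unfolding exp_add[symmetric] by (simp add: algebra_simps)
    ultimately have "((\<lambda>k. f k * integral {0..2*pi} (\<lambda>\<theta>. exp (\<i> * of_int (k - k0) * of_real \<theta>)))
      has_sum 0) UNIV"
      using z by (simp only: of_real_0 add_0_left) simp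
    then have 0: "((\<lambda>k. f k * (if k = k0 then 2 * of_real pi else 0)) has_sum 0) UNIV"
      by (simp only: integral_exp_ii_int right_minus_eq)
    have "((\<lambda>k. f k * (if k = k0 then 2 * of_real pi else 0)) has_sum (f k0 * (2 * of_real pi))) UNIV"
      by (rule has_sum_finite_neutralI[of "{k0}"]) auto
    with 0 have "f k0 * (2 * of_real pi) = 0" using has_sum_unique by blast
    with nonzero show False by simp
  qed
  then have "countable {w \<in> S. gen_fun w = 0}"
    by (intro holomorphic_countable_zeros op conn fsig)
      (use gen_fun_holomorphic in \<open>auto simp: S_def\<close>)
  then have "countable ((\<lambda>w. \<bar>Re w\<bar>) ` {w \<in> S. gen_fun w = 0})" by simp
  moreover have "uncountable {0<..<min \<delta> M}"
    using \<delta> LM by (simp add: uncountable_open_interval)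
  ultimately obtain \<epsilon> where \<epsilon>: "\<epsilon> \<in> {0<..<min \<delta> M}" "\<epsilon> \<notin> (\<lambda>w. \<bar>Re w\<bar>) ` {w \<in> S. gen_fun w = 0}"
    by (meson countable_subset subsetI)
  have nz: "gen_fun w \<noteq> 0" if "\<bar>Re w\<bar> = \<epsilon>" for w
    using \<epsilon> that by (auto simp: S_def)
  obtain A1 Ep where 1: "A1 > 0" "\<And>k. norm (Ep k) \<le> A1 * exp (- \<epsilon> * real_of_int k)"
    "\<And>n. ((\<lambda>l. Ep l * f (n - l)) has_sum (if n = 0 then 1 else 0)) UNIV"
    by (rule convolution_inverse_on_line[of \<epsilon>]) (use \<epsilon> nz in auto)
  obtain A2 Em where 2: "A2 > 0" "\<And>k. norm (Em k) \<le> A2 * exp (- (- \<epsilon>) * real_of_int k)"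
    "\<And>n. ((\<lambda>l. Em l * f (n - l)) has_sum (if n = 0 then 1 else 0)) UNIV"
    by (rule convolution_inverse_on_line[of "- \<epsilon>"]) (use \<epsilon> nz in auto)
  have le: "A1 * x \<le> max A1 A2 * x" "A2 * x \<le> max A1 A2 * x" if "x \<ge> 0" for x :: real
    using that by (auto intro!: mult_right_mono)
  show ?thesis
  proof (rule that[of \<epsilon> "max A1 A2" Ep Em])
    show "norm (Ep k) \<le> max A1 A2 * exp (- \<epsilon> * real_of_int k)" for k
      using 1(2)[of k] le(1) order_trans exp_ge_zero by blast
    show "norm (Em k) \<le> max A1 A2 * exp (\<epsilon> * real_of_int k)" for k
      using order_trans[OF 2(2)[of k] le(2)] by simp
  qed (use \<epsilon> 1 2 in auto)
qed

end

section \<open>Koszul signs\<close>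

text \<open>The sign of moving an odd operator past the entries in front of slot
  \<open>j\<close>.\<close>

definition sg :: "lvar list \<Rightarrow> nat \<Rightarrow> complex" where
  "sg xs j = (-1) ^ card {i. i < j \<and> is_odd (xs ! i)}"

definition psign :: "(nat \<Rightarrow> nat) \<Rightarrow> lvar list \<Rightarrow> complex" where
  "psign \<sigma> xs = (-1) ^ card {(i,j). i < j \<and> j < length xs \<and> \<sigma> j < \<sigma> i
                       \<and> is_odd (xs ! \<sigma> i) \<and> is_odd (xs ! \<sigma> j)}"

definition pairs :: "nat \<Rightarrow> (nat \<times> nat) set" where
  "pairs n = {(i,j). i < j \<and> j < n}"

lemma finite_pairs [simp]: "finite (pairs n)"
  by (rule finite_subset[of _ "{..<n} \<times> {..<n}"]) (auto simp: pairs_def)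

text \<open>Turns parity counts into products of local signs, which can then be compared factor by
  factor.\<close>

lemma neg_one_power_card:
  assumes "finite A"
  shows "(-1 :: 'a :: comm_ring_1) ^ card {x \<in> A. P x} = (\<Prod>x\<in>A. if P x then -1 else 1)"
  using assms by (simp add: prod.inter_filter[symmetric])

lemma sg_prod: "sg xs j = (\<Prod>i<j. if is_odd (xs ! i) then -1 else 1)"
  unfolding sg_def by (subst neg_one_power_card[symmetric]) auto

lemma sg_square [simp]: "sg xs j * sg xs j = 1"
  by (simp add: sg_def power_mult_distrib[symmetric])

lemma norm_sg [simp]: "norm (sg xs j) = 1"
  by (simp add: sg_def norm_power)

lemma psign_prod:
  "psign \<sigma> xs = (\<Prod>(i,j)\<in>pairs (length xs).
     if \<sigma> j < \<sigma> i \<and> is_odd (xs ! \<sigma> i) \<and> is_odd (xs ! \<sigma> j) then -1 else 1)"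
proof -
  have "{(i,j). i < j \<and> j < length xs \<and> \<sigma> j < \<sigma> i \<and> is_odd (xs ! \<sigma> i) \<and> is_odd (xs ! \<sigma> j)}
     = {x \<in> pairs (length xs). \<sigma> (snd x) < \<sigma> (fst x) \<and> is_odd (xs ! \<sigma> (fst x)) \<and> is_odd (xs ! \<sigma> (snd x))}"
    by (auto simp: pairs_def)
  then show ?thesis
    unfolding psign_def by (simp only: neg_one_power_card finite_pairs) (simp add: case_prod_unfold)
qed

lemma psign_square [simp]: "psign \<sigma> xs * psign \<sigma> xs = 1"
  by (simp add: psign_def power_mult_distrib[symmetric])

lemma norm_psign [simp]: "norm (psign \<sigma> xs) = 1"
  by (simp add: psign_def norm_power)

text \<open>For symmetric \<open>g\<close> this is a product over unordered pairs, which \<tau>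
  merely permutes; \<open>min\<close> and \<open>max\<close> sort each image pair again.\<close>

lemma prod_pairs_permute:
  assumes \<tau>: "\<tau> permutes {..<n}"
    and sym: "\<And>a b. a < n \<Longrightarrow> b < n \<Longrightarrow> a \<noteq> b \<Longrightarrow> g a b = g b a"
  shows "(\<Prod>(i,j)\<in>pairs n. g (\<tau> i) (\<tau> j)) = (\<Prod>(i,j)\<in>pairs n. g i j)"
proof (rule prod.reindex_bij_witness[of _
      "\<lambda>(a,b). (min (inv \<tau> a) (inv \<tau> b), max (inv \<tau> a) (inv \<tau> b))"
      "\<lambda>(a,b). (min (\<tau> a) (\<tau> b), max (\<tau> a) (\<tau> b))"])
  have lt: "\<tau> a < n \<longleftrightarrow> a < n" "inv \<tau> a < n \<longleftrightarrow> a < n" for a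
    using permutes_in_image[OF \<tau>, of a] permutes_in_image[OF permutes_inv[OF \<tau>], of a] by auto
  have inj: "\<tau> a = \<tau> b \<longleftrightarrow> a = b" "inv \<tau> a = inv \<tau> b \<longleftrightarrow> a = b" for a b
    using permutes_inj[OF \<tau>] permutes_inj[OF permutes_inv[OF \<tau>]] by (simp_all add: inj_eq)
  have inv: "inv \<tau> (\<tau> a) = a" "\<tau> (inv \<tau> a) = a" for a
    using permutes_inverses[OF \<tau>] by auto
  fix p :: "nat \<times> nat" assume "p \<in> pairs n"
  then obtain a b where p: "p = (a,b)" "a < b" "b < n"
    by (auto simp: pairs_def)
  show "(\<lambda>(a,b). (min (inv \<tau> a) (inv \<tau> b), max (inv \<tau> a) (inv \<tau> b)))
     ((\<lambda>(a,b). (min (\<tau> a) (\<tau> b), max (\<tau> a) (\<tau> b))) p) = p"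
    using p by (cases "\<tau> a \<le> \<tau> b") (simp_all add: inv min_absorb1 max_absorb2 min_absorb2 max_absorb1)
  show "(\<lambda>(a,b). (min (\<tau> a) (\<tau> b), max (\<tau> a) (\<tau> b)))
     ((\<lambda>(a,b). (min (inv \<tau> a) (inv \<tau> b), max (inv \<tau> a) (inv \<tau> b))) p) = p"
    using p by (cases "inv \<tau> a \<le> inv \<tau> b") (simp_all add: inv min_absorb1 max_absorb2 min_absorb2 max_absorb1)
  show "(\<lambda>(a,b). (min (\<tau> a) (\<tau> b), max (\<tau> a) (\<tau> b))) p \<in> pairs n"
    using p inj(1)[of a b] by (auto simp: pairs_def lt min_def max_def)
  show "(\<lambda>(a,b). (min (inv \<tau> a) (inv \<tau> b), max (inv \<tau> a) (inv \<tau> b))) p \<in> pairs n"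
    using p inj(2)[of a b] by (auto simp: pairs_def lt min_def max_def)
  show "(case (\<lambda>(a,b). (min (\<tau> a) (\<tau> b), max (\<tau> a) (\<tau> b))) p of (i, j) \<Rightarrow> g i j)
    = (case p of (i, j) \<Rightarrow> g (\<tau> i) (\<tau> j))"
    using p sym[of "\<tau> a" "\<tau> b"] inj(1)[of a b] lt by (auto simp: min_def max_def)
qed

text \<open>The pairwise factors of both sides differ by a function that is symmetric in the pair,
  hence insensitive to reordering the pairs.\<close>

lemma psign_comp:
  assumes \<sigma>: "\<sigma> permutes {..<length xs}" and \<tau>: "\<tau> permutes {..<length xs}"
  shows "psign (\<sigma> \<circ> \<tau>) xs = psign \<sigma> xs * psign \<tau> (permute_list \<sigma> xs)"
proof -
  define n where "n = length xs"
  define w :: "(nat \<Rightarrow> lvar) \<Rightarrow> nat \<Rightarrow> nat \<Rightarrow> complex" where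
    "w x a b = (if b < a \<and> is_odd (x a) \<and> is_odd (x b) then -1 else 1)" for x a b
  define g where "g a b = w (\<lambda>i. xs ! i) (\<sigma> a) (\<sigma> b) * w (\<lambda>i. xs ! \<sigma> i) a b" for a b
  have lt: "\<tau> a < n \<longleftrightarrow> a < n" "\<sigma> a < n \<longleftrightarrow> a < n" for a
    using permutes_in_image[OF \<tau>, of a] permutes_in_image[OF \<sigma>, of a] by (auto simp: n_def)
  have nth: "permute_list \<sigma> xs ! a = xs ! \<sigma> a" if "a < n" for a
    using that by (simp add: n_def permute_list_nth[OF \<sigma>])
  \<comment> \<open>For two odd entries, exchanging \<open>a\<close> and \<open>b\<close> reverses
    both the comparison of the indices and that of their images, so the two sign changes
    cancel.\<close>
  have sym: "g a b = g b a" if "a \<noteq> b" for a b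
  proof -
    have "\<sigma> a \<noteq> \<sigma> b" using that permutes_inj[OF \<sigma>] by (simp add: inj_eq)
    then consider "\<sigma> a < \<sigma> b" | "\<sigma> b < \<sigma> a" by linarith
    then show ?thesis
      using that by cases (cases "a < b"; simp add: g_def w_def)+
  qed
  have 1: "psign (\<sigma> \<circ> \<tau>) xs = (\<Prod>(i,j)\<in>pairs n. w (\<lambda>i. xs ! i) (\<sigma> (\<tau> i)) (\<sigma> (\<tau> j)))"
    by (simp add: psign_prod n_def w_def)
  have 2: "psign \<sigma> xs = (\<Prod>(i,j)\<in>pairs n. w (\<lambda>i. xs ! i) (\<sigma> i) (\<sigma> j))"
    by (simp add: psign_prod n_def w_def)
  have 3: "psign \<tau> (permute_list \<sigma> xs) = (\<Prod>(i,j)\<in>pairs n. w (\<lambda>i. xs ! \<sigma> i) (\<tau> i) (\<tau> j))"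
    unfolding psign_prod length_permute_list n_def[symmetric] w_def
    by (intro prod.cong refl) (auto simp: pairs_def nth lt)
  have "psign (\<sigma> \<circ> \<tau>) xs * psign \<tau> (permute_list \<sigma> xs) = (\<Prod>(i,j)\<in>pairs n. g (\<tau> i) (\<tau> j))"
    unfolding 1 3 prod.distrib[symmetric] by (simp add: case_prod_unfold g_def)
  also have "\<dots> = (\<Prod>(i,j)\<in>pairs n. g i j)"
    by (rule prod_pairs_permute) (use \<tau> sym in \<open>auto simp: n_def\<close>)
  also have "\<dots> = psign \<sigma> xs"
    unfolding 2 by (intro prod.cong refl) (auto simp: pairs_def g_def w_def)
  finally have "psign (\<sigma> \<circ> \<tau>) xs * (psign \<tau> (permute_list \<sigma> xs) * psign \<tau> (permute_list \<sigma> xs))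
      = psign \<sigma> xs * psign \<tau> (permute_list \<sigma> xs)"
    by (simp only: mult.assoc[symmetric])
  then show ?thesis by (simp only: psign_square mult_1_right)
qed

lemma permute_list_update:
  assumes "\<sigma> permutes {..<length xs}" "j < length xs"
  shows "permute_list \<sigma> (xs[\<sigma> j := x]) = (permute_list \<sigma> xs)[j := x]"
proof (rule nth_equalityI)
  fix i assume "i < length (permute_list \<sigma> (xs[\<sigma> j := x]))"
  then have i: "i < length xs" by simp
  have "\<sigma> i < length xs" using i permutes_in_image[OF assms(1), of i] by auto
  moreover have "\<sigma> i = \<sigma> j \<longleftrightarrow> i = j"
    using permutes_inj[OF assms(1)] by (simp_all add: inj_eq)
  moreover have "permute_list \<sigma> (xs[\<sigma> j := x]) ! i = xs[\<sigma> j := x] ! \<sigma> i"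
    using assms i by (intro permute_list_nth) auto
  moreover have "permute_list \<sigma> xs ! i = xs ! \<sigma> i"
    using assms i by (intro permute_list_nth) auto
  ultimately show "permute_list \<sigma> (xs[\<sigma> j := x]) ! i = (permute_list \<sigma> xs)[j := x] ! i"
    using i by (cases "i = j") auto
qed simp

text \<open>An odd operator gives the same total sign on slot \<open>\<sigma> j\<close> before
  reordering as on slot \<open>j\<close> after it. Toggling the parity there affects only the
  inversions that involve \<open>j\<close>; these record which odd entries change sides relative to
  it, which is exactly how the two \<open>sg\<close> signs differ.\<close>

lemma psign_update:
  assumes \<sigma>: "\<sigma> permutes {..<length xs}" and j: "j < length xs"
    and flip: "is_odd x \<noteq> is_odd (xs ! \<sigma> j)"
  shows "psign \<sigma> (xs[\<sigma> j := x]) * sg xs (\<sigma> j) = psign \<sigma> xs * sg (permute_list \<sigma> xs) j"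
proof -
  define n p e f where "n = length xs" and "p = \<sigma> j" and "e a = is_odd (xs ! \<sigma> a)"
    and "f b = (if b then -1 else 1 :: complex)" for a b
  have \<sigma>': "\<sigma> permutes {..<n}" using \<sigma> by (simp add: n_def)
  have lt: "\<sigma> a < n \<longleftrightarrow> a < n" for a
    using permutes_in_image[OF \<sigma>', of a] by auto
  have inj: "\<sigma> a = \<sigma> b \<longleftrightarrow> a = b" for a b
    using permutes_inj[OF \<sigma>] by (simp_all add: inj_eq)
  define e' where "e' a = (if a = j then \<not> e a else e a)" for a
  have e': "is_odd (xs[p := x] ! \<sigma> a) = e' a" if "a < n" for a
    using flip that lt inj by (cases "a = j") (auto simp: e_def e'_def p_def n_def)
  have 1: "psign \<sigma> xs = (\<Prod>(a,b)\<in>pairs n. f (\<sigma> b < \<sigma> a \<and> e a \<and> e b))"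
    by (simp add: psign_prod n_def e_def f_def)
  have 2: "psign \<sigma> (xs[p := x]) = (\<Prod>(a,b)\<in>pairs n. f (\<sigma> b < \<sigma> a \<and> e' a \<and> e' b))"
    unfolding psign_prod length_list_update n_def[symmetric] f_def
    by (intro prod.cong refl) (auto simp: pairs_def e' simp del: nth_list_update)
  \<comment> \<open>Pairs avoiding \<open>j\<close> have equal factors in both signs, with product
    1; what remains are the pairs having \<open>j\<close> as second or as first member.\<close>
  have split: "pairs n = {(a,b)\<in>pairs n. a \<noteq> j \<and> b \<noteq> j} \<union> ((\<lambda>a. (a, j)) ` {..<j} \<union> (\<lambda>b. (j, b)) ` {j<..<n})"
    using j by (auto simp: pairs_def n_def)
  let ?h = "\<lambda>(a,b). f (\<sigma> b < \<sigma> a \<and> e a \<and> e b) * f (\<sigma> b < \<sigma> a \<and> e' a \<and> e' b)"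
  have "psign \<sigma> xs * psign \<sigma> (xs[p := x]) = (\<Prod>q\<in>pairs n. ?h q)"
    unfolding 1 2 prod.distrib[symmetric] by (simp add: case_prod_unfold)
  also have "\<dots> = (\<Prod>q\<in>{(a,b)\<in>pairs n. a \<noteq> j \<and> b \<noteq> j}. ?h q) *
     (\<Prod>q\<in>(\<lambda>a. (a, j)) ` {..<j} \<union> (\<lambda>b. (j, b)) ` {j<..<n}. ?h q)"
    by (subst split, rule prod.union_disjoint)
      (auto intro: finite_subset[OF _ finite_pairs[of n]])
  also have "(\<Prod>q\<in>{(a,b)\<in>pairs n. a \<noteq> j \<and> b \<noteq> j}. ?h q) = 1"
    by (rule prod.neutral) (auto simp: e'_def f_def)
  also have "(\<Prod>q\<in>(\<lambda>a. (a, j)) ` {..<j} \<union> (\<lambda>b. (j, b)) ` {j<..<n}. ?h q)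
    = (\<Prod>q\<in>(\<lambda>a. (a, j)) ` {..<j}. ?h q) * (\<Prod>q\<in>(\<lambda>b. (j, b)) ` {j<..<n}. ?h q)"
    by (rule prod.union_disjoint) auto
  \<comment> \<open>Exactly one of \<open>e j\<close> and \<open>e' j\<close> holds, so the two
    factors combine to a condition on \<open>a\<close> alone.\<close>
  also have "(\<Prod>q\<in>(\<lambda>a. (a, j)) ` {..<j}. ?h q) = (\<Prod>a<j. f (p < \<sigma> a \<and> e a))"
    by (subst prod.reindex) (auto simp: inj_on_def e'_def f_def p_def intro!: prod.cong)
  also have "(\<Prod>q\<in>(\<lambda>b. (j, b)) ` {j<..<n}. ?h q) = (\<Prod>b\<in>{j<..<n}. f (\<sigma> b < p \<and> e b))"
    by (subst prod.reindex) (auto simp: inj_on_def e'_def f_def p_def intro!: prod.cong)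
  finally have A: "psign \<sigma> xs * psign \<sigma> (xs[p := x]) =
    (\<Prod>a<j. f (p < \<sigma> a \<and> e a)) * (\<Prod>b\<in>{j<..<n}. f (\<sigma> b < p \<and> e b))" by simp
  have p: "p < n" using j lt by (simp add: p_def n_def)
  have "sg xs p = (\<Prod>a<n. f (a < p \<and> is_odd (xs ! a)))"
    unfolding sg_prod f_def using p by (intro prod.mono_neutral_cong_left) auto
  also have "\<dots> = (\<Prod>a<n. f (\<sigma> a < p \<and> e a))"
    using prod.permute[OF \<sigma>', of "\<lambda>a. f (a < p \<and> is_odd (xs ! a))"] by (simp add: o_def e_def)
  also have "{..<n} = {..<j} \<union> insert j {j<..<n}"
    using j by (auto simp: n_def)
  also have "(\<Prod>a\<in>{..<j} \<union> insert j {j<..<n}. f (\<sigma> a < p \<and> e a))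
     = (\<Prod>a<j. f (\<sigma> a < p \<and> e a)) * (\<Prod>a\<in>{j<..<n}. f (\<sigma> a < p \<and> e a))"
    by (subst prod.union_disjoint) (auto simp: p_def f_def)
  finally have B: "sg xs p = (\<Prod>a<j. f (\<sigma> a < p \<and> e a)) * (\<Prod>a\<in>{j<..<n}. f (\<sigma> a < p \<and> e a))" .
  have C: "sg (permute_list \<sigma> xs) j = (\<Prod>a<j. f (e a))"
    unfolding sg_prod f_def e_def using j
    by (intro prod.cong refl) (auto simp: permute_list_nth[OF \<sigma>])
  \<comment> \<open>Since \<open>a\<close> differs from \<open>j\<close>, its image lies strictly
    above or strictly below \<open>p\<close>.\<close>
  have D: "(\<Prod>a<j. f (p < \<sigma> a \<and> e a)) = (\<Prod>a<j. f (\<sigma> a < p \<and> e a)) * (\<Prod>a<j. f (e a))"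
    unfolding prod.distrib[symmetric] using inj
    by (intro prod.cong refl) (auto simp: f_def p_def)
  have "psign \<sigma> xs * psign \<sigma> (xs[p := x]) = sg xs p * sg (permute_list \<sigma> xs) j"
    unfolding A B C D by (simp add: mult_ac)
  then have "(psign \<sigma> xs * psign \<sigma> xs) * psign \<sigma> (xs[p := x]) * sg xs p
     = psign \<sigma> xs * sg (permute_list \<sigma> xs) j * (sg xs p * sg xs p)"
    by (simp only: mult_ac)
  then show ?thesis by (simp add: p_def)
qed

section \<open>Graded symmetrization\<close>

lemma gsym_alt: "gsym T xs = (\<Sum>\<sigma> | \<sigma> permutes {..<length xs}. psign \<sigma> xs * T (permute_list \<sigma> xs))"
  by (simp add: gsym_def psign_def permute_list_def)

text \<open>Composition with \<tau> reindexes the sum over permutations, and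
  \<open>psign_comp\<close> accounts for the signs.\<close>

lemma gsym_permute:
  assumes \<tau>: "\<tau> permutes {..<length xs}"
  shows "psign \<tau> xs * gsym T (permute_list \<tau> xs) = gsym T xs"
proof -
  have "psign \<tau> xs * gsym T (permute_list \<tau> xs) =
     (\<Sum>\<sigma> | \<sigma> permutes {..<length xs}. psign (\<tau> \<circ> \<sigma>) xs * T (permute_list (\<tau> \<circ> \<sigma>) xs))"
    unfolding gsym_alt sum_distrib_left using \<tau>
    by (intro sum.cong) (auto simp: psign_comp permute_list_compose)
  also have "\<dots> = gsym T xs"
    unfolding gsym_alt
    by (rule setum_permutations_compose_left[OF \<tau>, symmetric])
  finally show ?thesis .
qed

lemma gsym_gsym: "gsym (gsym T) xs = fact (length xs) * gsym T xs"
proof -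
  have "gsym (gsym T) xs = (\<Sum>\<sigma> | \<sigma> permutes {..<length xs}. gsym T xs)"
    unfolding gsym_alt[of "gsym T"] by (intro sum.cong) (auto simp: gsym_permute)
  also have "\<dots> = fact (length xs) * gsym T xs"
    by (simp add: card_permutations[of "{..<length xs}"])
  finally show ?thesis .
qed

section \<open>Operators acting on one slot\<close>

text \<open>The transposed action: \<open>\<kappa> x y\<close> is the coefficient of
  \<open>y\<close> in the image of \<open>x\<close>, so on coefficient tensors the new entry
  \<open>xs ! j\<close> is fixed and the old one is summed over.\<close>

definition slot :: "(lvar \<Rightarrow> lvar \<Rightarrow> complex) \<Rightarrow> nat \<Rightarrow> (lvar list \<Rightarrow> complex) \<Rightarrow> lvar list \<Rightarrow> complex" where
  "slot \<kappa> j T xs = sg xs j * (\<Sum>\<^sub>\<infinity>x. \<kappa> x (xs ! j) * T (xs[j := x]))"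

lemma qop_eq_sum_slot: "qop nabla s T xs = (\<Sum>j<length xs. slot (qc nabla s) j T xs)"
  by (simp add: qop_def slot_def sg_def)

lemma has_sum_sum:
  fixes f :: "'i \<Rightarrow> 'a \<Rightarrow> 'b :: topological_comm_monoid_add"
  assumes "finite I" "\<And>i. i \<in> I \<Longrightarrow> (f i has_sum S i) A"
  shows "((\<lambda>x. \<Sum>i\<in>I. f i x) has_sum (\<Sum>i\<in>I. S i)) A"
  using assms by (induction I rule: finite_induct) (auto intro: has_sum_add)

lemma infsum_sum:
  fixes f :: "'i \<Rightarrow> 'a \<Rightarrow> 'b :: {topological_comm_monoid_add, t2_space}"
  assumes "finite I" "\<And>i. i \<in> I \<Longrightarrow> f i summable_on A"
  shows "(\<Sum>\<^sub>\<infinity>x\<in>A. \<Sum>i\<in>I. f i x) = (\<Sum>i\<in>I. \<Sum>\<^sub>\<infinity>x\<in>A. f i x)"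
  by (rule infsumI, rule has_sum_sum) (use assms in auto)

lemma summable_on_prod:
  fixes f :: "'a \<Rightarrow> real" and g :: "'b \<Rightarrow> real"
  assumes "f summable_on A" "g summable_on B"
    and "\<And>x. x \<in> A \<Longrightarrow> f x \<ge> 0" "\<And>y. y \<in> B \<Longrightarrow> g y \<ge> 0"
  shows "(\<lambda>(x,y). f x * g y) summable_on A \<times> B"
proof (rule summable_on_SigmaI[where g = "\<lambda>x. f x * infsum g B"])
  show "((\<lambda>y. case (x, y) of (x, y) \<Rightarrow> f x * g y) has_sum f x * infsum g B) B" for x
    using assms by (auto intro!: has_sum_cmult_right)
  show "(\<lambda>x. f x * infsum g B) summable_on A"
    using assms by (intro summable_on_cmult_left)
qed (use assms in auto)

text \<open>Slot \<open>\<sigma> j\<close> of \<open>xs\<close> becomes slot \<open>j\<close> of the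
  reordered list, with matching signs by \<open>psign_update\<close>. Permutations thus mix the
  slots, and it is the sum over all of them that commutes with symmetrization. Summability lets the
  finite sum over permutations leave the infinite one.\<close>

lemma gsym_sum_slot:
  assumes flip: "\<And>x y. \<kappa> x y \<noteq> 0 \<Longrightarrow> is_odd x \<noteq> is_odd y"
    and summable: "\<And>xs j. j < length xs \<Longrightarrow> (\<lambda>x. \<kappa> x (xs ! j) * T (xs[j := x])) summable_on UNIV"
  shows "(\<Sum>j<length xs. slot \<kappa> j (gsym T) xs) = gsym (\<lambda>xs. \<Sum>j<length xs. slot \<kappa> j T xs) xs"
proof -
  let ?n = "length xs" and ?P = "{\<sigma>. \<sigma> permutes {..<length xs}}"
  let ?t = "\<lambda>\<sigma> p. \<Sum>\<^sub>\<infinity>x. \<kappa> x (xs ! p) * (psign \<sigma> (xs[p := x]) * sg xs p * T (permute_list \<sigma> (xs[p := x])))"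
  have key: "?t \<sigma> (\<sigma> j) = psign \<sigma> xs * slot \<kappa> j T (permute_list \<sigma> xs)"
    and summ: "(\<lambda>x. \<kappa> x (xs ! \<sigma> j) * (psign \<sigma> (xs[\<sigma> j := x]) * sg xs (\<sigma> j) * T (permute_list \<sigma> (xs[\<sigma> j := x]))))
       summable_on UNIV"
    if \<sigma>: "\<sigma> permutes {..<?n}" and j: "j < ?n" for \<sigma> j
  proof -
    have nth: "permute_list \<sigma> xs ! j = xs ! \<sigma> j"
      using \<sigma> j by (rule permute_list_nth)
    have eq: "\<kappa> x (xs ! \<sigma> j) * (psign \<sigma> (xs[\<sigma> j := x]) * sg xs (\<sigma> j) * T (permute_list \<sigma> (xs[\<sigma> j := x])))
       = psign \<sigma> xs * sg (permute_list \<sigma> xs) j *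
          (\<kappa> x (permute_list \<sigma> xs ! j) * T ((permute_list \<sigma> xs)[j := x]))" for x
    proof (cases "\<kappa> x (xs ! \<sigma> j) = 0")
      case False
      show ?thesis
        unfolding psign_update[OF \<sigma> j flip[OF False]] permute_list_update[OF \<sigma> j] nth
        by (simp add: mult_ac)
    qed (simp add: nth)
    show "?t \<sigma> (\<sigma> j) = psign \<sigma> xs * slot \<kappa> j T (permute_list \<sigma> xs)"
      unfolding eq slot_def by (simp add: infsum_cmult_right' mult.assoc)
    show "(\<lambda>x. \<kappa> x (xs ! \<sigma> j) * (psign \<sigma> (xs[\<sigma> j := x]) * sg xs (\<sigma> j) * T (permute_list \<sigma> (xs[\<sigma> j := x]))))
       summable_on UNIV"
      unfolding eq by (rule summable_on_cmult_right, rule summable) (use j in simp)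
  qed
  have "slot \<kappa> p (gsym T) xs = (\<Sum>\<sigma>\<in>?P. ?t \<sigma> p)" if p: "p < ?n" for p
  proof -
    have "slot \<kappa> p (gsym T) xs =
       (\<Sum>\<^sub>\<infinity>x. \<Sum>\<sigma>\<in>?P. \<kappa> x (xs ! p) * (psign \<sigma> (xs[p := x]) * sg xs p * T (permute_list \<sigma> (xs[p := x]))))"
      unfolding slot_def gsym_alt
      by (subst infsum_cmult_right'[symmetric]) (simp add: sum_distrib_left mult_ac)
    also have "\<dots> = (\<Sum>\<sigma>\<in>?P. ?t \<sigma> p)"
    proof (rule infsum_sum)
      show "finite ?P" by (simp add: finite_permutations)
    next
      fix \<sigma> assume "\<sigma> \<in> ?P"
      then have \<sigma>: "\<sigma> permutes {..<?n}" by simp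
      then have "\<sigma> (inv \<sigma> p) = p" "inv \<sigma> p < ?n"
        using permutes_inverses[OF \<sigma>] permutes_in_image[OF permutes_inv[OF \<sigma>], of p] p by auto
      then show "(\<lambda>x. \<kappa> x (xs ! p) * (psign \<sigma> (xs[p := x]) * sg xs p * T (permute_list \<sigma> (xs[p := x]))))
          summable_on UNIV"
        using summ[OF \<sigma>, of "inv \<sigma> p"] by simp
    qed
    finally show ?thesis .
  qed
  then have "(\<Sum>j<?n. slot \<kappa> j (gsym T) xs) = (\<Sum>\<sigma>\<in>?P. \<Sum>p<?n. ?t \<sigma> p)"
    by (simp add: sum.swap[of _ "{..<?n}"])
  also have "\<dots> = (\<Sum>\<sigma>\<in>?P. \<Sum>j<?n. ?t \<sigma> (\<sigma> j))"
  proof (rule sum.cong)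
    fix \<sigma> assume "\<sigma> \<in> ?P"
    then have "\<sigma> permutes {..<?n}" by simp
    from sum.permute[OF this, of "?t \<sigma>"] show "(\<Sum>p<?n. ?t \<sigma> p) = (\<Sum>j<?n. ?t \<sigma> (\<sigma> j))"
      by (simp only: o_def)
  qed simp
  also have "\<dots> = (\<Sum>\<sigma>\<in>?P. \<Sum>j<?n. psign \<sigma> xs * slot \<kappa> j T (permute_list \<sigma> xs))"
    by (intro sum.cong refl key) auto
  also have "\<dots> = gsym (\<lambda>xs. \<Sum>j<length xs. slot \<kappa> j T xs) xs"
    by (simp add: gsym_alt sum_distrib_left)
  finally show ?thesis .
qed

section \<open>Anticommutation of operators on different slots\<close>

lemma sg_update_less:
  assumes "i < j" "j < length xs" "is_odd x \<noteq> is_odd (xs ! i)"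
  shows "sg (xs[i := x]) j = - sg xs j"
proof -
  have "sg ys j = (if is_odd (ys ! i) then -1 else 1) * (\<Prod>k\<in>{..<j} - {i}. if is_odd (ys ! k) then -1 else 1)" for ys
    unfolding sg_prod using assms(1) by (subst prod.remove[of _ i]) auto
  note this[of xs] this[of "xs[i := x]"]
  moreover have "(\<Prod>k\<in>{..<j} - {i}. if is_odd (xs[i := x] ! k) then -1 else 1 :: complex)
     = (\<Prod>k\<in>{..<j} - {i}. if is_odd (xs ! k) then -1 else 1)"
    by (intro prod.cong) auto
  ultimately show ?thesis using assms by auto
qed

lemma sg_update_ge:
  assumes "i \<le> j"
  shows "sg (xs[j := x]) i = sg xs i"
  unfolding sg_prod using assms by (intro prod.cong) auto

text \<open>The sign arises on one side only: changing the parity of entry \<open>i\<close> flips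
  \<open>sg\<close> at the later slot \<open>j\<close>, whereas changing entry \<open>j\<close>
  leaves \<open>sg\<close> at \<open>i\<close> alone. The product majorant \<open>a x * b y\<close>
  justifies exchanging the infinite sums.\<close>

lemma slot_anticommute_less:
  assumes ij: "i < j" "j < length xs"
    and flip1: "\<And>x y. \<kappa> x y \<noteq> 0 \<Longrightarrow> is_odd x \<noteq> is_odd y"
    and a: "(\<lambda>x. norm (\<kappa> x (xs ! i)) * a x) summable_on UNIV"
    and b: "(\<lambda>y. norm (\<kappa>' y (xs ! j)) * b y) summable_on UNIV"
    and nonneg: "\<And>x. a x \<ge> 0" "\<And>y. b y \<ge> 0"
    and bound: "\<And>x y. norm (T (xs[i := x, j := y])) \<le> a x * b y"
  shows "slot \<kappa> i (slot \<kappa>' j T) xs = - slot \<kappa>' j (slot \<kappa> i T) xs"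
proof -
  let ?F = "\<lambda>x y. \<kappa> x (xs ! i) * (\<kappa>' y (xs ! j) * T (xs[i := x, j := y]))"
  have "(\<lambda>(x,y). (norm (\<kappa> x (xs ! i)) * a x) * (norm (\<kappa>' y (xs ! j)) * b y)) summable_on UNIV \<times> UNIV"
    by (rule summable_on_prod) (use a b nonneg in auto)
  then have "(\<lambda>p. norm (case p of (x,y) \<Rightarrow> ?F x y)) summable_on UNIV \<times> UNIV"
  proof (rule Infinite_Sum.abs_summable_on_comparison_test')
    fix p :: "lvar \<times> lvar"
    obtain x y where p: "p = (x,y)" by (cases p)
    have "norm (?F x y) \<le> norm (\<kappa> x (xs ! i)) * (norm (\<kappa>' y (xs ! j)) * (a x * b y))"
      unfolding norm_mult by (intro mult_left_mono bound) auto
    then show "norm (case p of (x,y) \<Rightarrow> ?F x y) \<le>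
       (case p of (x,y) \<Rightarrow> (norm (\<kappa> x (xs ! i)) * a x) * (norm (\<kappa>' y (xs ! j)) * b y))"
      by (simp add: p mult_ac)
  qed
  then have "(\<lambda>(x,y). ?F x y) summable_on UNIV \<times> UNIV"
    by (rule abs_summable_summable)
  then have swap: "(\<Sum>\<^sub>\<infinity>x. \<Sum>\<^sub>\<infinity>y. ?F x y) = (\<Sum>\<^sub>\<infinity>y. \<Sum>\<^sub>\<infinity>x. ?F x y)"
    by (rule infsum_swap_banach)
  have "\<kappa> x (xs ! i) * slot \<kappa>' j T (xs[i := x]) = - sg xs j * (\<Sum>\<^sub>\<infinity>y. ?F x y)" for x
  proof (cases "\<kappa> x (xs ! i) = 0")
    case False
    then show ?thesis
      using ij flip1[OF False]
      by (simp add: slot_def sg_update_less infsum_cmult_right' mult_ac)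
  qed simp
  then have L: "slot \<kappa> i (slot \<kappa>' j T) xs = - (sg xs i * sg xs j * (\<Sum>\<^sub>\<infinity>x. \<Sum>\<^sub>\<infinity>y. ?F x y))"
    unfolding slot_def[of \<kappa> i] by (simp add: infsum_cmult_right' infsum_uminus mult_ac)
  have "\<kappa>' y (xs ! j) * slot \<kappa> i T (xs[j := y]) = sg xs i * (\<Sum>\<^sub>\<infinity>x. ?F x y)" for y
    using ij by (simp add: slot_def sg_update_ge infsum_cmult_right'[symmetric] list_update_swap mult_ac)
  then have R: "slot \<kappa>' j (slot \<kappa> i T) xs = sg xs i * sg xs j * (\<Sum>\<^sub>\<infinity>y. \<Sum>\<^sub>\<infinity>x. ?F x y)"
    unfolding slot_def[of \<kappa>' j] by (simp add: infsum_cmult_right' mult_ac)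
  show ?thesis unfolding L R swap by simp
qed

lemma slot_anticommute:
  assumes ij: "i \<noteq> j" "i < length xs" "j < length xs"
    and flip: "\<And>x y. \<kappa> x y \<noteq> 0 \<Longrightarrow> is_odd x \<noteq> is_odd y" "\<And>x y. \<kappa>' x y \<noteq> 0 \<Longrightarrow> is_odd x \<noteq> is_odd y"
    and a: "(\<lambda>x. norm (\<kappa> x (xs ! i)) * a x) summable_on UNIV"
    and b: "(\<lambda>y. norm (\<kappa>' y (xs ! j)) * b y) summable_on UNIV"
    and nonneg: "\<And>x. a x \<ge> 0" "\<And>y. b y \<ge> 0"
    and bound: "\<And>x y. norm (T (xs[i := x, j := y])) \<le> a x * b y"
  shows "slot \<kappa> i (slot \<kappa>' j T) xs = - slot \<kappa>' j (slot \<kappa> i T) xs"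
proof (cases "i < j")
  case True
  then show ?thesis
    by (rule slot_anticommute_less[where a = a and b = b]) (use assms in auto)
next
  case False
  then have "j < i" using ij by simp
  then have "slot \<kappa>' j (slot \<kappa> i T) xs = - slot \<kappa> i (slot \<kappa>' j T) xs"
  proof (rule slot_anticommute_less[where a = b and b = a])
    show "norm (T (xs[j := x, i := y])) \<le> b x * a y" for x y
      using bound[of y x] ij(1) by (simp add: list_update_swap mult.commute)
  qed (use assms in auto)
  then show ?thesis by simp
qed

section \<open>Uniformly local tensors\<close>

definition pos :: "lvar \<Rightarrow> int" where "pos x = snd (snd x)"

definition shift :: "int \<Rightarrow> lvar \<Rightarrow> lvar" where
  "shift c x = (fst x, fst (snd x), snd (snd x) + c)"

lemma shift_simps [simp]:
  "fst (shift c x) = fst x" "fst (snd (shift c x)) = fst (snd x)" "pos (shift c x) = pos x + c"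
  "snd (snd (shift c x)) = snd (snd x) + c" "is_odd (shift c x) = is_odd x"
  by (simp_all add: shift_def pos_def is_odd_def)

lemma shift_cancel [simp]: "shift c (shift d x) = shift (c + d) x" "shift 0 x = x"
  by (simp_all add: shift_def)

text \<open>All pairs of slots are compared, rather than each slot with the first, which makes the
  bound stable under permutations. The case \<open>a = b\<close> contains plain boundedness on
  nonempty lists.\<close>

definition decays :: "real \<Rightarrow> real \<Rightarrow> (lvar list \<Rightarrow> complex) \<Rightarrow> bool" where
  "decays L M T \<longleftrightarrow> (\<forall>xs a b. a < length xs \<longrightarrow> b < length xs \<longrightarrow>
     norm (T xs) \<le> L * exp (- M * \<bar>real_of_int (pos (xs ! a) - pos (xs ! b))\<bar>))"

text \<open>The working form of locality: one pair of constants for all field types and lengths, so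
  that estimates need not follow type sequences.\<close>

definition uniformly_local :: "nat \<Rightarrow> (lvar list \<Rightarrow> complex) \<Rightarrow> bool" where
  "uniformly_local N T \<longleftrightarrow> (\<forall>xs. N < length xs \<longrightarrow> T xs = 0) \<and> (\<forall>xs. T (map (shift 1) xs) = T xs) \<and>
     (\<exists>L>0. \<exists>M>0. decays L M T)"

lemma uniformly_localI:
  assumes "\<And>xs. N < length xs \<Longrightarrow> T xs = 0" "\<And>xs. T (map (shift 1) xs) = T xs"
    and "L > 0" "M > 0" "decays L M T"
  shows "uniformly_local N T"
  using assms unfolding uniformly_local_def by blast

lemma uniformly_localD:
  assumes "uniformly_local N T"
  shows "N < length xs \<Longrightarrow> T xs = 0" "T (map (shift 1) xs) = T xs"
  using assms by (auto simp: uniformly_local_def)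

lemma decaysD:
  "decays L M T \<Longrightarrow> a < length xs \<Longrightarrow> b < length xs \<Longrightarrow>
     norm (T xs) \<le> L * exp (- M * \<bar>real_of_int (pos (xs ! a) - pos (xs ! b))\<bar>)"
  by (simp add: decays_def)

lemma decays_mono:
  assumes "decays L M T" "L \<le> L'" "M' \<le> M" "0 \<le> L'"
  shows "decays L' M' T"
  unfolding decays_def
proof (intro allI impI)
  fix xs :: "lvar list" and a b assume "a < length xs" "b < length xs"
  then have "norm (T xs) \<le> L * exp (- M * \<bar>real_of_int (pos (xs ! a) - pos (xs ! b))\<bar>)"
    by (rule decaysD[OF assms(1)])
  also have "\<dots> \<le> L' * exp (- M' * \<bar>real_of_int (pos (xs ! a) - pos (xs ! b))\<bar>)"
    using assms by (intro mult_mono) (auto intro!: mult_right_mono)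
  finally show "norm (T xs) \<le> L' * exp (- M' * \<bar>real_of_int (pos (xs ! a) - pos (xs ! b))\<bar>)" .
qed

lemma decays_bounded:
  assumes "decays L M T" "xs \<noteq> []"
  shows "norm (T xs) \<le> L"
  using decaysD[OF assms(1), of 0 xs 0] assms(2) by simp

lemma uniformly_local_add:
  assumes "uniformly_local N T" "uniformly_local N S"
  shows "uniformly_local N (\<lambda>xs. T xs + S xs)"
proof -
  obtain L M where T: "L > 0" "M > 0" "decays L M T" using assms by (auto simp: uniformly_local_def)
  obtain L' M' where S: "L' > 0" "M' > 0" "decays L' M' S" using assms by (auto simp: uniformly_local_def)
  have "decays L (min M M') T" "decays L' (min M M') S"
    using T S by (auto intro: decays_mono)
  then have "decays (L + L') (min M M') (\<lambda>xs. T xs + S xs)"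
    unfolding decays_def distrib_right by (blast intro: norm_triangle_mono)
  moreover have "L + L' > 0" "min M M' > 0" using T S by auto
  ultimately show ?thesis
    by (intro uniformly_localI[of N _ "L + L'" "min M M'"]) (simp_all add: uniformly_localD[OF assms(1)] uniformly_localD[OF assms(2)])
qed

text \<open>Only lengths up to \<open>N\<close> occur, so a factor depending on the length is
  effectively bounded; factorial normalisations are of this kind.\<close>

lemma uniformly_local_scale:
  assumes "uniformly_local N T"
  shows "uniformly_local N (\<lambda>xs. c (length xs) * T xs)"
proof -
  obtain L M where T: "L > 0" "M > 0" "decays L M T" using assms by (auto simp: uniformly_local_def)
  define B where "B = (\<Sum>i\<le>N. norm (c i)) + 1"
  have "0 \<le> (\<Sum>i\<le>N. norm (c i))" by (intro sum_nonneg) auto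
  then have B: "B > 0" by (simp add: B_def)
  have c: "norm (c i) \<le> B" if "i \<le> N" for i
    using member_le_sum[of i "{..N}" "\<lambda>i. norm (c i)"] that by (simp add: B_def)
  have "decays (B * L) M (\<lambda>xs. c (length xs) * T xs)"
    unfolding decays_def
  proof (intro allI impI)
    fix xs :: "lvar list" and a b assume ab: "a < length xs" "b < length xs"
    show "norm (c (length xs) * T xs) \<le> B * L * exp (- M * \<bar>real_of_int (pos (xs ! a) - pos (xs ! b))\<bar>)"
    proof (cases "length xs \<le> N")
      case True
      then show ?thesis
        unfolding norm_mult mult.assoc[of B] using B by (intro mult_mono c decaysD[OF T(3)] ab) auto
    next
      case False
      then have "T xs = 0" using assms by (simp add: uniformly_local_def)
      then show ?thesis using B T by simp
    qed
  qed
  moreover have "B * L > 0" using B T by simp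
  ultimately show ?thesis
    by (intro uniformly_localI[of N _ "B * L" M]) (simp_all add: uniformly_localD[OF assms] T)
qed

lemma uniformly_local_diff:
  assumes "uniformly_local N T" "uniformly_local N S"
  shows "uniformly_local N (\<lambda>xs. T xs - S xs)"
  using uniformly_local_add[OF assms(1) uniformly_local_scale[OF assms(2), of "\<lambda>_. - 1"]] by simp

lemma uniformly_local_restrict:
  assumes "uniformly_local N T" "\<And>xs. p (map (shift 1) xs) = p xs"
  shows "uniformly_local N (\<lambda>xs. if p xs then T xs else 0)"
proof -
  obtain L M where T: "L > 0" "M > 0" "decays L M T" using assms by (auto simp: uniformly_local_def)
  then have "decays L M (\<lambda>xs. if p xs then T xs else 0)"
    by (auto simp: decays_def)
  then show ?thesis
    by (intro uniformly_localI[of N _ L M]) (simp_all add: uniformly_localD[OF assms(1)] T assms(2))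
qed

lemma uniformly_local_gsym:
  assumes "uniformly_local N T"
  shows "uniformly_local N (gsym T)"
proof -
  obtain L M where T: "L > 0" "M > 0" "decays L M T" using assms by (auto simp: uniformly_local_def)
  have zero: "gsym T xs = 0" if "N < length xs" for xs
    using assms that by (simp add: gsym_alt uniformly_local_def)
  have "gsym T (map (shift 1) xs) = gsym T xs" for xs
  proof -
    have "psign \<sigma> (map (shift 1) xs) = psign \<sigma> xs"
      "permute_list \<sigma> (map (shift 1) xs) = map (shift 1) (permute_list \<sigma> xs)"
      if \<sigma>: "\<sigma> permutes {..<length xs}" for \<sigma>
    proof -
      have "\<sigma> i < length xs" if "i < length xs" for i
        using permutes_in_image[OF \<sigma>, of i] that by simp
      then show "psign \<sigma> (map (shift 1) xs) = psign \<sigma> xs"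
        unfolding psign_prod by (intro prod.cong) (auto simp: pairs_def)
    qed (rule permute_list_map[OF \<sigma>])
    then show ?thesis
      using assms by (simp add: gsym_alt uniformly_local_def)
  qed
  moreover have "decays (fact N * L) M (gsym T)"
    unfolding decays_def
  proof (intro allI impI)
    fix xs :: "lvar list" and a b assume ab: "a < length xs" "b < length xs"
    let ?e = "exp (- M * \<bar>real_of_int (pos (xs ! a) - pos (xs ! b))\<bar>)"
    show "norm (gsym T xs) \<le> fact N * L * ?e"
    proof (cases "N < length xs")
      case True
      then show ?thesis using zero T by simp
    next
      case False
      have "norm (gsym T xs) \<le> (\<Sum>\<sigma> | \<sigma> permutes {..<length xs}. L * ?e)"
        unfolding gsym_alt
      proof (rule sum_norm_le)
        fix \<sigma> assume "\<sigma> \<in> {\<sigma>. \<sigma> permutes {..<length xs}}"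
        then have \<sigma>: "\<sigma> permutes {..<length xs}" by simp
        have "inv \<sigma> i < length xs \<and> permute_list \<sigma> xs ! inv \<sigma> i = xs ! i" if "i < length xs" for i
          using permutes_in_image[OF permutes_inv[OF \<sigma>], of i] that permutes_inverses[OF \<sigma>]
          by (simp add: permute_list_nth[OF \<sigma>])
        with ab decaysD[OF T(3), of "inv \<sigma> a" "permute_list \<sigma> xs" "inv \<sigma> b"]
        show "norm (psign \<sigma> xs * T (permute_list \<sigma> xs)) \<le> L * ?e"
          by (simp add: norm_mult)
      qed
      also have "\<dots> = fact (length xs) * (L * ?e)"
        by (simp add: card_permutations[of "{..<length xs}"])
      also have "\<dots> \<le> fact N * (L * ?e)"
        using False T by (intro mult_right_mono fact_mono) auto
      finally show ?thesis by (simp add: mult.assoc)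
    qed
  qed
  moreover have "fact N * L > 0" using T by simp
  ultimately show ?thesis
    by (intro uniformly_localI[of N _ "fact N * L" M]) (simp_all add: zero T)
qed

section \<open>Comparison of local functionals with uniformly local tensors\<close>

lemma tilc_shift:
  assumes "tilc C n" "length ms = n"
  shows "C (map (\<lambda>m. m + c) ms) = C ms"
proof -
  have nat: "C (map (\<lambda>m. m + int k) ms) = C ms" if "length ms = n" for k ms
    using that
  proof (induction k arbitrary: ms)
    case (Suc k)
    have "C (map (\<lambda>m. m + int (Suc k)) ms) = C (map (\<lambda>m. m + 1) (map (\<lambda>m. m + int k) ms))"
      by (simp add: o_def algebra_simps)
    also have "\<dots> = C (map (\<lambda>m. m + int k) ms)"
      using assms(1) Suc.prems by (simp add: tilc_def del: map_map)
    finally show ?case using Suc by simp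
  qed simp
  show ?thesis
  proof (cases "c \<ge> 0")
    case True
    then show ?thesis using nat[OF assms(2), of "nat c"] by simp
  next
    case False
    then have "C ms = C (map (\<lambda>m. m + int (nat (- c))) (map (\<lambda>m. m + c) ms))"
      by (simp add: o_def)
    then show ?thesis using nat[of "map (\<lambda>m. m + c) ms" "nat (- c)"] assms(2) by simp
  qed
qed

text \<open>If some coordinate is far from the first one, the farthest such coordinate controls
  every pairwise distance at half the rate. Otherwise translation leaves only finitely many
  configurations.\<close>

lemma tilc_bound:
  assumes C: "tilc C n"
  shows "\<exists>L>0. \<exists>M>0. \<forall>ms a b. length ms = n \<longrightarrow> a < n \<longrightarrow> b < n \<longrightarrow>
     norm (C ms) \<le> L * exp (- M * \<bar>real_of_int (ms ! a - ms ! b)\<bar>)"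
proof -
  obtain L M K where LM: "L > 0" "M > 0" and b: "\<And>ms j. length ms = n \<Longrightarrow> j \<in> {1..<n} \<Longrightarrow>
     K \<le> \<bar>ms!0 - ms!j\<bar> \<Longrightarrow> norm (C ms) < L * exp (- M * real_of_int \<bar>ms!0 - ms!j\<bar>)"
    using C unfolding tilc_def by blast
  define F where "F = {ms. set ms \<subseteq> {-\<bar>K\<bar>..\<bar>K\<bar>} \<and> length ms = n}"
  have fin: "finite F" unfolding F_def by (intro finite_lists_length_eq) simp
  define B where "B = (\<Sum>ms\<in>F. norm (C ms))"
  have B: "B \<ge> 0" unfolding B_def by (intro sum_nonneg) auto
  \<comment> \<open>When all coordinates are within \<open>\<bar>K\<bar>\<close> of the first,
    pairwise distances are at most twice that, so at rate \<open>M / 2\<close> the exponential loses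
    at most the factor compensated here.\<close>
  define L' where "L' = L + B * exp (M * \<bar>real_of_int K\<bar>)"
  have "norm (C ms) \<le> L' * exp (- (M / 2) * \<bar>real_of_int (ms ! a - ms ! b)\<bar>)"
    if ms: "length ms = n" and ab: "a < n" "b < n" for ms a b
  proof (cases "\<exists>j\<in>{1..<n}. K \<le> \<bar>ms!0 - ms!j\<bar>")
    case True
    define f where "f j = \<bar>ms!0 - ms!j\<bar>" for j
    have ne: "{1..<n} \<noteq> {}" using True by auto
    then have "Max (f ` {1..<n}) \<in> f ` {1..<n}" by (intro Max_in) auto
    then obtain j where j: "j \<in> {1..<n}" "f j = Max (f ` {1..<n})" by auto
    have max: "f i \<le> f j" if "i \<in> {1..<n}" for i
      unfolding j(2) using that by (intro Max_ge) auto
    have max': "f i \<le> f j" if "i < n" for i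
    proof (cases "i = 0")
      case True
      then show ?thesis by (simp add: f_def)
    qed (use max that in auto)
    have "K \<le> f j" using True max unfolding f_def by fastforce
    then have "norm (C ms) \<le> L * exp (- M * real_of_int (f j))"
      using b[OF ms j(1)] by (simp add: f_def)
    also have "\<dots> \<le> L' * exp (- (M / 2) * \<bar>real_of_int (ms ! a - ms ! b)\<bar>)"
    proof (intro mult_mono)
      have "\<bar>ms ! a - ms ! b\<bar> \<le> 2 * f j"
      proof -
        have "\<bar>ms ! a - ms ! b\<bar> \<le> f a + f b" unfolding f_def by linarith
        then show ?thesis using max'[OF ab(1)] max'[OF ab(2)] by linarith
      qed
      then have "\<bar>real_of_int (ms ! a - ms ! b)\<bar> \<le> 2 * real_of_int (f j)" by linarith
      then show "exp (- M * real_of_int (f j)) \<le> exp (- (M / 2) * \<bar>real_of_int (ms ! a - ms ! b)\<bar>)"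
        using LM by (simp add: field_simps)
    qed (use LM B in \<open>auto simp: L'_def\<close>)
    finally show ?thesis .
  next
    case False
    have close: "\<bar>ms ! 0 - ms ! j\<bar> \<le> \<bar>K\<bar>" if "j < n" for j
    proof (cases "j = 0")
      case False
      with that have "j \<in> {1..<n}" by simp
      with \<open>\<not> (\<exists>j\<in>{1..<n}. K \<le> \<bar>ms!0 - ms!j\<bar>)\<close> show ?thesis by (meson abs_ge_self linear order_trans)
    qed simp
    \<comment> \<open>Moving the first coordinate to 0 puts the configuration into the finite set
      \<open>F\<close> without changing the coefficient.\<close>
    let ?ms = "map (\<lambda>m. m + (- (ms ! 0))) ms"
    have "?ms \<in> F"
      using close ms by (fastforce simp: F_def in_set_conv_nth)
    then have "norm (C ?ms) \<le> B"
      unfolding B_def using fin by (intro member_le_sum) auto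
    then have "norm (C ms) \<le> B"
      by (simp only: tilc_shift[OF C ms])
    also have "\<dots> \<le> B * exp (M * \<bar>real_of_int K\<bar>) * exp (- (M / 2) * \<bar>real_of_int (ms ! a - ms ! b)\<bar>)"
    proof -
      have "\<bar>ms ! a - ms ! b\<bar> \<le> 2 * \<bar>K\<bar>"
        using close[OF ab(1)] close[OF ab(2)] by linarith
      then have "\<bar>real_of_int (ms ! a - ms ! b)\<bar> \<le> 2 * \<bar>real_of_int K\<bar>" by linarith
      then have "1 \<le> exp (M * \<bar>real_of_int K\<bar> + - (M / 2) * \<bar>real_of_int (ms ! a - ms ! b)\<bar>)"
        using LM by (simp add: field_simps)
      then show ?thesis using B unfolding mult.assoc exp_add[symmetric]
        by (metis mult_left_mono mult.right_neutral)
    qed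
    also have "\<dots> \<le> L' * exp (- (M / 2) * \<bar>real_of_int (ms ! a - ms ! b)\<bar>)"
      using LM by (intro mult_right_mono) (auto simp: L'_def)
    finally show ?thesis .
  qed
  moreover have "L' > 0" using LM B by (simp add: L'_def add_pos_nonneg)
  moreover have "M / 2 > 0" using LM by simp
  ultimately show ?thesis by blast
qed

lemma finite_fld_sgn: "finite (UNIV :: fld set)" "finite (UNIV :: sgn set)"
proof -
  have "(UNIV :: fld set) = {Phi, Ff, Chi, Chb}" "(UNIV :: sgn set) = {Pl, Mi}"
    using fld.exhaust sgn.exhaust by auto
  then show "finite (UNIV :: fld set)" "finite (UNIV :: sgn set)"
    by (metis finite.simps)+
qed

lemma map2_types_positions:
  "map2 (\<lambda>k m. (fst k, snd k, m)) (map (\<lambda>x. (fst x, fst (snd x))) xs) (map pos xs) = xs"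
  by (induction xs) (auto simp: pos_def)

lemma finite_uniform_bounds:
  fixes \<Phi> :: "'a \<Rightarrow> real \<Rightarrow> real \<Rightarrow> bool"
  assumes "finite A" and "\<And>k. k \<in> A \<Longrightarrow> \<exists>L>0. \<exists>M>0. \<Phi> k L M"
    and mono: "\<And>k L M L' M'. \<Phi> k L M \<Longrightarrow> 0 < L \<Longrightarrow> L \<le> L' \<Longrightarrow> 0 < M' \<Longrightarrow> M' \<le> M \<Longrightarrow> \<Phi> k L' M'"
  shows "\<exists>L>0. \<exists>M>0. \<forall>k\<in>A. \<Phi> k L M"
  using assms(1,2)
proof (induction A rule: finite_induct)
  case empty
  show ?case by (auto intro!: exI[of _ 1])
next
  case (insert a A)
  then have "\<exists>L>0. \<exists>M>0. \<forall>k\<in>A. \<Phi> k L M" by simp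
  then obtain L M where LM: "L > 0" "M > 0" "\<forall>k\<in>A. \<Phi> k L M" by blast
  obtain L' M' where LM': "L' > 0" "M' > 0" "\<Phi> a L' M'" using insert.prems[of a] by blast
  have "\<Phi> k (max L L') (min M M')" if "k \<in> insert a A" for k
  proof (cases "k = a")
    case True
    then show ?thesis using LM LM' mono[of a L' M'] by simp
  next
    case False
    then have "\<Phi> k L M" using that LM by simp
    from mono[OF this] show ?thesis using LM LM' by simp
  qed
  moreover have "max L L' > 0" "min M M' > 0" using LM LM' by auto
  ultimately show ?case by blast
qed

text \<open>There are finitely many type sequences of length at most \<open>N\<close>, so their
  separate constants combine into one pair.\<close>

lemma uniformly_local_if_local_functional:
  assumes "local_functional T"
  obtains N where "uniformly_local N T"
proof -
  obtain N where N: "\<And>xs. N < length xs \<Longrightarrow> T xs = 0"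
    and til: "\<And>ks. tilc (\<lambda>ms. T (map2 (\<lambda>k m. (fst k, snd k, m)) ks ms)) (length ks)"
    using assms by (auto simp: local_functional_def)
  let ?A = "{ks :: (fld \<times> sgn) list. set ks \<subseteq> UNIV \<times> UNIV \<and> length ks \<le> N}"
  let ?\<Phi> = "\<lambda>ks L M. \<forall>ms a b. length ms = length ks \<longrightarrow> a < length ks \<longrightarrow> b < length ks \<longrightarrow>
     norm (T (map2 (\<lambda>k m. (fst k, snd k, m)) ks ms)) \<le> L * exp (- M * \<bar>real_of_int (ms ! a - ms ! b)\<bar>)"
  have fin: "finite ?A"
    by (intro finite_lists_length_le finite_cartesian_product finite_fld_sgn)
  have "\<exists>L>0. \<exists>M>0. \<forall>ks\<in>?A. ?\<Phi> ks L M"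
  proof (rule finite_uniform_bounds[OF fin])
    show "\<exists>L>0. \<exists>M>0. ?\<Phi> ks L M" for ks
      using tilc_bound[OF til[of ks]] by blast
    show "?\<Phi> ks L' M'" if \<Phi>: "?\<Phi> ks L M" and le: "0 < L" "L \<le> L'" "0 < M'" "M' \<le> M" for ks L M L' M'
    proof (intro allI impI)
      fix ms :: "int list" and a b
      assume "length ms = length ks" "a < length ks" "b < length ks"
      then have "norm (T (map2 (\<lambda>k m. (fst k, snd k, m)) ks ms)) \<le> L * exp (- M * \<bar>real_of_int (ms ! a - ms ! b)\<bar>)"
        using \<Phi> by blast
      also have "\<dots> \<le> L' * exp (- M' * \<bar>real_of_int (ms ! a - ms ! b)\<bar>)"
        using le by (intro mult_mono) (auto intro!: mult_right_mono)
      finally show "norm (T (map2 (\<lambda>k m. (fst k, snd k, m)) ks ms)) \<le> L' * exp (- M' * \<bar>real_of_int (ms ! a - ms ! b)\<bar>)" .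
    qed
  qed
  then obtain L M where LM: "L > 0" "M > 0" and bd: "\<And>ks. ks \<in> ?A \<Longrightarrow> ?\<Phi> ks L M" by blast
  have "decays L M T"
    unfolding decays_def
  proof (intro allI impI)
    fix xs :: "lvar list" and a b assume ab: "a < length xs" "b < length xs"
    show "norm (T xs) \<le> L * exp (- M * \<bar>real_of_int (pos (xs ! a) - pos (xs ! b))\<bar>)"
    proof (cases "length xs \<le> N")
      case True
      then have "map (\<lambda>x. (fst x, fst (snd x))) xs \<in> ?A" by simp
      from bd[OF this, rule_format, of "map pos xs" a b] ab show ?thesis
        by (simp only: map2_types_positions length_map nth_map)
    next
      case False
      then show ?thesis using N LM by simp
    qed
  qed
  moreover have "T (map (shift 1) xs) = T xs" for xs
  proof -
    let ?ks = "map (\<lambda>x. (fst x, fst (snd x))) xs"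
    have "T (map2 (\<lambda>k m. (fst k, snd k, m)) ?ks (map (\<lambda>m. m + 1) (map pos xs)))
      = T (map2 (\<lambda>k m. (fst k, snd k, m)) ?ks (map pos xs))"
      by (rule tilc_shift[OF til]) simp
    moreover have "map2 (\<lambda>k m. (fst k, snd k, m)) ?ks (map (\<lambda>m. m + 1) (map pos xs)) = map (shift 1) xs"
      using map2_types_positions[of "map (shift 1) xs"] by (simp add: o_def)
    ultimately show ?thesis by (simp only: map2_types_positions)
  qed
  ultimately show ?thesis
    using N LM by (intro that[of N] uniformly_localI[of N T L M]) simp_all
qed

lemma uniformly_local_imp_tilc:
  assumes "uniformly_local N T" "length ks = n"
  shows "tilc (\<lambda>ms. T (map2 (\<lambda>k m. (fst k, snd k, m)) ks ms)) n"
proof -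
  obtain L M where T: "L > 0" "M > 0" "decays L M T" using assms by (auto simp: uniformly_local_def)
  let ?C = "\<lambda>ms. T (map2 (\<lambda>k m. (fst k, snd k, m)) ks ms)"
  have "?C (map (\<lambda>m. m + 1) ms) = ?C ms" if "length ms = n" for ms
  proof -
    have "map2 (\<lambda>k m. (fst k, snd k, m)) ks (map (\<lambda>m. m + 1) ms) = map (shift 1) (map2 (\<lambda>k m. (fst k, snd k, m)) ks ms)"
      by (rule nth_equalityI) (auto simp: shift_def)
    moreover have "T (map (shift 1) xs) = T xs" for xs
      using assms by (simp add: uniformly_local_def)
    ultimately show ?thesis by (simp only:)
  qed
  moreover have "norm (?C ms) < (L + 1) * exp (- M * real_of_int \<bar>ms!0 - ms!j\<bar>)"
    if ms: "length ms = n" and j: "j \<in> {1..<n}" for ms j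
  proof -
    let ?xs = "map2 (\<lambda>k m. (fst k, snd k, m)) ks ms"
    have p: "pos (?xs ! i) = ms ! i" if "i < n" for i
      using that ms assms by (simp add: pos_def)
    have "norm (?C ms) \<le> L * exp (- M * real_of_int \<bar>ms!0 - ms!j\<bar>)"
      using decaysD[OF T(3), of 0 ?xs j] j ms assms p[of 0] p[of j] by simp
    \<comment> \<open>The enlarged constant supplies the strict inequality of the TILC
      condition.\<close>
    also have "\<dots> < (L + 1) * exp (- M * real_of_int \<bar>ms!0 - ms!j\<bar>)"
      by simp
    finally show ?thesis .
  qed
  ultimately show ?thesis
    unfolding tilc_def using T by (intro conjI allI impI exI[of _ "L + 1"] exI[of _ M] exI[of _ 0]) auto
qed

lemma uniformly_local_imp_local_functional:
  assumes "uniformly_local N T"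
  shows "local_functional T"
  unfolding local_functional_def
proof (intro conjI allI)
  show "\<exists>N. \<forall>xs. N < length xs \<longrightarrow> T xs = 0"
    using assms by (auto simp: uniformly_local_def)
qed (rule uniformly_local_imp_tilc[OF assms refl])

section \<open>Locality of slot operators\<close>

lemma summable_exp_pos:
  assumes "M > 0"
  shows "(\<lambda>x::lvar. exp (- M * \<bar>real_of_int (pos x - p)\<bar>)) summable_on UNIV"
proof -
  have 1: "(\<lambda>k. exp (- M * \<bar>real_of_int (k - p)\<bar>)) summable_on UNIV"
    using summable_exp_neg_abs_int[OF assms]
    by (subst summable_on_reindex_bij_witness[of _ "\<lambda>k. k + p" "\<lambda>k. k - p" UNIV "\<lambda>k. exp (- M * \<bar>real_of_int k\<bar>)"]) auto
  have "(\<lambda>(t,k). 1 * exp (- M * \<bar>real_of_int (k - p)\<bar>)) summable_on (UNIV :: sgn set) \<times> UNIV"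
    by (rule summable_on_prod) (use 1 finite_fld_sgn in auto)
  then have 2: "(\<lambda>(t,k). 1 * exp (- M * \<bar>real_of_int (k - p)\<bar>)) summable_on (UNIV :: (sgn \<times> int) set)"
    by simp
  have "(\<lambda>(f,y). 1 * (case y of (t,k) \<Rightarrow> 1 * exp (- M * \<bar>real_of_int (k - p)\<bar>))) summable_on (UNIV :: fld set) \<times> (UNIV :: (sgn \<times> int) set)"
    by (rule summable_on_prod) (use 2 finite_fld_sgn in auto)
  then show ?thesis by (simp add: case_prod_unfold pos_def)
qed

definition decay_mass :: "real \<Rightarrow> real" where
  "decay_mass M = (\<Sum>\<^sub>\<infinity>x::lvar. exp (- M * \<bar>real_of_int (pos x)\<bar>))"

lemma infsum_exp_pos: "(\<Sum>\<^sub>\<infinity>x::lvar. exp (- M * \<bar>real_of_int (pos x - p)\<bar>)) = decay_mass M"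
  unfolding decay_mass_def
  by (rule infsum_reindex_bij_witness[of _ "shift p" "shift (- p)"]) auto

lemma decay_mass_nonneg: "decay_mass M \<ge> 0"
  unfolding decay_mass_def by (intro infsum_nonneg) auto

lemma slot_bound:
  assumes "M > 0" and "\<And>x. norm (\<kappa> x (xs ! j) * T (xs[j := x])) \<le> c * exp (- M * \<bar>real_of_int (pos x - p)\<bar>)"
  shows "(\<lambda>x. norm (\<kappa> x (xs ! j) * T (xs[j := x]))) summable_on UNIV"
    and "norm (slot \<kappa> j T xs) \<le> c * decay_mass M"
proof -
  have s: "(\<lambda>x::lvar. c * exp (- M * \<bar>real_of_int (pos x - p)\<bar>)) summable_on UNIV"
    by (intro summable_on_cmult_right summable_exp_pos assms)
  show abs: "(\<lambda>x. norm (\<kappa> x (xs ! j) * T (xs[j := x]))) summable_on UNIV"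
    by (rule Infinite_Sum.abs_summable_on_comparison_test'[OF s assms(2)])
  have "norm (slot \<kappa> j T xs) \<le> (\<Sum>\<^sub>\<infinity>x. norm (\<kappa> x (xs ! j) * T (xs[j := x])))"
    unfolding slot_def norm_mult[of "sg xs j"] using norm_infsum_bound[OF abs] by simp
  also have "\<dots> \<le> (\<Sum>\<^sub>\<infinity>x::lvar. c * exp (- M * \<bar>real_of_int (pos x - p)\<bar>))"
    by (rule infsum_mono[OF abs s assms(2)])
  also have "\<dots> = c * decay_mass M"
    by (simp only: infsum_cmult_right' infsum_exp_pos)
  finally show "norm (slot \<kappa> j T xs) \<le> c * decay_mass M" .
qed

lemma slot_shift:
  assumes "\<And>x y. \<kappa>' (shift 1 x) (shift 1 y) = \<kappa> x y" "\<And>xs. T (map (shift 1) xs) = T xs" "j < length xs"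
  shows "slot \<kappa>' j T (map (shift 1) xs) = slot \<kappa> j T xs"
proof -
  have "sg (map (shift 1) xs) j = sg xs j"
    unfolding sg_prod using assms(3) by (intro prod.cong) auto
  moreover have "(\<Sum>\<^sub>\<infinity>x. \<kappa>' x (map (shift 1) xs ! j) * T ((map (shift 1) xs)[j := x]))
    = (\<Sum>\<^sub>\<infinity>x. \<kappa> x (xs ! j) * T (xs[j := x]))"
  proof (rule infsum_reindex_bij_witness[of _ "shift 1" "shift (- 1)"])
    fix x
    have "\<kappa>' x (shift 1 (xs ! j)) = \<kappa> (shift (-1) x) (xs ! j)"
      using assms(1)[of "shift (-1) x" "xs ! j"] by simp
    moreover have "T ((map (shift 1) xs)[j := x]) = T (xs[j := shift (- 1) x])"
      using assms(2)[of "xs[j := shift (- 1) x]"] by (simp add: map_update)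
    ultimately show "\<kappa> (shift (- 1) x) (xs ! j) * T (xs[j := shift (- 1) x]) =
      \<kappa>' x (map (shift 1) xs ! j) * T ((map (shift 1) xs)[j := x])"
      using assms(3) by simp
  qed auto
  ultimately show ?thesis by (simp add: slot_def)
qed

lemma update_pos_diff:
  assumes "a < length xs" "b < length xs" "j < length xs"
  shows "\<bar>real_of_int (pos (xs ! a) - pos (xs ! b))\<bar> \<le>
    \<bar>real_of_int (pos (xs[j := x] ! a) - pos (xs[j := x] ! b))\<bar> + \<bar>real_of_int (pos x - pos (xs ! j))\<bar>"
  using assms by (cases "a = j"; cases "b = j") auto

text \<open>A kernel decaying at twice the rate of \<open>T\<close> leaves half of its decay for the summation.\<close>

lemma slot_near_term:
  assumes \<kappa>: "\<And>x y. norm (\<kappa> x y) \<le> C * exp (- (2 * M) * \<bar>real_of_int (pos x - pos y)\<bar>)"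
    and T: "decays L M T" and pos: "M > 0" "C \<ge> 0" "L \<ge> 0"
    and len: "j < length xs" "a < length xs" "b < length xs"
  shows "norm (\<kappa> x (xs ! j) * T (xs[j := x])) \<le>
     (C * L * exp (- M * \<bar>real_of_int (pos (xs ! a) - pos (xs ! b))\<bar>)) * exp (- M * \<bar>real_of_int (pos x - pos (xs ! j))\<bar>)"
proof -
  let ?d = "\<bar>real_of_int (pos x - pos (xs ! j))\<bar>"
  let ?u = "\<bar>real_of_int (pos (xs[j := x] ! a) - pos (xs[j := x] ! b))\<bar>"
  let ?v = "\<bar>real_of_int (pos (xs ! a) - pos (xs ! b))\<bar>"
  have "norm (\<kappa> x (xs ! j) * T (xs[j := x])) \<le> (C * exp (- (2 * M) * ?d)) * (L * exp (- M * ?u))"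
    unfolding norm_mult using len pos by (intro mult_mono \<kappa> decaysD[OF T]) auto
  also have "\<dots> = C * L * exp (- (2 * M) * ?d + - M * ?u)"
    unfolding exp_add by (simp only: mult_ac)
  also have "\<dots> \<le> C * L * exp (- M * ?v + - M * ?d)"
  proof -
    have "M * ?v \<le> M * (?u + ?d)"
      using pos update_pos_diff[OF len(2,3,1), of x] by (intro mult_left_mono) auto
    then have "- (2 * M) * ?d + - M * ?u \<le> - M * ?v + - M * ?d"
      unfolding distrib_left by linarith
    then show ?thesis using pos by (intro mult_left_mono) auto
  qed
  finally show ?thesis unfolding exp_add by (simp only: mult_ac)
qed

text \<open>The index set makes the full charge, its part on the tail slots and a single guarded
  slot instances of one operator.\<close>

definition opsum :: "(lvar \<Rightarrow> lvar \<Rightarrow> complex) \<Rightarrow> nat set \<Rightarrow> (lvar list \<Rightarrow> complex) \<Rightarrow> lvar list \<Rightarrow> complex" where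
  "opsum \<kappa> J T xs = (\<Sum>j | j \<in> J \<and> j < length xs. slot \<kappa> j T xs)"

lemma slot_cong:
  "(\<And>ys. length ys = length xs \<Longrightarrow> T ys = S ys) \<Longrightarrow> slot \<kappa> j T xs = slot \<kappa> j S xs"
  by (simp add: slot_def)

lemma opsum_single:
  "opsum \<kappa> {j} T xs = (if j < length xs then slot \<kappa> j T xs else 0)"
proof -
  have "{i. i \<in> {j} \<and> i < length xs} = (if j < length xs then {j} else {})" by auto
  then show ?thesis by (simp add: opsum_def)
qed

section \<open>Translation-invariant operators with kernels decaying in the distance\<close>

locale near_kernel =
  fixes \<kappa> :: "lvar \<Rightarrow> lvar \<Rightarrow> complex" and C M\<^sub>0 :: real
  assumes near: "\<And>x y. norm (\<kappa> x y) \<le> C * exp (- M\<^sub>0 * \<bar>real_of_int (pos x - pos y)\<bar>)"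
    and near_pos: "C > 0" "M\<^sub>0 > 0"
    and near_shift: "\<And>x y. \<kappa> (shift 1 x) (shift 1 y) = \<kappa> x y"
begin

lemma near_half:
  assumes "2 * M \<le> M\<^sub>0"
  shows "norm (\<kappa> x y) \<le> C * exp (- (2 * M) * \<bar>real_of_int (pos x - pos y)\<bar>)"
proof -
  have "C * exp (- M\<^sub>0 * \<bar>real_of_int (pos x - pos y)\<bar>) \<le> C * exp (- (2 * M) * \<bar>real_of_int (pos x - pos y)\<bar>)"
    using near_pos assms by (intro mult_left_mono) (auto intro!: mult_right_mono)
  with near[of x y] show ?thesis by linarith
qed

lemma uniformly_local_rate:
  assumes "uniformly_local N T"
  obtains L M where "L > 0" "M > 0" "2 * M \<le> M\<^sub>0" "decays L M T"
proof -
  obtain L M where LM: "L > 0" "M > 0" "decays L M T" using assms by (auto simp: uniformly_local_def)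
  show ?thesis
    by (rule that[of L "min M (M\<^sub>0 / 2)"]) (use LM near_pos in \<open>auto intro: decays_mono\<close>)
qed

lemma near_abs_summable:
  "(\<lambda>x. norm (\<kappa> x y)) summable_on UNIV"
  by (rule Infinite_Sum.abs_summable_on_comparison_test'[OF _ near])
    (intro summable_on_cmult_right summable_exp_pos near_pos)

lemma slot_abs_summable:
  assumes T: "uniformly_local N T" and len: "j < length xs"
  shows "(\<lambda>x. norm (\<kappa> x (xs ! j) * T (xs[j := x]))) summable_on UNIV"
proof -
  obtain L M where LM: "L > 0" "M > 0" "2 * M \<le> M\<^sub>0" "decays L M T"
    using uniformly_local_rate[OF T] .
  show ?thesis
    by (rule slot_bound(1)[OF LM(2)], rule slot_near_term[OF near_half[OF LM(3)] LM(4), where a = j and b = j])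
      (use LM near_pos len in auto)
qed

lemma slot_summable:
  assumes "uniformly_local N T" "j < length xs"
  shows "(\<lambda>x. \<kappa> x (xs ! j) * T (xs[j := x])) summable_on UNIV"
  by (rule abs_summable_summable[OF slot_abs_summable[OF assms]])

lemma slot_diff:
  assumes "uniformly_local N T" "uniformly_local N' S" "j < length xs"
  shows "slot \<kappa> j (\<lambda>xs. T xs - S xs) xs = slot \<kappa> j T xs - slot \<kappa> j S xs"
proof -
  have "(\<Sum>\<^sub>\<infinity>x. \<kappa> x (xs ! j) * T (xs[j := x]) + - (\<kappa> x (xs ! j) * S (xs[j := x]))) =
     (\<Sum>\<^sub>\<infinity>x. \<kappa> x (xs ! j) * T (xs[j := x])) + (\<Sum>\<^sub>\<infinity>x. - (\<kappa> x (xs ! j) * S (xs[j := x])))"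
    by (intro infsum_add iffD2[OF summable_on_uminus] slot_summable[OF assms(1,3)] slot_summable[OF assms(2,3)])
  then show ?thesis
    by (simp add: slot_def infsum_uminus right_diff_distrib)
qed

lemma opsum_diff:
  assumes "uniformly_local N T" "uniformly_local N' S"
  shows "opsum \<kappa> J (\<lambda>xs. T xs - S xs) xs = opsum \<kappa> J T xs - opsum \<kappa> J S xs"
  unfolding opsum_def sum_subtractf[symmetric]
  by (intro sum.cong refl slot_diff[OF assms]) auto

lemma opsum_add:
  assumes "uniformly_local N T" "uniformly_local N S"
  shows "opsum \<kappa> J (\<lambda>xs. T xs + S xs) xs = opsum \<kappa> J T xs + opsum \<kappa> J S xs"
  using opsum_diff[OF uniformly_local_add[OF assms] assms(2), of J xs] by simp

text \<open>The rate \<open>M\<close> survives unchanged, which matters when an operator with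
  constants tuned to \<open>M\<close> is applied next. The summand 1 keeps the constant
  positive.\<close>

lemma opsum_decays:
  assumes N: "\<And>xs. N < length xs \<Longrightarrow> T xs = 0"
    and LM: "L > 0" "M > 0" "2 * M \<le> M\<^sub>0" "decays L M T"
  shows "decays (real N * (C * L * decay_mass M) + 1) M (opsum \<kappa> J T)"
  unfolding decays_def
proof (intro allI impI)
  let ?B = "real N * (C * L * decay_mass M) + 1"
  have nn: "C * L * decay_mass M \<ge> 0" using near_pos LM decay_mass_nonneg by simp
  fix xs :: "lvar list" and a b assume ab: "a < length xs" "b < length xs"
  let ?e = "exp (- M * \<bar>real_of_int (pos (xs ! a) - pos (xs ! b))\<bar>)"
  show "norm (opsum \<kappa> J T xs) \<le> ?B * ?e"
  proof (cases "N < length xs")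
    case True
    then show ?thesis using N nn by (simp add: opsum_def slot_def)
  next
    case False
    have "norm (opsum \<kappa> J T xs) \<le> (\<Sum>j | j \<in> J \<and> j < length xs. C * L * ?e * decay_mass M)"
      unfolding opsum_def
    proof (rule sum_norm_le)
      fix j assume j: "j \<in> {j. j \<in> J \<and> j < length xs}"
      show "norm (slot \<kappa> j T xs) \<le> C * L * ?e * decay_mass M"
        by (rule slot_bound(2)[OF LM(2)], rule slot_near_term[OF near_half[OF LM(3)] LM(4)])
          (use LM near_pos ab j in auto)
    qed
    also have "\<dots> = real (card {j. j \<in> J \<and> j < length xs}) * (C * L * decay_mass M * ?e)" by simp
    also have "\<dots> \<le> real N * (C * L * decay_mass M * ?e)"
    proof (intro mult_right_mono)
      have "card {j. j \<in> J \<and> j < length xs} \<le> card {..<length xs}"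
        by (intro card_mono) auto
      then show "real (card {j. j \<in> J \<and> j < length xs}) \<le> real N" using False by simp
    qed (use nn in auto)
    also have "\<dots> \<le> ?B * ?e"
      unfolding distrib_right by simp
    finally show ?thesis .
  qed
qed

lemma uniformly_local_opsum:
  assumes T: "uniformly_local N T"
  shows "uniformly_local N (opsum \<kappa> J T)"
proof -
  obtain L M where LM: "L > 0" "M > 0" "2 * M \<le> M\<^sub>0" "decays L M T"
    using uniformly_local_rate[OF T] .
  have "C * L * decay_mass M \<ge> 0" using near_pos LM decay_mass_nonneg by simp
  then have "real N * (C * L * decay_mass M) + 1 > 0" by (simp add: add_nonneg_pos)
  moreover have "opsum \<kappa> J T xs = 0" if "N < length xs" for xs
    using that uniformly_localD(1)[OF T] by (simp add: opsum_def slot_def)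
  moreover have "opsum \<kappa> J T (map (shift 1) xs) = opsum \<kappa> J T xs" for xs
    unfolding opsum_def length_map
    by (intro sum.cong refl slot_shift near_shift uniformly_localD(2)[OF T]) auto
  ultimately show ?thesis
    using LM(2) opsum_decays[OF uniformly_localD(1)[OF T] LM] by (intro uniformly_localI)
qed

lemma slot_slot_anticommute:
  assumes flip: "\<And>x y. \<kappa> x y \<noteq> 0 \<Longrightarrow> is_odd x \<noteq> is_odd y"
    and T: "uniformly_local N T" and ij: "i \<noteq> j" "i < length xs" "j < length xs"
  shows "slot \<kappa> i (slot \<kappa> j T) xs = - slot \<kappa> j (slot \<kappa> i T) xs"
proof -
  obtain L M where LM: "L > 0" "M > 0" "decays L M T" using T by (auto simp: uniformly_local_def)
  show ?thesis
  proof (rule slot_anticommute[where a = "\<lambda>_. L" and b = "\<lambda>_. 1"])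
    show "(\<lambda>x. norm (\<kappa> x (xs ! i)) * L) summable_on UNIV" "(\<lambda>x. norm (\<kappa> x (xs ! j)) * 1) summable_on UNIV"
      by (intro summable_on_cmult_left near_abs_summable)+
    show "norm (T (xs[i := x, j := y])) \<le> L * 1" for x y
    proof -
      have "xs[i := x, j := y] \<noteq> []" using ij by auto
      then show ?thesis using decays_bounded[OF LM(3)] by simp
    qed
  qed (use assms LM in auto)
qed

lemma slot_opsum:
  assumes T: "uniformly_local N T" and i: "i < length xs"
  shows "slot \<kappa> i (opsum \<kappa> J T) xs = (\<Sum>j | j \<in> J \<and> j < length xs. slot \<kappa> i (slot \<kappa> j T) xs)"
proof -
  let ?J = "{j. j \<in> J \<and> j < length xs}"
  \<comment> \<open>\<open>opsum \<kappa> {j}\<close> replaces \<open>slot \<kappa> j\<close>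
    because it is 0 on lists without a slot \<open>j\<close>, hence uniformly local.\<close>
  have "slot \<kappa> i (opsum \<kappa> J T) xs =
      sg xs i * (\<Sum>\<^sub>\<infinity>x. \<Sum>j\<in>?J. \<kappa> x (xs ! i) * opsum \<kappa> {j} T (xs[i := x]))"
    by (simp add: slot_def[of _ _ "opsum \<kappa> J T"] opsum_def[of _ J] opsum_single sum_distrib_left)
  also have "\<dots> = sg xs i * (\<Sum>j\<in>?J. \<Sum>\<^sub>\<infinity>x. \<kappa> x (xs ! i) * opsum \<kappa> {j} T (xs[i := x]))"
    by (subst infsum_sum) (auto intro: slot_summable uniformly_local_opsum T i)
  also have "\<dots> = (\<Sum>j\<in>?J. slot \<kappa> i (opsum \<kappa> {j} T) xs)"
    by (simp add: slot_def[of _ i] sum_distrib_left)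
  also have "\<dots> = (\<Sum>j\<in>?J. slot \<kappa> i (slot \<kappa> j T) xs)"
    by (intro sum.cong refl slot_cong) (auto simp: opsum_single)
  finally show ?thesis .
qed

text \<open>Diagonal terms vanish because the kernel squares to zero; anticommutation of the others
  makes the double sum its own negative.\<close>

lemma opsum_opsum:
  assumes flip: "\<And>x y. \<kappa> x y \<noteq> 0 \<Longrightarrow> is_odd x \<noteq> is_odd y"
    and nil: "\<And>x y z. \<kappa> x y * \<kappa> y z = 0"
    and T: "uniformly_local N T"
  shows "opsum \<kappa> J (opsum \<kappa> J T) xs = 0"
proof -
  let ?J = "{j. j \<in> J \<and> j < length xs}"
  define A where "A i j = slot \<kappa> i (slot \<kappa> j T) xs" for i j
  have diag: "A j j = 0" if "j < length xs" for j
  proof -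
    have "\<kappa> y (xs ! j) * slot \<kappa> j T (xs[j := y]) = 0" for y
    proof (cases "\<kappa> y (xs ! j) = 0")
      case False
      then have "\<kappa> x y = 0" for x using nil[of x y "xs ! j"] by simp
      then show ?thesis using that by (simp add: slot_def)
    qed simp
    then have "(\<Sum>\<^sub>\<infinity>y. \<kappa> y (xs ! j) * slot \<kappa> j T (xs[j := y])) = 0"
      by (rule infsum_0)
    then show ?thesis by (simp add: A_def slot_def[of _ j "slot \<kappa> j T"])
  qed
  have anti: "A i j = - A j i" if "i \<in> ?J" "j \<in> ?J" for i j
    using that diag slot_slot_anticommute[OF flip T, of i j xs] by (cases "i = j") (auto simp: A_def)
  have eq: "opsum \<kappa> J (opsum \<kappa> J T) xs = (\<Sum>i\<in>?J. \<Sum>j\<in>?J. A i j)"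
    unfolding opsum_def[of _ _ "opsum \<kappa> J T"] A_def
    by (intro sum.cong refl slot_opsum[OF T]) auto
  have "(\<Sum>i\<in>?J. \<Sum>j\<in>?J. A i j) = (\<Sum>i\<in>?J. \<Sum>j\<in>?J. - A j i)"
    by (intro sum.cong refl anti)
  also have "\<dots> = - (\<Sum>i\<in>?J. \<Sum>j\<in>?J. A i j)"
    by (subst sum.swap) (simp add: sum_negf)
  finally show ?thesis unfolding eq by simp
qed

end

section \<open>Kernels centred at the head position\<close>

text \<open>Let u be the distance of \<open>x\<close> from the head, k that of slot
  \<open>j\<close>, and v and w the distances of slots \<open>a\<close> and \<open>b\<close> after
  and before the substitution. The kernel costs \<epsilon> u and gains \<epsilon> k, and
  \<open>T\<close> yields 3 \<epsilon> (u + v). As w is at most u + v + k, this leaves \<epsilon> w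
  for locality and \<epsilon> u for summation. \<open>1 \<le> j\<close> keeps the head
  fixed.\<close>

lemma slot_far_term:
  assumes \<kappa>: "\<And>x y. norm (\<kappa> x y) \<le> A * exp (- \<epsilon> * \<bar>real_of_int (pos y - pos (xs ! 0))\<bar>) * exp (\<epsilon> * \<bar>real_of_int (pos x - pos (xs ! 0))\<bar>)"
    and T: "decays L M T" and pos: "\<epsilon> > 0" "6 * \<epsilon> \<le> M" "A \<ge> 0" "L \<ge> 0"
    and len: "1 \<le> j" "j < length xs" "a < length xs" "b < length xs"
  shows "norm (\<kappa> x (xs ! j) * T (xs[j := x])) \<le>
     (A * L * exp (- \<epsilon> * \<bar>real_of_int (pos (xs ! a) - pos (xs ! b))\<bar>)) * exp (- \<epsilon> * \<bar>real_of_int (pos x - pos (xs ! 0))\<bar>)"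
proof -
  let ?k = "\<bar>real_of_int (pos (xs ! j) - pos (xs ! 0))\<bar>"
  let ?u = "\<bar>real_of_int (pos x - pos (xs ! 0))\<bar>"
  let ?v = "\<bar>real_of_int (pos (xs[j := x] ! a) - pos (xs[j := x] ! b))\<bar>"
  let ?w = "\<bar>real_of_int (pos (xs ! a) - pos (xs ! b))\<bar>"
  have ne: "xs \<noteq> []" using len by auto
  \<comment> \<open>The larger of the two distances is at least half their sum, so a rate of 6
    \<epsilon> in the larger one gives 3 \<epsilon> in the sum.\<close>
  have Tle: "norm (T (xs[j := x])) \<le> L * exp (- (3 * \<epsilon>) * (?u + ?v))"
  proof (cases "?u \<le> ?v")
    case True
    have "norm (T (xs[j := x])) \<le> L * exp (- M * ?v)"
      using decaysD[OF T, of a "xs[j := x]" b] len by simp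
    also have "\<dots> \<le> L * exp (- (3 * \<epsilon>) * (?u + ?v))"
    proof -
      have "(3 * \<epsilon>) * (?u + ?v) \<le> (3 * \<epsilon>) * (2 * ?v)"
        using True pos by (intro mult_left_mono) auto
      also have "\<dots> = 6 * \<epsilon> * ?v" by simp
      also have "\<dots> \<le> M * ?v" using pos by (intro mult_right_mono) auto
      finally show ?thesis using pos by (intro mult_left_mono) auto
    qed
    finally show ?thesis .
  next
    case False
    have "norm (T (xs[j := x])) \<le> L * exp (- M * ?u)"
      using decaysD[OF T, of j "xs[j := x]" 0] len ne by simp
    also have "\<dots> \<le> L * exp (- (3 * \<epsilon>) * (?u + ?v))"
    proof -
      have "(3 * \<epsilon>) * (?u + ?v) \<le> (3 * \<epsilon>) * (2 * ?u)"
        using False pos by (intro mult_left_mono) auto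
      also have "\<dots> = 6 * \<epsilon> * ?u" by simp
      also have "\<dots> \<le> M * ?u" using pos by (intro mult_right_mono) auto
      finally show ?thesis using pos by (intro mult_left_mono) auto
    qed
    finally show ?thesis .
  qed
  have "\<bar>real_of_int (pos x - pos (xs ! j))\<bar> \<le> ?u + ?k" by linarith
  then have w: "?w \<le> ?v + (?u + ?k)"
    using update_pos_diff[OF len(3,4,2), of x] by linarith
  have "norm (\<kappa> x (xs ! j) * T (xs[j := x])) \<le> (A * exp (- \<epsilon> * ?k) * exp (\<epsilon> * ?u)) * (L * exp (- (3 * \<epsilon>) * (?u + ?v)))"
    unfolding norm_mult using pos by (intro mult_mono \<kappa> Tle) auto
  also have "\<dots> = A * L * exp (- \<epsilon> * ?k + \<epsilon> * ?u + - (3 * \<epsilon>) * (?u + ?v))"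
    unfolding exp_add by (simp only: mult_ac)
  also have "\<dots> \<le> A * L * exp (- \<epsilon> * ?w + - \<epsilon> * ?u)"
  proof -
    have "- \<epsilon> * ?k + \<epsilon> * ?u + - (3 * \<epsilon>) * (?u + ?v) = - (\<epsilon> * (?k + 2 * ?u + 3 * ?v))"
      by (simp only: algebra_simps)
    also have "\<dots> \<le> - (\<epsilon> * (?w + ?u))"
    proof -
      have "w + u \<le> k + 2 * u + 3 * v" if "w \<le> v + (u + k)" "0 \<le> v" for w u k v :: real
        using that by linarith
      from this[OF w] have "?w + ?u \<le> ?k + 2 * ?u + 3 * ?v" by simp
      then show ?thesis using pos by simp
    qed
    also have "\<dots> = - \<epsilon> * ?w + - \<epsilon> * ?u" by (simp only: algebra_simps)
    finally show ?thesis using pos by (intro mult_left_mono) auto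
  qed
  finally show ?thesis unfolding exp_add by (simp only: mult_ac)
qed

section \<open>The supercharge on fields of one sign\<close>

definition is_upper :: "lvar \<Rightarrow> bool" where
  "is_upper x \<longleftrightarrow> fst x = Chi \<or> fst x = Ff"

text \<open>The values at lower fields are defaults; kernels apply \<open>lower\<close> to upper
  fields only.\<close>

fun lower :: "fld \<Rightarrow> fld" where
  "lower Chi = Phi" | "lower Ff = Chb" | "lower f = f"

text \<open>The charge maps \<open>Ff\<close> to \<open>Chb\<close> and \<open>Chi\<close> to
  \<open>Phi\<close>, hence preserves the number of auxiliary fields.\<close>

definition is_aux :: "lvar \<Rightarrow> bool" where
  "is_aux x \<longleftrightarrow> fst x = Ff \<or> fst x = Chb"

lemma is_upper_shift [simp]: "is_upper (shift c x) = is_upper x"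
  and is_aux_shift [simp]: "is_aux (shift c x) = is_aux x"
  by (simp_all add: is_upper_def is_aux_def)

text \<open>The phase in front of \<open>nabla\<close> when the charge of sign \<open>flip s\<close>
  acts on an upper field of sign \<open>s\<close>.\<close>

definition ucoeff :: "sgn \<Rightarrow> fld \<Rightarrow> complex" where
  "ucoeff s f = (if f = Chi \<and> s = Pl then \<i> else - \<i>)"

lemma norm_ucoeff [simp]: "norm (ucoeff s f) = 1" "ucoeff s f \<noteq> 0"
  by (simp_all add: ucoeff_def)

text \<open>Here \<open>s\<close> is the sign of the fields; the charge under study is that of the
  opposite sign.\<close>

locale supercharge =
  fixes nabla :: "int \<Rightarrow> complex" and s :: sgn and C M\<^sub>0 :: real and k\<^sub>0 :: int
  assumes decay: "\<And>k. norm (nabla k) \<le> C * exp (- M\<^sub>0 * \<bar>real_of_int k\<bar>)"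
    and pos: "C > 0" "M\<^sub>0 > 0"
    and sum0: "(nabla has_sum 0) UNIV" and nonzero: "nabla k\<^sub>0 \<noteq> 0"
begin

definition qk :: "lvar \<Rightarrow> lvar \<Rightarrow> complex" where
  "qk x y = (if fst (snd x) = s \<and> fst (snd y) = s \<and> is_upper x \<and> fst y = lower (fst x)
     then ucoeff s (fst x) * nabla (pos x - pos y) else 0)"

abbreviation Q :: "(lvar list \<Rightarrow> complex) \<Rightarrow> lvar list \<Rightarrow> complex" where
  "Q \<equiv> opsum qk UNIV"

abbreviation Qtail :: "(lvar list \<Rightarrow> complex) \<Rightarrow> lvar list \<Rightarrow> complex" where
  "Qtail \<equiv> opsum qk {1..}"

lemma qc_eq_qk: "fst (snd x) = s \<Longrightarrow> qc nabla (flip s) x y = qk x y"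
proof -
  assume x: "fst (snd x) = s"
  have ne: "s \<noteq> flip s" by (cases s) auto
  have c: "(if flip s = Pl then - \<i> else \<i>) = ucoeff s Chi" "ucoeff s Ff = - \<i>"
    by (cases s; simp add: ucoeff_def)+
  obtain f n where x': "x = (f, s, n)" using x by (cases x) auto
  obtain g u k where y': "y = (g, u, k)" by (cases y)
  show ?thesis
    unfolding x' y' by (cases f; cases g) (auto simp: qc_def qk_def is_upper_def pos_def ne c)
qed

lemma qop_eq_Q:
  assumes "pure s T"
  shows "qop nabla (flip s) T xs = Q T xs"
proof -
  have "slot (qc nabla (flip s)) j T xs = slot qk j T xs" if j: "j < length xs" for j
  proof -
    have "qc nabla (flip s) x (xs ! j) * T (xs[j := x]) = qk x (xs ! j) * T (xs[j := x])" for x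
    proof (cases "T (xs[j := x]) = 0")
      case False
      moreover have "x \<in> set (xs[j := x])" using j by (rule set_update_memI)
      ultimately have "fst (snd x) = s" using assms by (auto simp: pure_def)
      then show ?thesis by (simp add: qc_eq_qk)
    qed simp
    then show ?thesis unfolding slot_def by (simp only:)
  qed
  then show ?thesis
    unfolding qop_eq_sum_slot opsum_def by (intro sum.cong) auto
qed

lemma qk_upper: "qk x y \<noteq> 0 \<Longrightarrow> is_upper x \<and> \<not> is_upper y \<and> fst y = lower (fst x) \<and> fst (snd x) = s \<and> fst (snd y) = s"
  by (cases x; cases "fst x") (auto simp: qk_def is_upper_def split: if_splits)

lemma qk_flip: "qk x y \<noteq> 0 \<Longrightarrow> is_odd x \<noteq> is_odd y"
  by (cases x; cases "fst x") (auto simp: qk_def is_upper_def is_odd_def split: if_splits)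

lemma qk_square_zero: "qk x y * qk y z = 0"
  using qk_upper[of x y] qk_upper[of y z] by auto

sublocale near_kernel qk C M\<^sub>0
proof
  show "norm (qk x y) \<le> C * exp (- M\<^sub>0 * \<bar>real_of_int (pos x - pos y)\<bar>)" for x y
    using decay[of "pos x - pos y"] pos by (simp add: qk_def norm_mult)
  show "qk (shift 1 x) (shift 1 y) = qk x y" for x y
    by (simp add: qk_def)
qed (use pos in auto)

lemma slot_upper_zero:
  "is_upper (xs ! j) \<Longrightarrow> slot qk j T xs = 0"
proof -
  assume "is_upper (xs ! j)"
  then have "qk x (xs ! j) = 0" for x using qk_upper by blast
  then show ?thesis by (simp add: slot_def)
qed

lemma opsum_nonzeroE:
  assumes "opsum qk J T xs \<noteq> 0"
  obtains j x where "j \<in> J" "j < length xs" "qk x (xs ! j) \<noteq> 0" "T (xs[j := x]) \<noteq> 0"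
proof -
  obtain j where j: "j \<in> J" "j < length xs" "slot qk j T xs \<noteq> 0"
    using assms unfolding opsum_def by (metis (mono_tags, lifting) mem_Collect_eq sum.neutral)
  have "\<exists>x. qk x (xs ! j) * T (xs[j := x]) \<noteq> 0"
  proof (rule ccontr)
    assume "\<not> ?thesis"
    then have "(\<Sum>\<^sub>\<infinity>x. qk x (xs ! j) * T (xs[j := x])) = 0" by (intro infsum_0) blast
    then have "slot qk j T xs = 0" by (simp add: slot_def)
    with j show False by simp
  qed
  then show ?thesis using that j by auto
qed

lemma Q_split:
  "Q T xs = (if xs = [] then 0 else slot qk 0 T xs) + Qtail T xs"
proof (cases "xs = []")
  case False
  then have "{j. j \<in> UNIV \<and> j < length xs} = insert 0 {j. j \<in> {1..} \<and> j < length xs}" by auto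
  then have "Q T xs = (\<Sum>j\<in>insert 0 {j. j \<in> {1..} \<and> j < length xs}. slot qk j T xs)"
    by (simp only: opsum_def)
  with False show ?thesis by (simp add: opsum_def)
qed (simp add: opsum_def)

text \<open>The kernel of D with base point \<open>n\<close>: output positions from \<open>n\<close>
  on use \<open>Em\<close>, those before it use \<open>Ep\<close>. Dividing by \<open>ucoeff\<close>
  undoes the phase of the charge.\<close>

definition dk :: "(int \<Rightarrow> complex) \<Rightarrow> (int \<Rightarrow> complex) \<Rightarrow> int \<Rightarrow> lvar \<Rightarrow> lvar \<Rightarrow> complex" where
  "dk Ep Em n x y = (if fst (snd x) = s \<and> fst (snd y) = s \<and> is_upper y \<and> fst x = lower (fst y)
     then (if n \<le> pos y then Em else Ep) (pos x - pos y) / ucoeff s (fst y) else 0)"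

lemma dk_flip: "dk Ep Em n x y \<noteq> 0 \<Longrightarrow> is_odd x \<noteq> is_odd y"
  by (cases y; cases "fst y") (auto simp: dk_def is_upper_def is_odd_def split: if_splits)

text \<open>For input position l and output position k, the exponent l - k if k is at least n, and k
  - l otherwise, is at most |l - n| - |k - n|; the choice between \<open>Em\<close> and
  \<open>Ep\<close> is made for this.\<close>

lemma dk_bound:
  assumes "\<And>k. norm (Ep k) \<le> A * exp (- \<epsilon> * real_of_int k)"
    "\<And>k. norm (Em k) \<le> A * exp (\<epsilon> * real_of_int k)" "\<epsilon> > 0" "A > 0"
  shows "norm (dk Ep Em n x y) \<le>
     A * exp (- \<epsilon> * \<bar>real_of_int (pos y - n)\<bar>) * exp (\<epsilon> * \<bar>real_of_int (pos x - n)\<bar>)"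
proof -
  let ?k = "pos y" and ?l = "pos x"
  let ?R = "A * exp (- \<epsilon> * \<bar>real_of_int (?k - n)\<bar>) * exp (\<epsilon> * \<bar>real_of_int (?l - n)\<bar>)"
  have R: "?R = A * exp (\<epsilon> * (\<bar>real_of_int (?l - n)\<bar> - \<bar>real_of_int (?k - n)\<bar>))"
    unfolding mult.assoc exp_add[symmetric] by (simp add: algebra_simps)
  have "norm ((if n \<le> ?k then Em else Ep) (?l - ?k)) \<le> ?R"
  proof (cases "n \<le> ?k")
    case True
    have "norm (Em (?l - ?k)) \<le> A * exp (\<epsilon> * real_of_int (?l - ?k))" by (rule assms)
    also have "\<dots> \<le> ?R"
    proof -
      have "real_of_int (?l - ?k) \<le> \<bar>real_of_int (?l - n)\<bar> - \<bar>real_of_int (?k - n)\<bar>"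
        using True by linarith
      then show ?thesis unfolding R using assms(3,4) by (intro mult_left_mono) auto
    qed
    finally show ?thesis using True by simp
  next
    case False
    have "norm (Ep (?l - ?k)) \<le> A * exp (\<epsilon> * - real_of_int (?l - ?k))"
      using assms(1)[of "?l - ?k"] by (simp only: mult_minus_left mult_minus_right)
    also have "\<dots> \<le> ?R"
    proof -
      have "- real_of_int (?l - ?k) \<le> \<bar>real_of_int (?l - n)\<bar> - \<bar>real_of_int (?k - n)\<bar>"
        using False by linarith
      then show ?thesis unfolding R using assms(3,4) by (intro mult_left_mono) (auto simp only: exp_le_cancel_iff mult_le_cancel_left_pos)
    qed
    finally show ?thesis using False by simp
  qed
  moreover have "0 \<le> ?R" using assms by simp
  ultimately show ?thesis by (auto simp: dk_def norm_divide)
qed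

text \<open>The choice of inverse depends on \<open>z\<close> alone and not on the summed
  \<open>y\<close>, so for each \<open>z\<close> the sum is an honest convolution of one inverse
  with \<open>nabla\<close>.\<close>

lemma dk_qk:
  assumes "\<And>n. ((\<lambda>l. Ep l * nabla (n - l)) has_sum (if n = 0 then 1 else 0)) UNIV"
    "\<And>n. ((\<lambda>l. Em l * nabla (n - l)) has_sum (if n = 0 then 1 else 0)) UNIV"
    and z: "is_upper z" "fst (snd z) = s"
  shows "((\<lambda>y. dk Ep Em n y z * qk x y) has_sum (if x = z then 1 else 0)) UNIV"
proof (cases "fst x = fst z \<and> fst (snd x) = s")
  case False
  have "dk Ep Em n y z * qk x y = 0" for y
  proof (rule ccontr)
    assume "dk Ep Em n y z * qk x y \<noteq> 0"
    then have "is_upper x" "fst (snd x) = s" "lower (fst x) = lower (fst z)"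
      by (auto simp: dk_def qk_def split: if_splits)
    then have "fst x = fst z" using z(1) by (auto simp: is_upper_def)
    with False \<open>fst (snd x) = s\<close> show False by simp
  qed
  moreover have "x \<noteq> z" using False z by auto
  ultimately show ?thesis by (simp only: if_False has_sum_0_simp)
next
  case True
  define E where "E = (if n \<le> pos z then Em else Ep)"
  have E: "((\<lambda>l. E l * nabla (m - l)) has_sum (if m = 0 then 1 else 0)) UNIV" for m
    using assms(1)[of m] assms(2)[of m] by (cases "n \<le> pos z") (simp_all only: E_def if_True if_False)
  have eq: "x = z \<longleftrightarrow> pos x = pos z"
    using True z by (cases x; cases z) (auto simp: pos_def)
  let ?v = "\<lambda>l. (lower (fst z), s, l) :: lvar"
  have val: "dk Ep Em n (?v l) z * qk x (?v l) = E (l - pos z) * nabla (pos x - l)" for l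
    using True z by (simp add: dk_def qk_def E_def pos_def is_upper_def)
  have "((\<lambda>l. E (l - pos z) * nabla (pos x - l)) has_sum (if x = z then 1 else 0)) UNIV"
    using E[of "pos x - pos z"] unfolding eq
    by (subst has_sum_reindex_bij_witness[of _ "\<lambda>l. l + pos z" "\<lambda>l. l - pos z" UNIV "\<lambda>l. E l * nabla (pos x - pos z - l)"])
      (auto simp: algebra_simps)
  then have "((\<lambda>y. dk Ep Em n y z * qk x y) has_sum (if x = z then 1 else 0)) (range ?v)"
    by (subst has_sum_reindex) (auto simp: inj_on_def o_def val)
  moreover have "dk Ep Em n y z * qk x y = 0" if "y \<notin> range ?v" for y
    using that by (cases y) (auto simp: dk_def)
  ultimately show ?thesis
    by (subst has_sum_cong_neutral[where T = "range ?v" and g = "\<lambda>y. dk Ep Em n y z * qk x y"]) auto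
qed

lemma slot_dk_qk:
  assumes E: "\<And>n. ((\<lambda>l. Ep l * nabla (n - l)) has_sum (if n = 0 then 1 else 0)) UNIV"
    "\<And>n. ((\<lambda>l. Em l * nabla (n - l)) has_sum (if n = 0 then 1 else 0)) UNIV"
    and bound: "\<And>k. norm (Ep k) \<le> A * exp (- \<epsilon> * real_of_int k)"
    "\<And>k. norm (Em k) \<le> A * exp (\<epsilon> * real_of_int k)" "\<epsilon> > 0" "A > 0"
    and T: "decays L M T" "L > 0" "2 * \<epsilon> \<le> M" "2 * \<epsilon> \<le> M\<^sub>0"
    and j: "1 \<le> j" "j < length xs"
    and z: "is_upper (xs ! j)" "fst (snd (xs ! j)) = s"
  shows "slot (dk Ep Em (pos (xs ! 0))) j (slot qk j T) xs = T xs"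
proof -
  define n z where "n = pos (xs ! 0)" and "z = xs ! j"
  let ?F = "\<lambda>x y. dk Ep Em n y z * (qk x y * T (xs[j := x]))"
  \<comment> \<open>The growth of D is at most exp of \<epsilon> times (\<open>?d\<close> +
    \<open>?u\<close>); half of the decay of \<open>nabla\<close> and half of that of
    \<open>T\<close> absorb it. The result majorizes the double sum.\<close>
  have F: "norm (?F x y) \<le> A * C * L * (exp (- \<epsilon> * \<bar>real_of_int (pos x - n)\<bar>) * exp (- \<epsilon> * \<bar>real_of_int (pos y - pos x)\<bar>))" for x y
  proof -
    let ?d = "\<bar>real_of_int (pos x - pos y)\<bar>" and ?u = "\<bar>real_of_int (pos x - n)\<bar>"
      and ?w = "\<bar>real_of_int (pos y - n)\<bar>"
    have "norm (dk Ep Em n y z) \<le> A * exp (- \<epsilon> * \<bar>real_of_int (pos z - n)\<bar>) * exp (\<epsilon> * ?w)"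
      by (rule dk_bound) (use bound in auto)
    also have "\<dots> \<le> A * 1 * exp (\<epsilon> * ?w)"
      using bound by (intro mult_right_mono mult_left_mono) auto
    finally have 1: "norm (dk Ep Em n y z) \<le> A * exp (\<epsilon> * ?w)" by simp
    have 2: "norm (T (xs[j := x])) \<le> L * exp (- M * ?u)"
    proof -
      have "xs \<noteq> []" using j by auto
      then show ?thesis using decaysD[OF T(1), of j "xs[j := x]" 0] j by (simp add: n_def)
    qed
    have "norm (?F x y) \<le> (A * exp (\<epsilon> * ?w)) * ((C * exp (- M\<^sub>0 * ?d)) * (L * exp (- M * ?u)))"
      unfolding norm_mult using bound pos T by (intro mult_mono 1 near 2) auto
    also have "\<dots> = A * C * L * exp (\<epsilon> * ?w + - M\<^sub>0 * ?d + - M * ?u)"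
      unfolding exp_add by (simp only: mult_ac)
    also have "\<dots> \<le> A * C * L * exp (- \<epsilon> * ?u + - \<epsilon> * ?d)"
    proof -
      have "\<epsilon> * ?w \<le> \<epsilon> * (?d + ?u)" using bound by (intro mult_left_mono) auto
      moreover have "2 * \<epsilon> * ?d \<le> M\<^sub>0 * ?d" "2 * \<epsilon> * ?u \<le> M * ?u"
        using T by (intro mult_right_mono; simp)+
      ultimately have "\<epsilon> * ?w + - M\<^sub>0 * ?d + - M * ?u \<le> - \<epsilon> * ?u + - \<epsilon> * ?d"
        unfolding distrib_left by linarith
      then show ?thesis using bound pos T by (intro mult_left_mono) auto
    qed
    finally show ?thesis unfolding exp_add
      by (simp only: abs_minus_commute[of "real_of_int (pos y)"] of_int_diff)
  qed
  have "(\<lambda>(x,y). A * C * L * (exp (- \<epsilon> * \<bar>real_of_int (pos x - n)\<bar>) * exp (- \<epsilon> * \<bar>real_of_int (pos y - pos x)\<bar>)))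
    summable_on (UNIV :: lvar set) \<times> (UNIV :: lvar set)"
  proof (rule summable_on_SigmaI)
    fix x :: lvar
    have "((\<lambda>y::lvar. exp (- \<epsilon> * \<bar>real_of_int (pos y - pos x)\<bar>)) has_sum decay_mass \<epsilon>) UNIV"
      using has_sum_infsum[OF summable_exp_pos[OF bound(3), of "pos x"]] by (simp only: infsum_exp_pos)
    then show "((\<lambda>y::lvar. case (x, y) of (x,y) \<Rightarrow> A * C * L * (exp (- \<epsilon> * \<bar>real_of_int (pos x - n)\<bar>) * exp (- \<epsilon> * \<bar>real_of_int (pos y - pos x)\<bar>)))
      has_sum (A * C * L * (exp (- \<epsilon> * \<bar>real_of_int (pos x - n)\<bar>) * decay_mass \<epsilon>))) UNIV"
      unfolding prod.case by (intro has_sum_cmult_right)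
  next
    show "(\<lambda>x::lvar. A * C * L * (exp (- \<epsilon> * \<bar>real_of_int (pos x - n)\<bar>) * decay_mass \<epsilon>)) summable_on UNIV"
      by (intro summable_on_cmult_right summable_on_cmult_left summable_exp_pos bound)
  qed (use bound pos T in auto)
  then have "(\<lambda>p. norm (case p of (x,y) \<Rightarrow> ?F x y)) summable_on UNIV \<times> UNIV"
    by (rule Infinite_Sum.abs_summable_on_comparison_test') (use F in auto)
  then have swap: "(\<Sum>\<^sub>\<infinity>x. \<Sum>\<^sub>\<infinity>y. ?F x y) = (\<Sum>\<^sub>\<infinity>y. \<Sum>\<^sub>\<infinity>x. ?F x y)"
    by (intro infsum_swap_banach) (rule abs_summable_summable)
  have inner: "(\<Sum>\<^sub>\<infinity>y. ?F x y) = (if x = z then T xs else 0)" for x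
  proof -
    have "(\<Sum>\<^sub>\<infinity>y. ?F x y) = (\<Sum>\<^sub>\<infinity>y. dk Ep Em n y z * qk x y * T (xs[j := x]))"
      by (simp add: mult.assoc)
    also have "\<dots> = (\<Sum>\<^sub>\<infinity>y. dk Ep Em n y z * qk x y) * T (xs[j := x])"
      by (rule infsum_cmult_left')
    also have "(\<Sum>\<^sub>\<infinity>y. dk Ep Em n y z * qk x y) = (if x = z then 1 else 0)"
      by (intro infsumI dk_qk E) (use z in \<open>auto simp: z_def\<close>)
    finally show ?thesis using j by (auto simp: z_def)
  qed
  \<comment> \<open>The sign at slot \<open>j\<close> ignores the entry there, so both operators
    contribute the same sign and it squares to 1.\<close>
  have sg: "sg (xs[j := y]) j = sg xs j" for y by (rule sg_update_ge) simp
  have "dk Ep Em n y z * slot qk j T (xs[j := y]) = sg xs j * (\<Sum>\<^sub>\<infinity>x. ?F x y)" for y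
    unfolding infsum_cmult_right' using j by (simp add: slot_def sg)
  then have "slot (dk Ep Em n) j (slot qk j T) xs = sg xs j * (sg xs j * (\<Sum>\<^sub>\<infinity>y. \<Sum>\<^sub>\<infinity>x. ?F x y))"
    unfolding slot_def[of "dk Ep Em n"] z_def[symmetric]
    by (simp only: infsum_cmult_right'[where c = "sg xs j"])
  also have "\<dots> = (\<Sum>\<^sub>\<infinity>x. \<Sum>\<^sub>\<infinity>y. ?F x y)"
    by (simp only: swap mult.assoc[symmetric, of "sg xs j"] sg_square mult_1_left)
  also have "\<dots> = (\<Sum>\<^sub>\<infinity>x. if x = z then T xs else 0)"
    by (simp only: inner)
  also have "\<dots> = T xs"
    by (intro infsumI has_sum_finite_neutralI[of "{z}"]) auto
  finally show ?thesis by (simp add: n_def)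
qed

end

section \<open>Acyclicity in the presence of auxiliary fields\<close>

text \<open>The sector where exactness is proved. The charge preserves it and lowers
  \<open>q\<close> by one.\<close>

definition fcls :: "sgn \<Rightarrow> int \<Rightarrow> lvar list \<Rightarrow> bool" where
  "fcls s q xs \<longleftrightarrow> (\<forall>x\<in>set xs. fst (snd x) = s) \<and> nf_mono xs = q \<and> (\<exists>x\<in>set xs. is_aux x)"

lemma all_set_update_iff:
  assumes "j < length xs"
  shows "(\<forall>x\<in>set (xs[j := y]). p x) \<longleftrightarrow> p y \<and> (\<forall>i<length xs. i \<noteq> j \<longrightarrow> p (xs ! i))"
  using assms by (auto simp: all_set_conv_all_nth nth_list_update)

lemma nf_mono_update:
  assumes "j < length xs"
  shows "nf_mono (xs[j := y]) = nf_mono xs - nf_var (xs ! j) + nf_var y"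
proof -
  have "sum_list (as[j := a]) = sum_list as - as ! j + a" if "j < length as" for as :: "int list" and j a
    using that by (induction as arbitrary: j) (auto split: nat.split)
  from this[of j "map nf_var xs"] show ?thesis
    using assms by (simp add: nf_mono_def map_update)
qed

lemma fcls_lower:
  assumes j: "j < length xs" and u: "is_upper (xs ! j)" "fst (snd (xs ! j)) = s"
    and x: "fst x = lower (fst (xs ! j))" "fst (snd x) = s"
  shows "fcls s q (xs[j := x]) \<longleftrightarrow> fcls s (q + 1) xs"
proof -
  have nf: "nf_var (xs ! j) = nf_var x + 1" and aux: "is_aux x = is_aux (xs ! j)"
    using u x by (auto simp: is_upper_def is_aux_def nf_var_def)
  \<comment> \<open>Writing \<open>xs\<close> as \<open>xs[j := xs ! j]\<close> makes both sides
    updates at the same slot.\<close>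
  have "(\<forall>y\<in>set (xs[j := x]). fst (snd y) = s) \<longleftrightarrow> (\<forall>y\<in>set (xs[j := xs ! j]). fst (snd y) = s)"
    unfolding all_set_update_iff[OF j] using u x by simp
  moreover have "(\<forall>y\<in>set (xs[j := x]). \<not> is_aux y) \<longleftrightarrow> (\<forall>y\<in>set (xs[j := xs ! j]). \<not> is_aux y)"
    unfolding all_set_update_iff[OF j] using aux by simp
  ultimately show ?thesis
    unfolding fcls_def nf_mono_update[OF j] nf by auto
qed

text \<open>The fermion number is the number of upper fields minus the number of auxiliary ones,
  so one auxiliary field forces two upper fields.\<close>

lemma fcls_upper_tail:
  assumes "fcls s 1 xs"
  shows "\<exists>i. 1 \<le> i \<and> i < length xs \<and> is_upper (xs ! i)"
proof (rule ccontr)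
  assume not: "\<not> ?thesis"
  obtain y ys where xs: "xs = y # ys"
    using assms by (cases xs) (auto simp: fcls_def)
  have ys: "\<not> is_upper x" if x: "x \<in> set ys" for x
  proof
    assume "is_upper x"
    from x obtain i where "i < length ys" "ys ! i = x" by (auto simp: in_set_conv_nth)
    with \<open>is_upper x\<close> have "1 \<le> Suc i \<and> Suc i < length xs \<and> is_upper (xs ! Suc i)" by (simp add: xs)
    with not show False by blast
  qed
  have le: "nf_var x \<le> 0" if "\<not> is_upper x" for x
    using that by (auto simp: nf_var_def is_upper_def)
  have tail: "sum_list (map nf_var zs) \<le> 0 \<and> ((\<exists>x\<in>set zs. is_aux x) \<longrightarrow> sum_list (map nf_var zs) < 0)"
    if "\<forall>x\<in>set zs. \<not> is_upper x" for zs
    using that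
  proof (induction zs)
    case (Cons z zs)
    then have "nf_var z \<le> 0" "is_aux z \<Longrightarrow> nf_var z < 0"
      by (auto simp: nf_var_def is_upper_def is_aux_def)
    with Cons show ?case by force
  qed simp
  have tail': "sum_list (map nf_var ys) \<le> 0" "(\<exists>x\<in>set ys. is_aux x) \<Longrightarrow> sum_list (map nf_var ys) < 0"
    using tail[of ys] ys by blast+
  have "nf_var y + sum_list (map nf_var ys) = 1"
    using assms by (simp add: fcls_def nf_mono_def xs)
  moreover have "nf_var y \<le> 1" "is_aux y \<Longrightarrow> nf_var y \<le> 0"
    by (auto simp: nf_var_def is_aux_def)
  moreover have "is_aux y \<or> (\<exists>x\<in>set ys. is_aux x)"
    using assms by (simp add: fcls_def xs)
  ultimately show False using tail' by fastforce
qed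

context supercharge
begin

lemma opsum_fcls:
  assumes "\<And>xs. T xs \<noteq> 0 \<Longrightarrow> fcls s q xs" "opsum qk J T xs \<noteq> 0"
  shows "fcls s (q - 1) xs"
proof -
  obtain j x where j: "j < length xs" "qk x (xs ! j) \<noteq> 0" "T (xs[j := x]) \<noteq> 0"
    using opsum_nonzeroE[OF assms(2)] by metis
  note q = qk_upper[OF j(2)]
  have "fcls s (q - 1) ((xs[j := x])[j := xs ! j]) \<longleftrightarrow> fcls s (q - 1 + 1) (xs[j := x])"
    by (rule fcls_lower) (use j q in auto)
  then show ?thesis using assms(1)[OF j(3)] by simp
qed

lemma Q_square: "uniformly_local N T \<Longrightarrow> opsum qk J (opsum qk J T) xs = 0"
  by (rule opsum_opsum) (rule qk_flip qk_square_zero, assumption?)+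

text \<open>\<open>S\<close> is D_j \<open>T\<close>. On an output with an upper field in slot
  \<open>j\<close>, the \<open>j\<close> term of \<open>Qtail S\<close> is absent; anticommutation
  turns the others into minus D_j of (\<open>Qtail T\<close> minus its \<open>j\<close> term), which
  by closedness is D_j Q_j \<open>T\<close>, that is, \<open>T\<close>.\<close>

lemma eliminate_slot:
  assumes T: "uniformly_local N T" and cls: "\<And>xs. T xs \<noteq> 0 \<Longrightarrow> fcls s q xs"
    and closed: "\<And>xs. Qtail T xs = 0" and j: "1 \<le> j"
  obtains S where "uniformly_local N S"
    "\<And>xs. S xs \<noteq> 0 \<Longrightarrow> \<exists>x. j < length xs \<and> T (xs[j := x]) \<noteq> 0 \<and> is_upper (xs ! j) \<and> fst (snd (xs ! j)) = s
        \<and> fst x = lower (fst (xs ! j)) \<and> fst (snd x) = s"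
    "\<And>xs. j < length xs \<Longrightarrow> is_upper (xs ! j) \<Longrightarrow> T xs = Qtail S xs"
proof -
  obtain L M where LM: "L > 0" "M > 0" "2 * M \<le> M\<^sub>0" "decays L M T"
    using uniformly_local_rate[OF T] .
  have M6: "M / 6 > 0" using LM by simp
  \<comment> \<open>The bound \<open>M / 6\<close> is what \<open>slot_far_term\<close>
    demands.\<close>
  obtain \<epsilon> A Ep Em where \<epsilon>: "0 < \<epsilon>" "\<epsilon> < M / 6" "A > 0"
    and bound: "\<And>k. norm (Ep k) \<le> A * exp (- \<epsilon> * real_of_int k)"
    "\<And>k. norm (Em k) \<le> A * exp (\<epsilon> * real_of_int k)"
    and inv: "\<And>n. ((\<lambda>l. Ep l * nabla (n - l)) has_sum (if n = 0 then 1 else 0)) UNIV"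
    "\<And>n. ((\<lambda>l. Em l * nabla (n - l)) has_sum (if n = 0 then 1 else 0)) UNIV"
    by (rule convolution_inverses[OF pos decay sum0 nonzero M6]) (rule that)
  let ?d = "\<lambda>xs :: lvar list. dk Ep Em (pos (xs ! 0))"
  define S where "S xs = (if j < length xs then slot (?d xs) j T xs else 0)" for xs
  have far: "norm (?d xs x y) \<le> A * exp (- \<epsilon> * \<bar>real_of_int (pos y - pos (xs ! 0))\<bar>) * exp (\<epsilon> * \<bar>real_of_int (pos x - pos (xs ! 0))\<bar>)" for xs x y
    by (rule dk_bound[OF bound \<epsilon>(1,3)])
  \<comment> \<open>Stated for every tensor of rate \<open>M\<close>, since D_j is also applied to
    the single-slot parts of \<open>Qtail T\<close>.\<close>
  have summable: "(\<lambda>x. ?d xs x (xs ! j) * U (xs[j := x])) summable_on UNIV"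
    if U: "decays B M U" "B > 0" and len: "j < length xs" for B U xs
  proof -
    have "(\<lambda>x. norm (?d xs x (xs ! j) * U (xs[j := x]))) summable_on UNIV"
      by (rule slot_bound(1)[OF \<epsilon>(1)], rule slot_far_term[OF far U(1) \<epsilon>(1), where a = j and b = j])
        (use \<epsilon> U j len in auto)
    then show ?thesis by (rule abs_summable_summable)
  qed
  have loc: "uniformly_local N S"
  proof (rule uniformly_localI)
    show "S xs = 0" if "N < length xs" for xs
      using that uniformly_localD(1)[OF T] by (simp add: S_def slot_def)
    show "S (map (shift 1) xs) = S xs" for xs
    proof (cases "j < length xs")
      case True
      have "dk Ep Em (pos (map (shift 1) xs ! 0)) (shift 1 x) (shift 1 y) = ?d xs x y" for x y
        using True j by (subst nth_map) (auto simp: dk_def)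
      then have "slot (?d (map (shift 1) xs)) j T (map (shift 1) xs) = slot (?d xs) j T xs"
        by (intro slot_shift uniformly_localD(2)[OF T] True)
      then show ?thesis by (simp add: S_def)
    qed (simp add: S_def)
    show "A * L * decay_mass \<epsilon> + 1 > 0"
      using \<epsilon> LM decay_mass_nonneg by (intro add_nonneg_pos mult_nonneg_nonneg) auto
    show "\<epsilon> > 0" by (rule \<epsilon>)
    show "decays (A * L * decay_mass \<epsilon> + 1) \<epsilon> S"
      unfolding decays_def
    proof (intro allI impI)
      fix xs :: "lvar list" and a b assume ab: "a < length xs" "b < length xs"
      let ?e = "exp (- \<epsilon> * \<bar>real_of_int (pos (xs ! a) - pos (xs ! b))\<bar>)"
      have "norm (S xs) \<le> A * L * ?e * decay_mass \<epsilon>"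
      proof (cases "j < length xs")
        case True
        have "norm (slot (?d xs) j T xs) \<le> A * L * ?e * decay_mass \<epsilon>"
          by (rule slot_bound(2)[OF \<epsilon>(1)], rule slot_far_term[OF far LM(4) \<epsilon>(1)])
            (use \<epsilon> LM j ab True in auto)
        then show ?thesis using True by (simp add: S_def)
      next
        case False
        then show ?thesis using \<epsilon> LM decay_mass_nonneg by (simp add: S_def)
      qed
      also have "\<dots> \<le> (A * L * decay_mass \<epsilon> + 1) * ?e"
        by (simp add: algebra_simps)
      finally show "norm (S xs) \<le> (A * L * decay_mass \<epsilon> + 1) * ?e" .
    qed
  qed
  have supp: "\<exists>x. j < length xs \<and> T (xs[j := x]) \<noteq> 0 \<and> is_upper (xs ! j) \<and> fst (snd (xs ! j)) = s
        \<and> fst x = lower (fst (xs ! j)) \<and> fst (snd x) = s" if nz: "S xs \<noteq> 0" for xs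
  proof -
    have len: "j < length xs" using nz by (simp add: S_def split: if_splits)
    have "\<exists>x. ?d xs x (xs ! j) * T (xs[j := x]) \<noteq> 0"
    proof (rule ccontr)
      assume "\<not> ?thesis"
      then have "(\<Sum>\<^sub>\<infinity>x. ?d xs x (xs ! j) * T (xs[j := x])) = 0" by (intro infsum_0) blast
      with nz len show False by (simp add: S_def slot_def)
    qed
    then obtain x where "?d xs x (xs ! j) \<noteq> 0" "T (xs[j := x]) \<noteq> 0" by auto
    then show ?thesis using len by (intro exI[of _ x]) (auto simp: dk_def split: if_splits)
  qed
  have eq: "T xs = Qtail S xs" if len: "j < length xs" and up: "is_upper (xs ! j)" for xs
  proof (cases "fst (snd (xs ! j)) = s")
    case False
    have "T xs = 0"
    proof (rule ccontr)
      assume "T xs \<noteq> 0"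
      then have "\<forall>x\<in>set xs. fst (snd x) = s" using cls by (simp add: fcls_def)
      with False len show False by simp
    qed
    moreover have "Qtail S xs = 0"
    proof (rule ccontr)
      assume "Qtail S xs \<noteq> 0"
      then obtain i x where i: "i \<in> {1..}" "i < length xs" "qk x (xs ! i) \<noteq> 0" "S (xs[i := x]) \<noteq> 0"
        by (rule opsum_nonzeroE)
      have "i \<noteq> j" using qk_upper[OF i(3)] up by auto
      then show False using supp[OF i(4)] False by auto
    qed
    ultimately show ?thesis by simp
  next
    case sgn: True
    let ?J = "{i. i \<in> {1..} \<and> i < length xs}"
    have jJ: "j \<in> ?J" using j len by simp
    have opS: "slot qk i S xs = - slot (?d xs) j (slot qk i T) xs" if i: "i \<in> ?J - {j}" for i
    proof -
      have "S (xs[i := x]) = slot (?d xs) j T (xs[i := x])" for x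
        using i len by (simp add: S_def)
      then have "slot qk i S xs = slot qk i (slot (?d xs) j T) xs"
        by (simp add: slot_def)
      also have "\<dots> = - slot (?d xs) j (slot qk i T) xs"
      \<comment> \<open>\<open>T\<close> is dominated by its decay between slot \<open>j\<close> and
        the head, a bound independent of the entry in slot \<open>i\<close>; it beats the growth of
        D_j, while the kernel in slot \<open>i\<close> is summable by itself.\<close>
      proof (rule slot_anticommute[where a = "\<lambda>_. 1" and b = "\<lambda>y. L * exp (- M * \<bar>real_of_int (pos y - pos (xs ! 0))\<bar>)"])
        show "(\<lambda>x. norm (qk x (xs ! i)) * 1) summable_on UNIV"
          by (intro summable_on_cmult_left near_abs_summable)
        show "(\<lambda>y. norm (?d xs y (xs ! j)) * (L * exp (- M * \<bar>real_of_int (pos y - pos (xs ! 0))\<bar>))) summable_on UNIV"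
        proof (rule summable_on_comparison_test)
          show "(\<lambda>y::lvar. A * L * exp (- \<epsilon> * \<bar>real_of_int (pos y - pos (xs ! 0))\<bar>)) summable_on UNIV"
            by (intro summable_on_cmult_right summable_exp_pos \<epsilon>)
          fix y :: lvar
          let ?u = "\<bar>real_of_int (pos y - pos (xs ! 0))\<bar>"
          have "norm (?d xs y (xs ! j)) \<le> A * 1 * exp (\<epsilon> * ?u)"
            by (rule order_trans[OF far]) (use \<epsilon> in \<open>intro mult_right_mono mult_left_mono; simp\<close>)
          then have "norm (?d xs y (xs ! j)) * (L * exp (- M * ?u)) \<le> (A * exp (\<epsilon> * ?u)) * (L * exp (- M * ?u))"
            using LM by (intro mult_right_mono) auto
          also have "\<dots> = A * L * exp (\<epsilon> * ?u + - M * ?u)"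
            unfolding exp_add by (simp only: mult_ac)
          also have "\<dots> \<le> A * L * exp (- \<epsilon> * ?u)"
          proof -
            have "2 * \<epsilon> * ?u \<le> M * ?u" using \<epsilon> by (intro mult_right_mono) auto
            then show ?thesis using \<epsilon> LM by (intro mult_left_mono) auto
          qed
          finally show "norm (?d xs y (xs ! j)) * (L * exp (- M * ?u)) \<le> A * L * exp (- \<epsilon> * ?u)" .
          show "0 \<le> norm (?d xs y (xs ! j)) * (L * exp (- M * ?u))" using LM by simp
        qed
        show "norm (T (xs[i := x, j := y])) \<le> 1 * (L * exp (- M * \<bar>real_of_int (pos y - pos (xs ! 0))\<bar>))" for x y
        proof -
          have "xs \<noteq> []" using len by auto
          then show ?thesis
            using decaysD[OF LM(4), of j "xs[i := x, j := y]" 0] i j len by simp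
        qed
      qed (use i len LM qk_flip dk_flip in auto)
      finally show ?thesis .
    qed
    let ?D = "\<lambda>i. slot (?d xs) j (slot qk i T) xs"
    have "Qtail S xs = slot qk j S xs + (\<Sum>i\<in>?J - {j}. slot qk i S xs)"
      unfolding opsum_def using jJ by (subst sum.remove[of _ j]) auto
    also have "\<dots> = (\<Sum>i\<in>?J - {j}. - ?D i)"
      using slot_upper_zero[of xs j S] up by (simp add: opS)
    also have "\<dots> = ?D j - (\<Sum>i\<in>?J. ?D i)"
      using jJ by (subst sum.remove[of ?J j]) (auto simp: sum_negf)
    also have "(\<Sum>i\<in>?J. ?D i) = slot (?d xs) j (Qtail T) xs"
    proof -
      define B where "B = real N * (C * L * decay_mass M) + 1"
      have B: "B > 0" unfolding B_def using pos LM decay_mass_nonneg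
        by (intro add_nonneg_pos mult_nonneg_nonneg) auto
      have dec: "decays B M (opsum qk {i} T)" for i
        unfolding B_def by (rule opsum_decays[OF uniformly_localD(1)[OF T] LM])
      have single: "Qtail T ys = (\<Sum>i | i \<in> {1..} \<and> i < length ys. opsum qk {i} T ys)" for ys
        unfolding opsum_def[of qk "{1..}"] by (intro sum.cong) (auto simp: opsum_single)
      have "slot (?d xs) j (Qtail T) xs =
         sg xs j * (\<Sum>\<^sub>\<infinity>x. \<Sum>i\<in>?J. ?d xs x (xs ! j) * opsum qk {i} T (xs[j := x]))"
        by (simp only: slot_def[of _ _ "Qtail T"] single sum_distrib_left length_list_update)
      also have "\<dots> = sg xs j * (\<Sum>i\<in>?J. \<Sum>\<^sub>\<infinity>x. ?d xs x (xs ! j) * opsum qk {i} T (xs[j := x]))"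
        by (subst infsum_sum) (auto intro: summable[OF dec B len])
      also have "\<dots> = (\<Sum>i\<in>?J. slot (?d xs) j (opsum qk {i} T) xs)"
        by (simp add: slot_def[of _ j] sum_distrib_left)
      also have "\<dots> = (\<Sum>i\<in>?J. ?D i)"
        by (intro sum.cong refl slot_cong) (auto simp: opsum_single)
      finally show ?thesis by simp
    qed
    also have "\<dots> = 0"
      by (simp only: slot_def closed mult_zero_right infsum_0_simp)
    also have "?D j = T xs"
      by (rule slot_dk_qk[OF inv bound \<epsilon>(1,3) LM(4,1)]) (use \<epsilon> LM j len up sgn in auto)
    finally show ?thesis by simp
  qed
  show ?thesis by (rule that[OF loc supp eq])
qed

text \<open>Slots are cleared one by one: after step \<open>m\<close> equality holds on all lists
  with an upper field among the slots 1 to \<open>m\<close>. The type of the head is untouched by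
  tail operators and is carried along for the later treatment of the head.\<close>

lemma tail_exact:
  assumes T: "uniformly_local N T" and cls: "\<And>xs. T xs \<noteq> 0 \<Longrightarrow> fcls s 1 xs"
    and closed: "\<And>xs. Qtail T xs = 0"
    and hd: "\<And>xs. T xs \<noteq> 0 \<Longrightarrow> is_upper (xs ! 0) = b"
  obtains S where "uniformly_local N S" "\<And>xs. S xs \<noteq> 0 \<Longrightarrow> fcls s 2 xs"
    "\<And>xs. S xs \<noteq> 0 \<Longrightarrow> is_upper (xs ! 0) = b" "\<And>xs. T xs = Qtail S xs"
proof -
  let ?P = "\<lambda>m S. uniformly_local N S \<and> (\<forall>xs. S xs \<noteq> 0 \<longrightarrow> fcls s 2 xs \<and> is_upper (xs ! 0) = b) \<and>
    (\<forall>xs i. 1 \<le> i \<longrightarrow> i \<le> m \<longrightarrow> i < length xs \<longrightarrow> is_upper (xs ! i) \<longrightarrow> T xs = Qtail S xs)"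
  have hdQ: "is_upper (xs ! 0) = b"
    if S: "\<And>xs. S xs \<noteq> 0 \<Longrightarrow> is_upper (xs ! 0) = b" and nz: "Qtail S xs \<noteq> 0" for S xs
  proof -
    obtain j x where "j \<in> {1..}" "j < length xs" "S (xs[j := x]) \<noteq> 0"
      using opsum_nonzeroE[OF nz] by metis
    then show ?thesis using S[of "xs[j := x]"] by simp
  qed
  have "\<exists>S. ?P m S" for m
  proof (induction m)
    case 0
    have "uniformly_local N (\<lambda>_. 0)"
      using uniformly_local_diff[OF T T] by simp
    then show ?case by (intro exI[of _ "\<lambda>_. 0"]) auto
  next
    case (Suc m)
    then obtain S where S: "uniformly_local N S" "\<And>xs. S xs \<noteq> 0 \<Longrightarrow> fcls s 2 xs"
      "\<And>xs. S xs \<noteq> 0 \<Longrightarrow> is_upper (xs ! 0) = b"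
      and m: "\<And>xs i. 1 \<le> i \<Longrightarrow> i \<le> m \<Longrightarrow> i < length xs \<Longrightarrow> is_upper (xs ! i) \<Longrightarrow> T xs = Qtail S xs" by blast
    define T' where "T' xs = T xs - Qtail S xs" for xs
    have loc: "uniformly_local N T'"
      unfolding T'_def by (intro uniformly_local_diff T uniformly_local_opsum S)
    have cls': "fcls s 1 xs" if "T' xs \<noteq> 0" for xs
      using that cls[of xs] opsum_fcls[where T = S and q = 2 and J = "{1..}" and xs = xs, OF S(2)] by (cases "T xs = 0") (auto simp: T'_def)
    have hd': "is_upper (xs ! 0) = b" if "T' xs \<noteq> 0" for xs
      using that hd[of xs] hdQ[where S = S and xs = xs, OF S(3)] by (cases "T xs = 0") (simp_all add: T'_def)
    have closed': "Qtail T' xs = 0" for xs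
      unfolding T'_def opsum_diff[OF T uniformly_local_opsum[OF S(1)]]
      by (simp only: closed Q_square[OF S(1)] diff_self)
    obtain S' where loc': "uniformly_local N S'"
      and supp: "\<And>xs. S' xs \<noteq> 0 \<Longrightarrow> \<exists>x. Suc m < length xs \<and> T' (xs[Suc m := x]) \<noteq> 0 \<and> is_upper (xs ! Suc m) \<and> fst (snd (xs ! Suc m)) = s
        \<and> fst x = lower (fst (xs ! Suc m)) \<and> fst (snd x) = s"
      and eq: "\<And>xs. Suc m < length xs \<Longrightarrow> is_upper (xs ! Suc m) \<Longrightarrow> T' xs = Qtail S' xs"
      by (rule eliminate_slot[OF loc cls' closed', of "Suc m"]) auto
    have cls2: "fcls s 2 xs" if nz: "S' xs \<noteq> 0" for xs
    proof -
      obtain x where x: "Suc m < length xs" "T' (xs[Suc m := x]) \<noteq> 0" "is_upper (xs ! Suc m)" "fst (snd (xs ! Suc m)) = s"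
        "fst x = lower (fst (xs ! Suc m))" "fst (snd x) = s" using supp[OF nz] by blast
      show ?thesis using fcls_lower[OF x(1,3,4,5,6), of 1] cls'[OF x(2)] by simp
    qed
    have hd2: "is_upper (xs ! 0) = b" if nz: "S' xs \<noteq> 0" for xs
      using supp[OF nz] hd' by fastforce
    \<comment> \<open>The new correction does not disturb cleared slots: a nonzero term would come
      from a value of \<open>T'\<close> whose upper field in slot \<open>i\<close> is still present,
      and there \<open>T'\<close> vanishes already.\<close>
    have zero: "Qtail S' xs = 0" if i: "1 \<le> i" "i \<le> m" "i < length xs" "is_upper (xs ! i)" for xs i
    proof (rule ccontr)
      assume "Qtail S' xs \<noteq> 0"
      then obtain l x where l: "l < length xs" "qk x (xs ! l) \<noteq> 0" "S' (xs[l := x]) \<noteq> 0"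
        using opsum_nonzeroE by metis
      then obtain x' where x': "T' (xs[l := x, Suc m := x']) \<noteq> 0" using supp by blast
      have "i \<noteq> l" using qk_upper[OF l(2)] i by auto
      then have "is_upper (xs[l := x, Suc m := x'] ! i)" using i by simp
      then have "T' (xs[l := x, Suc m := x']) = 0"
        unfolding T'_def using m[OF i(1,2), of "xs[l := x, Suc m := x']"] i(3) by simp
      with x' show False by simp
    qed
    have "?P (Suc m) (\<lambda>xs. S xs + S' xs)"
    proof (intro conjI allI impI)
      show "uniformly_local N (\<lambda>xs. S xs + S' xs)" by (intro uniformly_local_add S loc')
      show "fcls s 2 xs" "is_upper (xs ! 0) = b" if "S xs + S' xs \<noteq> 0" for xs
        using that S(2)[of xs] S(3)[of xs] cls2[of xs] hd2[of xs] by (cases "S xs = 0"; simp)+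
      show "T xs = Qtail (\<lambda>xs. S xs + S' xs) xs"
        if i: "1 \<le> i" "i \<le> Suc m" "i < length xs" "is_upper (xs ! i)" for xs i
      proof (cases "i = Suc m")
        case True
        then have "T' xs = Qtail S' xs" using eq[of xs] i by blast
        then show ?thesis unfolding T'_def opsum_add[OF S(1) loc'] by (simp only: diff_eq_eq add.commute)
      next
        case False
        then show ?thesis using m[of i xs] zero[of i xs] i by (simp add: opsum_add[OF S(1) loc'])
      qed
    qed
    then show ?case by blast
  qed
  then obtain S where S: "uniformly_local N S" "\<And>xs. S xs \<noteq> 0 \<Longrightarrow> fcls s 2 xs"
      "\<And>xs. S xs \<noteq> 0 \<Longrightarrow> is_upper (xs ! 0) = b"
      and N: "\<And>xs i. 1 \<le> i \<Longrightarrow> i \<le> N \<Longrightarrow> i < length xs \<Longrightarrow> is_upper (xs ! i) \<Longrightarrow> T xs = Qtail S xs" by metis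
  \<comment> \<open>Wherever the two sides could differ, the list lies in the sector with fermion
    number 1, so it has an upper field in the tail, and every slot has been cleared.\<close>
  have eq: "T xs = Qtail S xs" for xs
  proof (rule ccontr)
    assume ne: "T xs \<noteq> Qtail S xs"
    then have "fcls s 1 xs"
      using cls[of xs] opsum_fcls[where T = S and q = 2 and J = "{1..}" and xs = xs, OF S(2)] by (cases "T xs = 0") auto
    then obtain i where i: "1 \<le> i" "i < length xs" "is_upper (xs ! i)" using fcls_upper_tail by blast
    have "length xs \<le> N"
    proof (rule ccontr)
      assume "\<not> ?thesis"
      then have "T xs = 0" "Qtail S xs = 0"
        using uniformly_localD(1)[OF T] uniformly_localD(1)[OF uniformly_local_opsum[OF S(1)]] by auto
      with ne show False by simp
    qed
    with N[of i xs] i ne show False by simp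
  qed
  show ?thesis by (rule that[OF S eq])
qed

text \<open>The part with upper head is closed under the tail charge and is removed by
  \<open>S1\<close>. What remains has only lower heads, on which the head term of the charge is
  zero, so a tail preimage is a full preimage.\<close>

lemma exact:
  assumes T: "uniformly_local N T" and cls: "\<And>xs. T xs \<noteq> 0 \<Longrightarrow> fcls s 1 xs"
    and closed: "\<And>xs. Q T xs = 0"
  obtains S where "uniformly_local N S" "\<And>xs. S xs \<noteq> 0 \<Longrightarrow> fcls s 2 xs" "\<And>xs. T xs = Q S xs"
proof -
  have ne: "xs \<noteq> []" if "fcls s q xs" for q xs using that by (auto simp: fcls_def)
  let ?h = "\<lambda>xs :: lvar list. xs \<noteq> [] \<and> is_upper (xs ! 0)"
  define T1 where "T1 xs = (if ?h xs then T xs else 0)" for xs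
  have T1: "uniformly_local N T1"
  proof -
    have "?h (map (shift 1) xs) = ?h xs" for xs by (cases xs) auto
    then show ?thesis unfolding T1_def by (rule uniformly_local_restrict[OF T])
  qed
  \<comment> \<open>The head term cannot produce an upper head, so here the full charge reduces to
    the tail charge.\<close>
  have tail0: "Qtail T xs = 0" if "?h xs" for xs
    using closed[of xs] that by (simp add: Q_split slot_upper_zero)
  have closed1: "Qtail T1 xs = 0" for xs
  proof (cases "?h xs")
    case True
    have "slot qk j T1 xs = slot qk j T xs" if "1 \<le> j" for j
      using True that by (simp add: slot_def T1_def)
    then have "Qtail T1 xs = Qtail T xs" unfolding opsum_def by (intro sum.cong) auto
    then show ?thesis using tail0[OF True] by simp
  next
    case False
    have "slot qk j T1 xs = 0" if "1 \<le> j" for j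
    proof -
      have "T1 (xs[j := x]) = 0" for x
        using False that unfolding T1_def by (cases "xs = []") auto
      then show ?thesis by (simp add: slot_def)
    qed
    then show ?thesis by (simp add: opsum_def)
  qed
  obtain S1 where S1: "uniformly_local N S1" "\<And>xs. S1 xs \<noteq> 0 \<Longrightarrow> fcls s 2 xs"
    "\<And>xs. S1 xs \<noteq> 0 \<Longrightarrow> is_upper (xs ! 0) = True" "\<And>xs. T1 xs = Qtail S1 xs"
    by (rule tail_exact[OF T1 _ closed1, of True]) (use cls in \<open>auto simp: T1_def split: if_splits\<close>)
  define T2 where "T2 xs = T xs - Q S1 xs" for xs
  have T2: "uniformly_local N T2"
    unfolding T2_def by (intro uniformly_local_diff T uniformly_local_opsum S1)
  have cls2: "fcls s 1 xs" if "T2 xs \<noteq> 0" for xs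
    using that cls[of xs] opsum_fcls[where T = S1 and q = 2 and J = UNIV and xs = xs, OF S1(2)] by (cases "T xs = 0") (auto simp: T2_def)
  have hd2: "\<not> is_upper (xs ! 0)" if nz: "T2 xs \<noteq> 0" for xs
  proof
    assume up: "is_upper (xs ! 0)"
    have "xs \<noteq> []" using ne cls2[OF nz] by blast
    then have "T xs = Q S1 xs"
      using S1(4)[of xs] up by (simp add: Q_split slot_upper_zero T1_def)
    with nz show False by (simp add: T2_def)
  qed
  have slot0: "slot qk 0 U xs = 0" if "\<And>xs. U xs \<noteq> 0 \<Longrightarrow> \<not> is_upper (xs ! 0)" "xs \<noteq> []" for U xs
  proof -
    have "qk x (xs ! 0) * U (xs[0 := x]) = 0" for x
      using qk_upper[of x "xs ! 0"] that(1)[of "xs[0 := x]"] that(2) by (cases xs) auto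
    then have "(\<Sum>\<^sub>\<infinity>x. qk x (xs ! 0) * U (xs[0 := x])) = 0" by (rule infsum_0)
    then show ?thesis by (simp add: slot_def)
  qed
  have closed2: "Qtail T2 xs = 0" for xs
  proof -
    have "Q T2 xs = 0"
      unfolding T2_def opsum_diff[OF T uniformly_local_opsum[OF S1(1)]]
      by (simp add: closed Q_square[OF S1(1)])
    then show ?thesis using slot0[where U = T2 and xs = xs, OF hd2] by (simp add: Q_split split: if_splits)
  qed
  obtain S2 where S2: "uniformly_local N S2" "\<And>xs. S2 xs \<noteq> 0 \<Longrightarrow> fcls s 2 xs"
    "\<And>xs. S2 xs \<noteq> 0 \<Longrightarrow> is_upper (xs ! 0) = False" "\<And>xs. T2 xs = Qtail S2 xs"
    by (rule tail_exact[OF T2 cls2 closed2, of False]) (use hd2 in auto)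
  have "T2 xs = Q S2 xs" for xs
    using S2(4)[of xs] slot0[of S2 xs] S2(3) by (auto simp: Q_split)
  then have "T xs = Q (\<lambda>xs. S1 xs + S2 xs) xs" for xs
    by (simp add: opsum_add[OF S1(1) S2(1)] T2_def diff_eq_eq add.commute)
  moreover have "fcls s 2 xs" if "S1 xs + S2 xs \<noteq> 0" for xs
    using that S1(2)[of xs] S2(2)[of xs] by (cases "S1 xs = 0") simp_all
  ultimately show ?thesis
    using that[OF uniformly_local_add[OF S1(1) S2(1)]] by blast
qed

end

section \<open>Terms without auxiliary fields\<close>

lemma gsym_add: "gsym (\<lambda>xs. T xs + S xs) xs = gsym T xs + gsym S xs"
  by (simp add: gsym_alt distrib_left sum.distrib)

lemma gsym_cong:
  "(\<And>ys. length ys = length xs \<Longrightarrow> T ys = S ys) \<Longrightarrow> gsym T xs = gsym S xs"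
  by (simp add: gsym_alt)

lemma gsym_nonzeroE:
  assumes "gsym T xs \<noteq> 0"
  obtains \<sigma> where "\<sigma> permutes {..<length xs}" "T (permute_list \<sigma> xs) \<noteq> 0"
proof -
  have "\<exists>\<sigma>\<in>{\<sigma>. \<sigma> permutes {..<length xs}}. psign \<sigma> xs * T (permute_list \<sigma> xs) \<noteq> 0"
    using assms unfolding gsym_alt by (meson sum.neutral)
  then show ?thesis using that by auto
qed

lemma nf_mono_mset: "mset xs = mset ys \<Longrightarrow> nf_mono xs = nf_mono ys"
  unfolding nf_mono_def by (metis mset_map sum_mset_sum_list)

definition chi_phi :: "sgn \<Rightarrow> lvar list \<Rightarrow> bool" where
  "chi_phi s xs \<longleftrightarrow> xs \<noteq> [] \<and> fst (hd xs) = Chi \<and> fst (snd (hd xs)) = s \<and>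
     (\<forall>y\<in>set (tl xs). fst y = Phi \<and> fst (snd y) = s)"

definition chi_phi_types :: "sgn \<Rightarrow> nat \<Rightarrow> (fld \<times> sgn) list" where
  "chi_phi_types s k = (Chi, s) # replicate k (Phi, s)"

lemma map2_chi_phi_types:
  "length ns = k \<Longrightarrow> map2 (\<lambda>k m. (fst k, snd k, m)) (chi_phi_types s k) (m # ns)
     = (Chi, s, m) # map (\<lambda>n. (Phi, s, n)) ns"
  unfolding chi_phi_types_def by (induction ns arbitrary: k) (auto simp: Suc_length_conv)

lemma chi_phi_positions:
  assumes "chi_phi s xs" "length xs = Suc k"
  shows "map2 (\<lambda>k m. (fst k, snd k, m)) (chi_phi_types s k) (map (\<lambda>y. snd (snd y)) xs) = xs"
proof -
  obtain y ys where xs: "xs = y # ys" using assms by (cases xs) auto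
  have y: "y = (Chi, s, snd (snd y))"
    using assms by (cases y) (simp add: xs chi_phi_def)
  have "map (\<lambda>n. (Phi, s, n)) (map (\<lambda>y. snd (snd y)) ys) = ys"
    using assms by (intro map_idI[of ys, unfolded] nth_equalityI) (auto simp: xs chi_phi_def prod_eq_iff)
  then show ?thesis
    using assms y map2_chi_phi_types[of "map (\<lambda>y. snd (snd y)) ys" k s "snd (snd y)"]
    by (simp only: xs list.map length_map list.size)
qed

text \<open>The number of \<sigma> with \<open>\<sigma> i = p\<close> is the same for every
  \<open>i < n\<close>, by composing with a transposition, and each \<sigma> hits \<open>p\<close>
  exactly once.\<close>

lemma card_permutes_at:
  assumes "p < n"
  shows "n * card {\<sigma>. \<sigma> permutes {..<n} \<and> \<sigma> 0 = p} = fact n"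
proof -
  let ?P = "{\<sigma>. \<sigma> permutes {..<n}}" and ?h = "\<lambda>q. if q = p then 1 else 0 :: nat"
  have fin: "finite ?P" by (simp add: finite_permutations)
  have card: "card {\<sigma>. \<sigma> permutes {..<n} \<and> \<sigma> 0 = p} = (\<Sum>\<sigma>\<in>?P. ?h (\<sigma> 0))"
    using fin by (simp add: sum.If_cases Int_def)
  have const: "(\<Sum>\<sigma>\<in>?P. ?h (\<sigma> 0)) = (\<Sum>\<sigma>\<in>?P. ?h (\<sigma> i))" if i: "i < n" for i
  proof -
    have "Transposition.transpose 0 i permutes {..<n}" using i by (intro permutes_swap_id) auto
    from sum_permutations_compose_right[OF this, of "\<lambda>\<sigma>. ?h (\<sigma> 0)"] show ?thesis by simp
  qed
  have "n * (\<Sum>\<sigma>\<in>?P. ?h (\<sigma> 0)) = (\<Sum>i<n. \<Sum>\<sigma>\<in>?P. ?h (\<sigma> 0))" by simp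
  also have "\<dots> = (\<Sum>i<n. \<Sum>\<sigma>\<in>?P. ?h (\<sigma> i))"
    by (intro sum.cong refl const) simp
  also have "\<dots> = (\<Sum>\<sigma>\<in>?P. \<Sum>i<n. ?h (\<sigma> i))" by (rule sum.swap)
  also have "\<dots> = (\<Sum>\<sigma>\<in>?P. \<Sum>i<n. ?h i)"
  proof (rule sum.cong)
    fix \<sigma> assume "\<sigma> \<in> ?P"
    then have "\<sigma> permutes {..<n}" by simp
    from sum.permute[OF this, of ?h] show "(\<Sum>i<n. ?h (\<sigma> i)) = (\<Sum>i<n. ?h i)" by (simp only: o_def)
  qed simp
  also have "\<dots> = fact n" using assms by (simp add: card_permutations[of "{..<n}"])
  finally show ?thesis by (simp only: card)
qed

lemma unique_chi:
  assumes "\<forall>x\<in>set xs. fst x = Chi \<or> fst x = Phi" "nf_mono xs = 1"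
  obtains p where "p < length xs" "\<And>i. i < length xs \<Longrightarrow> fst (xs ! i) = Chi \<longleftrightarrow> i = p"
proof -
  let ?A = "{i\<in>{..<length xs}. fst (xs ! i) = Chi}"
  have "nf_mono xs = (\<Sum>i<length xs. nf_var (xs ! i))"
    by (simp add: nf_mono_def sum_list_sum_nth atLeast0LessThan)
  also have "\<dots> = (\<Sum>i<length xs. if fst (xs ! i) = Chi then 1 else 0)"
    using assms(1) by (intro sum.cong refl) (auto simp: nf_var_def dest!: bspec[OF _ nth_mem])
  also have "\<dots> = int (card ?A)"
    by (simp add: sum.If_cases Int_def)
  finally have "card ?A = 1" using assms(2) by simp
  then obtain p where p: "?A = {p}" by (auto simp: card_1_singleton_iff)
  show ?thesis
  proof (rule that[of p])
    show "p < length xs" using p by auto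
    show "fst (xs ! i) = Chi \<longleftrightarrow> i = p" if "i < length xs" for i
      using p that by auto
  qed
qed

lemma psign_eq_1:
  assumes "\<sigma> permutes {..<length xs}"
    and "\<And>i j. i < length xs \<Longrightarrow> j < length xs \<Longrightarrow> is_odd (xs ! i) \<Longrightarrow> is_odd (xs ! j) \<Longrightarrow> i = j"
  shows "psign \<sigma> xs = 1"
proof -
  have "{(i,j). i < j \<and> j < length xs \<and> \<sigma> j < \<sigma> i \<and> is_odd (xs ! \<sigma> i) \<and> is_odd (xs ! \<sigma> j)} = {}"
  proof -
    have False if "i < j" "j < length xs" "\<sigma> j < \<sigma> i" "is_odd (xs ! \<sigma> i)" "is_odd (xs ! \<sigma> j)" for i j
    proof -
      have "\<sigma> i < length xs" "\<sigma> j < length xs"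
        using permutes_in_image[OF assms(1), of i] permutes_in_image[OF assms(1), of j] that by auto
      then have "\<sigma> i = \<sigma> j" using assms(2) that by blast
      then show False using that by simp
    qed
    then show ?thesis by blast
  qed
  then show ?thesis by (simp only: psign_def card.empty power_0)
qed

context supercharge
begin

lemma Q_gsym:
  assumes "uniformly_local N T"
  shows "Q (gsym T) xs = gsym (Q T) xs"
proof -
  have Q: "opsum qk UNIV U = (\<lambda>xs. \<Sum>j<length xs. slot qk j U xs)" for U
    by (auto simp: opsum_def lessThan_def)
  show ?thesis unfolding Q
    by (rule gsym_sum_slot[OF qk_flip slot_summable[OF assms]])
qed

text \<open>A property unchanged by all replacements that the charge makes cuts out a direct summand
  of the complex.\<close>

lemma Q_restrict:
  assumes "\<And>xs j x. j < length xs \<Longrightarrow> qk x (xs ! j) \<noteq> 0 \<Longrightarrow> p (xs[j := x]) = p xs"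
  shows "Q (\<lambda>xs. if p xs then T xs else 0) xs = (if p xs then Q T xs else 0)"
proof -
  have "slot qk j (\<lambda>xs. if p xs then T xs else 0) xs = (if p xs then slot qk j T xs else 0)"
    if j: "j < length xs" for j
  proof -
    have "qk x (xs ! j) * (if p (xs[j := x]) then T (xs[j := x]) else 0) =
        (if p xs then qk x (xs ! j) * T (xs[j := x]) else 0)" for x
      using assms[OF j, of x] by (cases "qk x (xs ! j) = 0") auto
    then show ?thesis by (simp add: slot_def)
  qed
  then have "Q (\<lambda>xs. if p xs then T xs else 0) xs =
      (\<Sum>j | j \<in> UNIV \<and> j < length xs. if p xs then slot qk j T xs else 0)"
    unfolding opsum_def by (intro sum.cong) auto
  then show ?thesis by (simp add: opsum_def)
qed

lemma aux_update:
  assumes "j < length xs" "qk x (xs ! j) \<noteq> 0"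
  shows "(\<exists>y\<in>set (xs[j := x]). is_aux y) = (\<exists>y\<in>set xs. is_aux y)"
proof -
  have aux: "is_aux x = is_aux (xs ! j)"
    using qk_upper[OF assms(2)] by (auto simp: is_aux_def is_upper_def)
  have "(\<forall>y\<in>set (xs[j := x]). \<not> is_aux y) \<longleftrightarrow> (\<forall>y\<in>set (xs[j := xs ! j]). \<not> is_aux y)"
    unfolding all_set_update_iff[OF assms(1)] using aux by simp
  then show ?thesis by auto
qed

lemma slot_phi:
  assumes j: "j < length xs" and xs: "xs ! j = (Phi, s, n)" "\<And>i. i < length xs \<Longrightarrow> \<not> is_odd (xs ! i)"
  shows "slot qk j T xs = ucoeff s Chi * (\<Sum>\<^sub>\<infinity>m. nabla (m - n) * T (xs[j := (Chi, s, m)]))"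
proof -
  have sg: "sg xs j = 1"
    unfolding sg_prod using xs j by (intro prod.neutral) auto
  have "(\<Sum>\<^sub>\<infinity>x. qk x (xs ! j) * T (xs[j := x])) =
      (\<Sum>\<^sub>\<infinity>x\<in>range (\<lambda>m. (Chi, s, m)). qk x (xs ! j) * T (xs[j := x]))"
  proof (rule infsum_cong_neutral)
    fix x :: lvar assume "x \<in> UNIV - range (\<lambda>m. (Chi, s, m))"
    then show "qk x (xs ! j) * T (xs[j := x]) = 0"
      by (cases x; cases "fst x") (auto simp: qk_def xs is_upper_def)
  qed auto
  also have "\<dots> = (\<Sum>\<^sub>\<infinity>m. qk (Chi, s, m) (xs ! j) * T (xs[j := (Chi, s, m)]))"
    by (subst infsum_reindex) (auto simp: inj_on_def o_def)
  also have "\<dots> = (\<Sum>\<^sub>\<infinity>m. ucoeff s Chi * (nabla (m - n) * T (xs[j := (Chi, s, m)])))"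
    by (simp add: qk_def xs is_upper_def pos_def mult.assoc)
  finally show ?thesis
    by (simp add: slot_def infsum_cmult_right' sg)
qed

text \<open>The CLR is \<open>Q T = 0\<close> evaluated on \<open>k + 1\<close> fields
  \<open>Phi\<close>: slot \<open>r\<close> gives, up to a common phase, the cyclic term of rotation
  \<open>r\<close>. The factor \<open>Suc k\<close> is the number of places where \<open>Chi\<close>
  could stand, while a CLR term lists it only in front.\<close>

lemma clr_of_closed:
  assumes T: "uniformly_local N T"
    and sym: "\<And>xs ys. mset xs = mset ys \<Longrightarrow> chi_phi s xs \<Longrightarrow> T ys = T xs"
    and closed: "\<And>xs. Q T xs = 0"
  shows "is_clr nabla k (\<lambda>ms. of_nat (Suc k) * T (map2 (\<lambda>k m. (fst k, snd k, m)) (chi_phi_types s k) ms))"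
    (is "is_clr nabla k ?C")
proof -
  have C: "?C (m # ns) = of_nat (Suc k) * T ((Chi, s, m) # map (\<lambda>n. (Phi, s, n)) ns)"
    if "length ns = k" for m ns
    by (simp only: map2_chi_phi_types[OF that])
  have "uniformly_local N (\<lambda>xs. of_nat (Suc k) * T xs)"
    using uniformly_local_scale[OF T, of "\<lambda>_. of_nat (Suc k)"] .
  then have "tilc ?C (Suc k)"
    by (rule uniformly_local_imp_tilc) (simp add: chi_phi_types_def)
  moreover have "?C (m # ns') = ?C (m # ns)" if "length ns = k" "mset ns' = mset ns" for m ns ns'
  proof -
    have "T ((Chi, s, m) # map (\<lambda>n. (Phi, s, n)) ns') = T ((Chi, s, m) # map (\<lambda>n. (Phi, s, n)) ns)"
      by (rule sym) (use that in \<open>auto simp: chi_phi_def\<close>)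
    moreover have "length ns' = k" using that mset_eq_length by metis
    ultimately show ?thesis by (simp only: C that(1))
  qed
  moreover have "(\<Sum>r<Suc k. infsum (\<lambda>m. nabla (m - hd (rotate r ns)) * ?C (m # tl (rotate r ns))) UNIV) = 0"
    if ns: "length ns = Suc k" for ns
  proof -
    let ?xs = "map (\<lambda>n. (Phi, s, n)) ns"
    have "infsum (\<lambda>m. nabla (m - hd (rotate r ns)) * ?C (m # tl (rotate r ns))) UNIV
       = of_nat (Suc k) / ucoeff s Chi * slot qk r T ?xs" if r: "r < Suc k" for r
    proof -
      have rot: "rotate r ns = ns ! r # drop (Suc r) ns @ take r ns"
        using r ns by (simp add: rotate_drop_take Cons_nth_drop_Suc)
      have eq: "?C (m # tl (rotate r ns)) = of_nat (Suc k) * T (?xs[r := (Chi, s, m)])" for m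
      proof -
        \<comment> \<open>Moving the \<open>Chi\<close> in slot \<open>r\<close> to the front and
          reordering the fields \<open>Phi\<close> is a permutation of the list, harmless by
          symmetry.\<close>
        have "T (?xs[r := (Chi, s, m)]) = T ((Chi, s, m) # map (\<lambda>n. (Phi, s, n)) (tl (rotate r ns)))"
        proof (rule sym)
          show "mset ((Chi, s, m) # map (\<lambda>n. (Phi, s, n)) (tl (rotate r ns))) = mset (?xs[r := (Chi, s, m)])"
            using r ns by (simp add: rot upd_conv_take_nth_drop take_map drop_map)
        qed (auto simp: chi_phi_def)
        then show ?thesis using C[of "tl (rotate r ns)" m] ns by simp
      qed
      have "slot qk r T ?xs = ucoeff s Chi * (\<Sum>\<^sub>\<infinity>m. nabla (m - ns ! r) * T (?xs[r := (Chi, s, m)]))"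
        by (rule slot_phi) (use r ns in \<open>auto simp: is_odd_def\<close>)
      moreover have "infsum (\<lambda>m. nabla (m - hd (rotate r ns)) * ?C (m # tl (rotate r ns))) UNIV =
         of_nat (Suc k) * (\<Sum>\<^sub>\<infinity>m. nabla (m - ns ! r) * T (?xs[r := (Chi, s, m)]))"
        unfolding eq unfolding rot list.sel infsum_cmult_right'[symmetric] by (simp only: mult_ac)
      ultimately show ?thesis by simp
    qed
    then have "(\<Sum>r<Suc k. infsum (\<lambda>m. nabla (m - hd (rotate r ns)) * ?C (m # tl (rotate r ns))) UNIV)
      = (\<Sum>r<Suc k. of_nat (Suc k) / ucoeff s Chi * slot qk r T ?xs)"
      by (intro sum.cong refl) simp
    also have "\<dots> = of_nat (Suc k) / ucoeff s Chi * Q T ?xs"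
      unfolding sum_distrib_left[symmetric] opsum_def using ns by (simp add: lessThan_def)
    finally show ?thesis by (simp add: closed)
  qed
  ultimately show ?thesis unfolding is_clr_def by blast
qed

end

lemma sum_clr_tensor:
  assumes T: "\<And>xs. N < length xs \<Longrightarrow> T xs = 0"
  shows "(\<Sum>k<N. clr_tensor s k (\<lambda>ms. of_nat (Suc k) * T (map2 (\<lambda>k m. (fst k, snd k, m)) (chi_phi_types s k) ms)) xs)
    = (if chi_phi s xs then of_nat (length xs) * T xs else 0)"
proof -
  let ?C = "\<lambda>k ms. of_nat (Suc k) * T (map2 (\<lambda>k m. (fst k, snd k, m)) (chi_phi_types s k) ms)"
  have "clr_tensor s k (?C k) xs = (if k = length xs - 1 \<and> chi_phi s xs then of_nat (length xs) * T xs else 0)" for k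
  proof (cases "chi_phi s xs \<and> length xs = Suc k")
    case True
    then have "clr_tensor s k (?C k) xs = ?C k (map (\<lambda>y. snd (snd y)) xs)"
      unfolding clr_tensor_def chi_phi_def by auto
    also have "\<dots> = of_nat (length xs) * T xs"
      using True chi_phi_positions[of s xs k] by simp
    finally show ?thesis using True by simp
  next
    case False
    then have "clr_tensor s k (?C k) xs = 0"
      unfolding clr_tensor_def chi_phi_def by auto
    moreover have "\<not> (k = length xs - 1 \<and> chi_phi s xs)"
      using False by (cases xs) (auto simp: chi_phi_def)
    ultimately show ?thesis by (simp only: if_False)
  qed
  then have eq: "(\<Sum>k<N. clr_tensor s k (?C k) xs) =
     (\<Sum>k<N. if k = length xs - 1 then (if chi_phi s xs then of_nat (length xs) * T xs else 0) else 0)"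
    by (intro sum.cong) auto
  show ?thesis
  proof (cases "chi_phi s xs \<and> length xs \<le> N")
    case True
    then have "length xs - 1 < N" by (cases xs) (auto simp: chi_phi_def)
    then show ?thesis unfolding eq by simp
  next
    case False
    then have "(if chi_phi s xs then of_nat (length xs) * T xs else 0) = 0"
      using T[of xs] by auto
    then show ?thesis unfolding eq by simp
  qed
qed

text \<open>Without auxiliary fields, fermion number 1 means exactly one \<open>Chi\<close>. Among
  the n! orders only (n-1)! have it in front; the weight \<open>length xs\<close> restores the
  balance.\<close>

lemma gsym_chi_phi:
  assumes sym: "\<And>\<sigma> xs. \<sigma> permutes {..<length xs} \<Longrightarrow> psign \<sigma> xs * T (permute_list \<sigma> xs) = T xs"
    and supp: "\<And>xs. T xs \<noteq> 0 \<Longrightarrow> (\<forall>x\<in>set xs. fst (snd x) = s) \<and> nf_mono xs = 1"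
  shows "gsym (\<lambda>xs. if chi_phi s xs then of_nat (length xs) * T xs else 0) xs =
    gsym (\<lambda>xs. if \<exists>x\<in>set xs. is_aux x then 0 else T xs) xs" (is "gsym ?U xs = gsym ?V xs")
proof -
  let ?P = "{\<sigma>. \<sigma> permutes {..<length xs}}"
  have U: "gsym ?U xs = (\<Sum>\<sigma>\<in>?P. if chi_phi s (permute_list \<sigma> xs) then of_nat (length xs) * T xs else 0)"
    unfolding gsym_alt
    by (intro sum.cong refl) (simp add: mult.left_commute[of "psign _ _" "of_nat _"] sym)
  have V: "gsym ?V xs = (\<Sum>\<sigma>\<in>?P. ?V xs)"
    unfolding gsym_alt by (intro sum.cong refl) (auto simp: sym)
  show ?thesis
  proof (cases "T xs = 0 \<or> (\<exists>x\<in>set xs. is_aux x)")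
    case True
    have "(if chi_phi s (permute_list \<sigma> xs) then of_nat (length xs) * T xs else 0) = 0" if "\<sigma> \<in> ?P" for \<sigma>
    proof (cases "T xs = 0")
      case False
      with True obtain x where x: "x \<in> set xs" "is_aux x" by blast
      then have "x \<in> set (permute_list \<sigma> xs)" using that by simp
      with x have "\<not> chi_phi s (permute_list \<sigma> xs)"
        by (cases "permute_list \<sigma> xs") (auto simp: chi_phi_def is_aux_def intro!: bexI[of _ x])
      then show ?thesis by simp
    qed simp
    then have "gsym ?U xs = 0" unfolding U by (rule sum.neutral[OF ballI])
    moreover have "gsym ?V xs = 0" unfolding V using True by auto
    ultimately show ?thesis by simp
  next
    case False
    then have xs: "\<forall>x\<in>set xs. fst (snd x) = s" "nf_mono xs = 1" and na: "\<forall>x\<in>set xs. \<not> is_aux x"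
      using supp by auto
    have cp: "fst x = Chi \<or> fst x = Phi" if "x \<in> set xs" for x
      using na that by (cases "fst x") (auto simp: is_aux_def)
    obtain p where p: "p < length xs" "\<And>i. i < length xs \<Longrightarrow> fst (xs ! i) = Chi \<longleftrightarrow> i = p"
      using unique_chi[of xs] cp xs by blast
    have iff: "chi_phi s (permute_list \<sigma> xs) \<longleftrightarrow> \<sigma> 0 = p" if "\<sigma> \<in> ?P" for \<sigma>
    proof -
      have \<sigma>: "\<sigma> permutes {..<length xs}" using that by simp
      have lt: "\<sigma> i < length xs" if "i < length xs" for i
        using permutes_in_image[OF \<sigma>, of i] that by simp
      have inj: "\<sigma> i = \<sigma> j \<longleftrightarrow> i = j" for i j
        using permutes_inj[OF \<sigma>] by (simp add: inj_eq)
      have nth: "permute_list \<sigma> xs ! i = xs ! \<sigma> i" if "i < length xs" for i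
        using that by (rule permute_list_nth[OF \<sigma>])
      have ne: "permute_list \<sigma> xs \<noteq> []" "0 < length xs" using p(1) by (auto simp flip: length_greater_0_conv)
      have hd: "hd (permute_list \<sigma> xs) = xs ! \<sigma> 0"
        using ne nth[of 0] by (simp add: hd_conv_nth)
      have "chi_phi s (permute_list \<sigma> xs)" if 0: "\<sigma> 0 = p"
      proof -
        have "fst y = Phi \<and> fst (snd y) = s" if y: "y \<in> set (tl (permute_list \<sigma> xs))" for y
        proof -
          obtain i where i: "i < length xs - 1" "tl (permute_list \<sigma> xs) ! i = y"
            using y by (auto simp: in_set_conv_nth)
          then have "y = xs ! \<sigma> (Suc i)" using nth[of "Suc i"] by (simp add: nth_tl)
          moreover have "\<sigma> (Suc i) \<noteq> p" using 0 inj[of "Suc i" 0] by auto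
          moreover have l: "\<sigma> (Suc i) < length xs" using lt[of "Suc i"] i by simp
          ultimately show ?thesis using p(2)[OF l] cp[of y] xs(1) nth_mem[OF l] by auto
        qed
        then show ?thesis
          using hd ne p xs(1) by (auto simp: chi_phi_def 0)
      qed
      moreover have "\<sigma> 0 = p" if "chi_phi s (permute_list \<sigma> xs)"
        using that hd p(2)[OF lt[OF ne(2)]] by (simp add: chi_phi_def)
      ultimately show ?thesis by blast
    qed
    have "gsym ?U xs = (\<Sum>\<sigma>\<in>?P. if \<sigma> 0 = p then of_nat (length xs) * T xs else 0)"
      unfolding U by (intro sum.cong refl) (simp add: iff)
    also have "\<dots> = of_nat (length xs * card {\<sigma>. \<sigma> permutes {..<length xs} \<and> \<sigma> 0 = p}) * T xs"
      using finite_permutations[of "{..<length xs}"] by (simp add: sum.If_cases Int_def)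
    also have "\<dots> = fact (length xs) * T xs"
      unfolding card_permutes_at[OF p(1)] by simp
    also have "\<dots> = gsym ?V xs"
      unfolding V using na by (simp add: card_permutations[of "{..<length xs}"])
    finally show ?thesis .
  qed
qed

section \<open>Assembly of the decomposition\<close>

theorem theorem1:
  fixes nabla :: "int \<Rightarrow> complex" and s :: sgn and P :: "lvar list \<Rightarrow> complex"
  assumes "difference_op nabla"
    and "local_functional P" and "fermion_number 1 P" and "pure s P" and "P [] = 0"
    and "geq (qop nabla (flip s) P) (\<lambda>_. 0)"
  shows "\<exists>(cs :: (complex \<times> nat \<times> (int list \<Rightarrow> complex)) list) Qt.
           (\<forall>(a, k, C)\<in>set cs. is_clr nabla k C) \<and>
           local_functional Qt \<and> fermion_number 2 Qt \<and> pure s Qt \<and> Qt [] = 0 \<and>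
           geq P (\<lambda>xs. (\<Sum>(a, k, C)\<leftarrow>cs. a * clr_tensor s k C xs) + qop nabla (flip s) Qt xs)"
proof -
  obtain L M K k0 where LM: "L > 0" "M > 0"
    and dec: "\<And>k. K \<le> \<bar>k\<bar> \<Longrightarrow> norm (nabla k) < L * exp (- M * real_of_int \<bar>k\<bar>)"
    and sum0: "(nabla has_sum 0) UNIV" and k0: "nabla k0 \<noteq> 0"
    using assms(1) unfolding difference_op_def by blast
  obtain C where C: "C > 0" "\<And>k. norm (nabla k) \<le> C * exp (- M * \<bar>real_of_int k\<bar>)"
    using exp_decay_everywhere[OF LM(2) dec] by blast
  interpret supercharge nabla s C M k0
    by (rule supercharge.intro[OF C(2,1) LM(2) sum0 k0])
  obtain N where P: "uniformly_local N P"
    using uniformly_local_if_local_functional[OF assms(2)] .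
  \<comment> \<open>\<open>R\<close> represents the same element as \<open>P\<close> and is itself
    graded symmetric, so that closedness up to symmetrization becomes \<open>Q R = 0\<close> on
    every list.\<close>
  define R where "R xs = 1 / fact (length xs) * gsym P xs" for xs
  have R: "uniformly_local N R"
    unfolding R_def by (rule uniformly_local_scale[OF uniformly_local_gsym[OF P], of "\<lambda>n. 1 / fact n"])
  have gR: "gsym R xs = gsym P xs" for xs
  proof -
    have "gsym R xs = 1 / fact (length xs) * gsym (gsym P) xs"
      unfolding gsym_alt[of R] gsym_alt[of "gsym P"] R_def sum_distrib_left
      by (intro sum.cong refl) simp
    then show ?thesis by (simp add: gsym_gsym)
  qed
  have sym: "psign \<sigma> xs * R (permute_list \<sigma> xs) = R xs" if "\<sigma> permutes {..<length xs}" for \<sigma> xs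
    using gsym_permute[OF that, of P] by (simp add: R_def)
  have supp: "(\<forall>x\<in>set xs. fst (snd x) = s) \<and> nf_mono xs = 1" if nz: "R xs \<noteq> 0" for xs
  proof -
    have "gsym P xs \<noteq> 0" using nz by (simp add: R_def)
    then obtain \<sigma> where \<sigma>: "\<sigma> permutes {..<length xs}" "P (permute_list \<sigma> xs) \<noteq> 0"
      by (rule gsym_nonzeroE)
    have "mset (permute_list \<sigma> xs) = mset xs" "set (permute_list \<sigma> xs) = set xs"
      using \<sigma>(1) by simp_all
    then show ?thesis
      using assms(3,4) \<sigma>(2) nf_mono_mset unfolding fermion_number_def pure_def by metis
  qed
  have closed: "Q R xs = 0" for xs
  proof -
    have "Q R xs = (1 / fact (length xs)) * Q (gsym P) xs"
    proof -
      have "slot qk j R xs = 1 / fact (length xs) * slot qk j (gsym P) xs" for j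
      proof -
        have "(\<Sum>\<^sub>\<infinity>x. qk x (xs ! j) * R (xs[j := x])) =
            (\<Sum>\<^sub>\<infinity>x. 1 / fact (length xs) * (qk x (xs ! j) * gsym P (xs[j := x])))"
          by (intro infsum_cong) (simp add: R_def)
        then show ?thesis unfolding slot_def infsum_cmult_right' by simp
      qed
      then show ?thesis by (simp only: opsum_def sum_distrib_left)
    qed
    also have "Q (gsym P) xs = gsym (Q P) xs" by (rule Q_gsym[OF P])
    also have "\<dots> = gsym (qop nabla (flip s) P) xs"
      by (rule gsym_cong) (simp add: qop_eq_Q[OF assms(4)])
    also have "\<dots> = 0"
      using assms(6) by (simp add: geq_def gsym_alt)
    finally show ?thesis by simp
  qed
  \<comment> \<open>The presence of an auxiliary field is preserved by the charge, so closedness of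
    \<open>R\<close> passes to \<open>W\<close>, the part to be shown exact.\<close>
  let ?aux = "\<lambda>xs :: lvar list. \<exists>x\<in>set xs. is_aux x"
  define V W where "V xs = (if ?aux xs then 0 else R xs)" and "W xs = (if ?aux xs then R xs else 0)" for xs
  have W: "uniformly_local N W"
    unfolding W_def by (rule uniformly_local_restrict[OF R]) simp
  have clsW: "fcls s 1 xs" if "W xs \<noteq> 0" for xs
    using that supp[of xs] by (auto simp: W_def fcls_def split: if_splits)
  have QW: "Q W xs = 0" for xs
    using Q_restrict[of ?aux R xs, OF aux_update] closed[of xs] unfolding W_def by simp
  obtain Qt where Qt: "uniformly_local N Qt" "\<And>xs. Qt xs \<noteq> 0 \<Longrightarrow> fcls s 2 xs" "\<And>xs. W xs = Q Qt xs"
    by (rule exact[OF W _ QW], erule clsW, rule that)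
  have pure: "pure s Qt" and fn: "fermion_number 2 Qt"
    using Qt(2) by (auto simp: pure_def fermion_number_def fcls_def)
  have nil: "Qt [] = 0" using Qt(2)[of "[]"] by (auto simp: fcls_def)
  \<comment> \<open>With a single odd entry reordering costs no sign, so graded symmetry is ordinary
    symmetry here.\<close>
  have symR: "R ys = R xs" if m: "mset xs = mset ys" and c: "chi_phi s xs" for xs ys
  proof -
    obtain \<sigma> where \<sigma>: "\<sigma> permutes {..<length xs}" "permute_list \<sigma> xs = ys"
      using mset_eq_permutation[OF m[symmetric]] by blast
    have "psign \<sigma> xs = 1"
    proof (rule psign_eq_1[OF \<sigma>(1)])
      have odd0: "i = 0" if "i < length xs" "is_odd (xs ! i)" for i
      proof (rule ccontr)
        assume "i \<noteq> 0"
        then have "xs ! i \<in> set (tl xs)"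
          using that(1) by (cases xs) (auto simp: nth_Cons split: nat.splits)
        then show False using c that(2) by (auto simp: chi_phi_def is_odd_def)
      qed
      then show "i = j" if "i < length xs" "j < length xs" "is_odd (xs ! i)" "is_odd (xs ! j)" for i j
        using that by metis
    qed
    then show ?thesis using sym[OF \<sigma>(1)] \<sigma>(2) by simp
  qed
  define D where "D k ms = of_nat (Suc k) * R (map2 (\<lambda>k m. (fst k, snd k, m)) (chi_phi_types s k) ms)"
    for k ms
  \<comment> \<open>Terms with \<open>k < N\<close> exhaust the lengths \<open>k + 1\<close> up to
    \<open>N\<close>; all weights are inside \<open>D\<close>, so the scalar coefficients are
    1.\<close>
  define cs where "cs = map (\<lambda>k. (1 :: complex, k, D k)) [0..<N]"
  have "is_clr nabla k (D k)" for k
    unfolding D_def[abs_def] by (rule clr_of_closed[OF R symR closed])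
  then have clr: "\<forall>(a, k, C)\<in>set cs. is_clr nabla k C"
    by (auto simp: cs_def)
  have sum: "(\<Sum>(a, k, C)\<leftarrow>cs. a * clr_tensor s k C xs) =
      (if chi_phi s xs then of_nat (length xs) * R xs else 0)" for xs
  proof -
    have "(\<Sum>(a, k, C)\<leftarrow>cs. a * clr_tensor s k C xs) = (\<Sum>k<N. clr_tensor s k (D k) xs)"
      by (simp add: cs_def o_def interv_sum_list_conv_sum_set_nat atLeast0LessThan)
    also have "\<dots> = (if chi_phi s xs then of_nat (length xs) * R xs else 0)"
      unfolding D_def[abs_def] by (rule sum_clr_tensor[OF uniformly_localD(1)[OF R]])
    finally show ?thesis .
  qed
  have "gsym P xs = gsym (\<lambda>xs. (\<Sum>(a, k, C)\<leftarrow>cs. a * clr_tensor s k C xs) + qop nabla (flip s) Qt xs) xs" for xs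
  proof -
    have "gsym (\<lambda>xs. (\<Sum>(a, k, C)\<leftarrow>cs. a * clr_tensor s k C xs) + qop nabla (flip s) Qt xs) xs
       = gsym (\<lambda>xs. if chi_phi s xs then of_nat (length xs) * R xs else 0) xs + gsym W xs"
      by (simp add: gsym_add sum qop_eq_Q[OF pure] Qt(3)[symmetric])
    also have "\<dots> = gsym V xs + gsym W xs"
    proof -
      have "gsym (\<lambda>xs. if chi_phi s xs then of_nat (length xs) * R xs else 0) xs = gsym V xs"
        unfolding V_def[abs_def] by (rule gsym_chi_phi) (erule sym supp)+
      then show ?thesis by simp
    qed
    also have "\<dots> = gsym R xs"
      unfolding gsym_add[symmetric] by (intro gsym_cong) (simp add: V_def W_def)
    finally show ?thesis by (simp add: gR)
  qed
  then show ?thesis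
    using clr uniformly_local_imp_local_functional[OF Qt(1)] fn pure nil unfolding geq_def by blast
qed

end
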